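(* Let $u$ be the solution of the dipole-emitter problem described in the context, with unit dipole direction $\mathbf{a}$ and emitter location $\mathbf{p}=(0,p)$. If $\mathbf{a}\neq(0,1)$, then for any $M>0$ there exist positive constants $C_1$, $C_2$, $A_*$ and $\epsilon_0$ depending on $\mathbf{a}$ and $M$ such that the following estimates hold for all $\mathbf{x}=(x_1,x_2)\in B_{1/2}\setminus\overline{D_1\cup D_2}$, for all $\mathbf{p}$ with $|\mathbf{p}|<M\sqrt{\epsilon}$, and for all $\epsilon<\epsilon_0$: (i) if $|\mathbf{x}-\mathbf{p}|\le C_1\epsilon$, then $$|\nabla u(\mathbf{x})|\simeq\frac{1}{|\mathbf{x}-\mathbf{p}|^2};$$ (ii) if $|\mathbf{x}-\mathbf{p}|\ge C_2\,\epsilon|\log\epsilon|$, then $$|\nabla u(\mathbf{x})|\simeq\frac{1}{\sqrt{\epsilon}\,(\epsilon+x_2^2)};$$ (iii) if $C_1\epsilon<|\mathbf{x}-\mathbf{p}|<C_2\,\epsilon|\log\epsilon|$, then $$|\nabla u(\mathbf{x})|\lesssim\frac{1}{|\mathbf{x}-\mathbf{p}|^2}\exp\left(-A_*\frac{|\mathbf{x}-\mathbf{p}|}{\epsilon}\right)+\epsilon^{-3/2}.$$ The constants involved in the relations $\simeq$ and $\lesssim$ above depend on $\mathbf{a}$ and $M$.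
   Context: Notation: $B_r(\mathbf{c})$ is the open disk in $\mathbb{R}^2$ of radius $r$ centered at $\mathbf{c}$, and $B_r=B_r(\mathbf{0})$. For $\epsilon>0$, $$D_j=B_1\big((-1)^j(1+\epsilon/2),0\big),\quad j=1,2,$$ so $\mathrm{dist}(D_1,D_2)=\epsilon$. The emitter is located on the $x_2$-axis at $\mathbf{p}=(0,p)$, its direction $\mathbf{a}$ is a unit vector, and $\delta_{\mathbf{p}}$ is the Dirac mass at $\mathbf{p}$. The dipole-emitter problem is: find $u$ such that $$\begin{cases}\Delta u=\mathbf{a}\cdot\nabla\delta_{\mathbf{p}} & \text{in }\mathbb{R}^2\setminus\overline{D_1\cup D_2},\\ u=c_j & \text{on }\partial D_j,\ j=1,2,\\ \int_{\partial D_j}\partial_\nu u\,ds=0, & j=1,2,\\ u(\mathbf{x})=O(|\mathbf{x}|^{-1}) & \text{as }|\mathbf{x}|\to\infty,\end{cases}$$ where the constants $c_1,c_2$ are not prescribed but are determined by the problem, and $\nu$ is the unit normal on $\partial D_1\cup\partial D_2$ pointing inward to $D_1\cup D_2$. This problem has a unique solution $u$ (depending on $\epsilon$, $\mathbf{p}$, $\mathbf{a}$), which is singular at $\mathbf{p}$, so pointwise estimates of $\nabla u(\mathbf{x})$ are understood for $\mathbf{x}\neq\mathbf{p}$. $\alpha\lesssim\beta$ means $\alpha\le C\beta$ for a positive constant $C$ independent of (sufficiently small) $\epsilon$; $\alpha\simeq\beta$ means $\alpha\lesssim\beta$ and $\beta\lesssim\alpha$.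
   Formalization: The direction a=(0,-1) is excluded as well as a=(0,1): for a=(0,-1), p=0 the solution is minus that for (0,1), and its gradient at x=(0,1/4) tends to zero as ε→0, so the lower bound in (ii) fails. *)

theory Defs
  imports "HOL-Analysis.Analysis" "HOL-Library.Landau_Symbols"
begin

subsection \<open>Test functions and distributions\<close>

definition partial :: "'n::finite \<Rightarrow> (real^'n \<Rightarrow> real) \<Rightarrow> real^'n \<Rightarrow> real" where
  "partial i f x = frechet_derivative f (at x) (axis i 1)"

text \<open>All iterated partial derivatives exist and are (Frechet) differentiable everywhere;
  this is the same as being of class C-infinity.\<close>

definition smooth :: "(real^'n::finite \<Rightarrow> real) \<Rightarrow> bool" where
  "smooth f \<longleftrightarrow> (\<forall>is. foldr partial is f differentiable_on UNIV)"

definition test_functions :: "(real^'n::finite) set \<Rightarrow> (real^'n \<Rightarrow> real) set" where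
  "test_functions S =
     {\<phi>. smooth \<phi> \<and> compact (closure {x. \<phi> x \<noteq> 0}) \<and> closure {x. \<phi> x \<noteq> 0} \<subseteq> S}"

text \<open>Distributions are represented as functionals; only their values on
  \<^const>\<open>test_functions\<close> are meaningful.\<close>

type_synonym 'n distr = "(real^'n \<Rightarrow> real) \<Rightarrow> real"

definition distr_partial :: "'n::finite \<Rightarrow> 'n distr \<Rightarrow> 'n distr" where
  "distr_partial i T \<phi> = - T (partial i \<phi>)"

definition distr_laplacian :: "'n::finite distr \<Rightarrow> 'n distr" where
  "distr_laplacian T \<phi> = (\<Sum>i\<in>UNIV. distr_partial i (distr_partial i T) \<phi>)"

definition distr_dir_deriv :: "real^'n::finite \<Rightarrow> 'n distr \<Rightarrow> 'n distr" where
  "distr_dir_deriv a T \<phi> = (\<Sum>i\<in>UNIV. a $ i * distr_partial i T \<phi>)"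

definition dirac :: "real^'n::finite \<Rightarrow> 'n distr" where
  "dirac p \<phi> = \<phi> p"

definition regular_distr :: "(real^'n::finite) set \<Rightarrow> (real^'n \<Rightarrow> real) \<Rightarrow> 'n distr" where
  "regular_distr S u \<phi> = (LINT x:S|lebesgue. u x * \<phi> x)"

definition locally_integrable_on :: "(real^'n::finite \<Rightarrow> real) \<Rightarrow> (real^'n) set \<Rightarrow> bool" where
  "locally_integrable_on u S \<longleftrightarrow> (\<forall>K. compact K \<and> K \<subseteq> S \<longrightarrow> u absolutely_integrable_on K)"


subsection \<open>The two disks\<close>

definition disk_center :: "real \<Rightarrow> nat \<Rightarrow> real^2" where
  "disk_center \<epsilon> j = vector [(-1) ^ j * (1 + \<epsilon> / 2), 0]"

definition disk :: "real \<Rightarrow> nat \<Rightarrow> (real^2) set" where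
  "disk \<epsilon> j = ball (disk_center \<epsilon> j) 1"

definition exterior_domain :: "real \<Rightarrow> (real^2) set" where
  "exterior_domain \<epsilon> = UNIV - closure (disk \<epsilon> 1 \<union> disk \<epsilon> 2)"

text \<open>The unit normal on the boundary of the \<open>j\<close>-th disk, pointing into that (unit) disk.\<close>

definition inward_normal :: "real \<Rightarrow> nat \<Rightarrow> real^2 \<Rightarrow> real^2" where
  "inward_normal \<epsilon> j x = disk_center \<epsilon> j - x"

text \<open>Since \<open>\<nu>\<close> points out of the domain of \<open>u\<close>, the normal derivative is the derivative at \<open>t = 0\<close>
  of \<open>u (x + t \<nu>)\<close> from the side \<open>t \<le> 0\<close>.\<close>

definition has_normal_derivative ::
    "(real^2 \<Rightarrow> real) \<Rightarrow> real \<Rightarrow> real^2 \<Rightarrow> real^2 \<Rightarrow> bool" where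
  "has_normal_derivative u d x \<nu> \<longleftrightarrow>
     ((\<lambda>t. u (x + t *\<^sub>R \<nu>)) has_real_derivative d) (at 0 within {..0})"

text \<open>Arc length on the boundary of a unit disk is the polar angle.\<close>

definition has_disk_boundary_integral ::
    "(real^2 \<Rightarrow> real) \<Rightarrow> real \<Rightarrow> real \<Rightarrow> nat \<Rightarrow> bool" where
  "has_disk_boundary_integral g I \<epsilon> j \<longleftrightarrow>
     ((\<lambda>\<theta>. g (disk_center \<epsilon> j + vector [cos \<theta>, sin \<theta>])) has_integral I) {0..2 * pi}"


subsection \<open>The dipole-emitter problem\<close>

text \<open>The equation is understood in the sense of distributions. Continuity up to the boundary,
  away from \<open>p\<close>, selects the pointwise representative of \<open>u\<close> and gives meaning to its boundary
  values; no differentiability away from \<open>p\<close> is imposed in the interior.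
  The values of \<open>u\<close> at \<open>p\<close> and inside the disks are irrelevant.\<close>

definition dipole_solution ::
    "real \<Rightarrow> real^2 \<Rightarrow> real^2 \<Rightarrow> (real^2 \<Rightarrow> real) \<Rightarrow> bool" where
  "dipole_solution \<epsilon> a p u \<longleftrightarrow>
     continuous_on (closure (exterior_domain \<epsilon>) - {p}) u \<and>
     locally_integrable_on u (exterior_domain \<epsilon>) \<and>
     (\<forall>\<phi>\<in>test_functions (exterior_domain \<epsilon>).
        distr_laplacian (regular_distr (exterior_domain \<epsilon>) u) \<phi> = distr_dir_deriv a (dirac p) \<phi>) \<and>
     (\<forall>j\<in>{1,2}. \<exists>c. \<forall>x\<in>frontier (disk \<epsilon> j). u x = c) \<and>
     (\<forall>j\<in>{1,2}. \<exists>g.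
        (\<forall>x\<in>frontier (disk \<epsilon> j). has_normal_derivative u (g x) x (inward_normal \<epsilon> j x)) \<and>
        has_disk_boundary_integral g 0 \<epsilon> j) \<and>
     u \<in> O[at_infinity](\<lambda>x. 1 / norm x)"

end

theory Submission
  imports Defs "HOL-Complex_Analysis.Complex_Analysis"
begin

text \<open>The solution is explicit. A Moebius map with its zero and pole at the two points inverse in both circles
  takes the exterior of the disks to an annulus, and its logarithm, suitably scaled, to a strip in
  which the potential of a dipole with constant boundary values is a trigonometric function; the
  \<open>2 \<pi> \<i>\<close>-periodic image sum of this potential, corrected by a linear term that removes its period,
  solves the problem. Uniqueness, for solutions in the sense of distributions, follows from a maximum
  principle for mollified functions together with the flux conditions. In the strip the dipole field
  decays exponentially with the distance to the emitter, which gives the bounds near the emitter, while the linear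
  term contributes the field of order \<open>1 / (sqrt \<epsilon> * (\<epsilon> + (x $ 2)\<^sup>2))\<close> that persists away from it.\<close>

text \<open>The three regimes come from one change of scale. At the emitter the logarithmic
  derivative of the Moebius map and the factor that normalises the strip both have order
  \<open>1 / sqrt \<epsilon>\<close>, so a displacement \<open>t\<close> from \<open>p\<close>
  becomes a strip displacement of order \<open>t / \<epsilon>\<close>. Exponential decay in the
  strip is decay in \<open>t / \<epsilon>\<close>, and it drops below the field of the linear term,
  of order \<open>sqrt \<epsilon>\<close> in the strip, once \<open>t\<close> exceeds a multiple of
  \<open>\<epsilon> * \<bar>ln \<epsilon>\<bar>\<close>. The linear term is forced: the dipole
  potential of the strip tends to opposite imaginary constants at the two ends, so the image sum
  grows by a fixed amount over each period. The obstacle on the side of uniqueness is that a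
  solution is only continuous away from \<open>p\<close> and solves the equation weakly. It is
  therefore never differentiated before it has been identified; all derivatives fall on mollifiers,
  and even the Laplacian of the dipole is obtained from Lipschitz truncations of its field. The
  solution is identified only up to an additive constant, which the gradient does not see.\<close>

section \<open>Integration by parts for compactly supported functions\<close>

lemma lipschitz_of_C1_compact_support:
  fixes g :: "'a::euclidean_space \<Rightarrow> real"
  assumes der: "\<And>x. (g has_derivative g' x) (at x)"
    and cont: "\<And>e. continuous_on UNIV (\<lambda>x. g' x e)"
    and K: "compact K" and supp: "\<And>x e. x \<notin> K \<Longrightarrow> g' x e = 0"
  obtains L where "L > 0" "\<And>x y. \<bar>g x - g y\<bar> \<le> L * norm (x - y)"
proof -
  have "\<forall>b. \<exists>B. \<forall>x. \<bar>g' x b\<bar> \<le> B"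
  proof
    fix b
    have "compact ((\<lambda>x. g' x b) ` K)"
      by (rule compact_continuous_image[OF continuous_on_subset[OF cont] K]) auto
    then obtain B where B: "\<forall>y\<in>(\<lambda>x. g' x b) ` K. norm y \<le> B"
      using compact_imp_bounded bounded_iff by metis
    have "\<bar>g' x b\<bar> \<le> max B 0" for x
      using B supp[of x b] by (cases "x \<in> K") force+
    thus "\<exists>B. \<forall>x. \<bar>g' x b\<bar> \<le> B" by blast
  qed
  then obtain B where B: "\<And>b x. \<bar>g' x b\<bar> \<le> B b" by metis
  define L where "L = (\<Sum>b\<in>Basis. B b) + 1"
  have B0: "B b \<ge> 0" for b using B[of undefined b] by linarith
  have "L > 0" unfolding L_def using B0 by (simp add: add_nonneg_pos sum_nonneg)
  have bnd: "norm (g' x h) \<le> L * norm h" for x h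
  proof -
    have lin: "linear (g' x)" using der has_derivative_linear by blast
    have "g' x h = g' x (\<Sum>b\<in>Basis. (h \<bullet> b) *\<^sub>R b)" by (simp add: euclidean_representation)
    also have "\<dots> = (\<Sum>b\<in>Basis. (h \<bullet> b) * g' x b)"
      using lin by (simp add: linear_sum linear_scale)
    finally have "norm (g' x h) \<le> (\<Sum>b\<in>Basis. \<bar>(h \<bullet> b) * g' x b\<bar>)" by simp
    also have "\<dots> \<le> (\<Sum>b\<in>Basis. norm h * B b)"
      by (intro sum_mono) (auto simp: abs_mult intro!: mult_mono B Basis_le_norm)
    also have "\<dots> = norm h * (\<Sum>b\<in>Basis. B b)" by (simp add: sum_distrib_left)
    also have "\<dots> \<le> L * norm h" unfolding L_def by (simp add: algebra_simps)
    finally show ?thesis .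
  qed
  have "\<bar>g x - g y\<bar> \<le> L * norm (x - y)" for x y
  proof -
    have "norm (g x - g y) \<le> L * norm (x - y)"
      by (rule differentiable_bound[of UNIV g g'])
        (use der bnd in \<open>auto intro: onorm_bound simp: \<open>L > 0\<close> less_imp_le\<close>)
    thus ?thesis by simp
  qed
  thus ?thesis using that \<open>L > 0\<close> by blast
qed

lemma integral_lebesgue_translation:
  fixes g :: "'a::euclidean_space \<Rightarrow> real"
  assumes "g \<in> borel_measurable borel"
  shows "integral\<^sup>L lebesgue (\<lambda>x. g (c + x)) = integral\<^sup>L lebesgue g"
proof -
  have m: "(\<lambda>x. g (c + x)) \<in> borel_measurable borel" using assms by measurable
  have "integral\<^sup>L lebesgue (\<lambda>x. g (c + x)) = integral\<^sup>L lborel (\<lambda>x. g (c + x))"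
    using m by (intro integral_completion) auto
  also have "\<dots> = integral\<^sup>L (distr lborel borel ((+) c)) g"
    using assms by (subst integral_distr) auto
  also have "\<dots> = integral\<^sup>L lebesgue g"
    using assms by (simp add: lborel_distr_plus integral_completion)
  finally show ?thesis .
qed

lemma integrable_compact_support:
  fixes g :: "'a::euclidean_space \<Rightarrow> real"
  assumes "continuous_on UNIV g" "compact K" "\<And>x. x \<notin> K \<Longrightarrow> g x = 0"
  shows "integrable lebesgue g"
proof -
  have "integrable lborel (\<lambda>x. indicator K x *\<^sub>R g x)"
    by (rule borel_integrable_compact) (use assms continuous_on_subset[OF assms(1), of K] in auto)
  moreover have "(\<lambda>x. indicator K x *\<^sub>R g x) = g" using assms(3) by (auto simp: indicator_def fun_eq_iff)
  ultimately show ?thesis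
    by (metis integrable_completion borel_measurable_integrable)
qed

text \<open>By translation invariance every difference quotient of \<open>g\<close> has integral
  zero, and the Lipschitz constant gives a common integrable majorant, so dominated convergence
  carries the zero over to the derivative. Differentiability is asked only off a negligible set,
  which admits fields with a kink along a circle.\<close>

lemma integral_directional_derivative_zero:
  fixes g g' :: "'a::euclidean_space \<Rightarrow> real"
  assumes lip: "\<And>x y. \<bar>g x - g y\<bar> \<le> L * norm (x - y)"
    and supp: "\<And>x. norm x > R \<Longrightarrow> g x = 0"
    and N: "negligible N"
    and der: "\<And>x. x \<notin> N \<Longrightarrow> ((\<lambda>t. g (x + t *\<^sub>R e)) has_real_derivative g' x) (at 0)"
    and meas: "g' \<in> borel_measurable lebesgue"
  shows "integrable lebesgue g'" "integral\<^sup>L lebesgue g' = 0"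
proof -
  define s where "s n x = real (Suc n) * (g (inverse (Suc n) *\<^sub>R e + x) - g x)" for n x
  \<comment> \<open>All shifts have length at most \<open>norm e\<close>, so the quotients
    \<open>s n\<close> vanish outside one ball of radius \<open>R + norm e\<close>.\<close>
  define w where "w x = indicator (cball 0 (R + norm e)) x *\<^sub>R (L * norm e)" for x :: 'a
  have "L-lipschitz_on UNIV g" if "L \<ge> 0"
    using lip that by (auto simp: lipschitz_on_def dist_norm)
  moreover have "L \<ge> 0"
  proof -
    \<comment> \<open>Comparing the values at \<open>0\<close> and at a unit vector forces the
      Lipschitz constant to be nonnegative.\<close>
    obtain b :: 'a where "b \<in> Basis" by (meson nonempty_Basis all_not_in_conv)
    thus ?thesis using lip[of b 0] by (simp) 
  qed
  ultimately have cont: "continuous_on UNIV g" using lipschitz_on_continuous_on by blast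
  hence gm: "g \<in> borel_measurable borel" by (simp add: borel_measurable_continuous_onI)
  have gint: "integrable lebesgue g"
    by (rule integrable_compact_support[OF cont, of "cball 0 R"]) (auto intro: supp)
  have gint': "integrable lebesgue (\<lambda>x. g (c + x))" for c
  proof (rule integrable_compact_support[of _ "cball (0::'a) (R + norm c)"])
    show "continuous_on UNIV (\<lambda>x. g (c + x))"
      by (rule continuous_on_compose2[OF cont]) (auto intro!: continuous_intros)
    fix x :: 'a assume "x \<notin> cball 0 (R + norm c)"
    hence "norm x > R + norm c" by auto
    hence "norm (c + x) > R" using norm_diff_ineq[of x c] by (simp add: add.commute)
    thus "g (c + x) = 0" by (rule supp)
  qed auto
  have s0: "integral\<^sup>L lebesgue (s n) = 0" for n
    unfolding s_def using gint gint'[of "inverse (Suc n) *\<^sub>R e"]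
    by (simp add: Bochner_Integration.integral_diff integral_lebesgue_translation[OF gm])
  have sm: "s n \<in> borel_measurable lebesgue" for n
    unfolding s_def using gint gint'[of "inverse (Suc n) *\<^sub>R e"]
    by (intro borel_measurable_times borel_measurable_diff borel_measurable_const borel_measurable_integrable)
  have wint: "integrable lebesgue w"
    unfolding w_def by (intro integrable_real_indicator integrable_scaleR_left) (auto simp: emeasure_bounded_finite less_top[symmetric] simp flip: infinity_ennreal_def)
  have "integrable lebesgue g' \<and> (\<lambda>n. integral\<^sup>L lebesgue (s n)) \<longlonglongrightarrow> integral\<^sup>L lebesgue g'"
  proof -
    have AE: "AE x in lebesgue. x \<notin> N"
      using N by (simp add: negligible_iff_null_sets AE_not_in)
    have lim: "AE x in lebesgue. (\<lambda>n. s n x) \<longlonglongrightarrow> g' x"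
      using AE
    proof eventually_elim
      case (elim x)
      have "((\<lambda>t. (g (x + t *\<^sub>R e) - g x) / t) \<longlongrightarrow> g' x) (at 0)"
        using der[OF elim] by (simp add: DERIV_def)
      hence "((\<lambda>t. (g (x + t *\<^sub>R e) - g x) / t) \<circ> (\<lambda>n. inverse (real (Suc n)))) \<longlonglongrightarrow> g' x"
        by (subst (asm) tendsto_at_iff_sequentially) (use LIMSEQ_inverse_real_of_nat in auto)
      thus ?case by (rule Lim_transform_eventually)
          (auto simp: s_def o_def divide_inverse add.commute intro!: always_eventually)
    qed
    have bound: "AE x in lebesgue. norm (s n x) \<le> w x" for n
    proof (rule AE_I2)
      fix x
      have n1: "norm (inverse (real (Suc n)) *\<^sub>R e) \<le> norm e"
        by (simp add: field_simps mult_right_mono[of 1 "1 + real n" "norm e", simplified])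
      show "norm (s n x) \<le> w x"
      proof (cases "norm x > R + norm e")
        case True
        have "norm (inverse (real (Suc n)) *\<^sub>R e + x) \<ge> norm x - norm (inverse (real (Suc n)) *\<^sub>R e)"
          using norm_diff_ineq[of x "inverse (real (Suc n)) *\<^sub>R e"] by (simp add: add.commute)
        hence "g (inverse (Suc n) *\<^sub>R e + x) = 0" using True n1 by (intro supp) linarith
        moreover have "g x = 0" using True by (intro supp) (smt (verit) norm_ge_zero)
        ultimately show ?thesis unfolding s_def w_def using \<open>L \<ge> 0\<close> by (simp add: indicator_def)
      next
        case False
        have "norm (s n x) \<le> real (Suc n) * (L * norm (inverse (real (Suc n)) *\<^sub>R e))"
          unfolding s_def using lip[of "inverse (Suc n) *\<^sub>R e + x" x]
          by (simp add: abs_mult mult_left_mono)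
        also have "\<dots> = L * norm e" by (simp add: field_simps)
        finally show ?thesis using False by (simp add: w_def indicator_def)
      qed
    qed
    show ?thesis
      using integrable_dominated_convergence[OF meas sm wint lim bound]
        integral_dominated_convergence[OF meas sm wint lim bound] by blast
  qed
  thus "integrable lebesgue g'" "integral\<^sup>L lebesgue g' = 0"
    using s0 LIMSEQ_unique[OF _ tendsto_const] by auto
qed

text \<open>The product of \<open>f\<close> and \<open>\<psi>\<close>, extended by zero outside
  \<open>K\<close>, is continuously differentiable on the whole space although \<open>f\<close> is
  controlled only on \<open>S\<close>; the integral of its derivative vanishes, and the product rule
  splits that integral.\<close>

lemma integral_by_parts_compact_support:
  fixes f \<psi> :: "'a::euclidean_space \<Rightarrow> real"
  assumes S: "open S"
    and f: "\<And>x. x \<in> S \<Longrightarrow> (f has_derivative f' x) (at x)"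
    and cf: "\<And>e. continuous_on S (\<lambda>x. f' x e)"
    and psi: "\<And>x. (\<psi> has_derivative \<psi>' x) (at x)"
    and cpsi: "\<And>e. continuous_on UNIV (\<lambda>x. \<psi>' x e)"
    and K: "compact K" "K \<subseteq> S" and supp: "\<And>x. x \<notin> K \<Longrightarrow> \<psi> x = 0"
  shows "set_integrable lebesgue S (\<lambda>x. f x * \<psi>' x e)"
    "set_integrable lebesgue S (\<lambda>x. f' x e * \<psi> x)"
    "(LINT x:S|lebesgue. f x * \<psi>' x e) = - (LINT x:S|lebesgue. f' x e * \<psi> x)"
proof -
  have psi0: "\<psi>' x e = 0" if "x \<notin> K" for x e
  proof -
    have "open (-K)" by (intro open_Compl compact_imp_closed K)
    have "(\<psi> has_derivative (\<lambda>_. 0)) (at x)"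
      by (rule has_derivative_transform_within_open[of "\<lambda>_. 0" _ _ _ "-K"])
        (use that \<open>open (-K)\<close> supp in auto)
    thus ?thesis using psi[of x] has_derivative_unique by metis
  qed
  have oK: "open (-K)" by (intro open_Compl compact_imp_closed K)
  have cov: "S \<union> -K = UNIV" using K by auto
  \<comment> \<open>\<open>ex\<close> cuts a function off outside \<open>K\<close>. Continuity of
    the result is glued from the open sets \<open>S\<close> and \<open>- K\<close>, which cover the
    space because \<open>K\<close> lies in \<open>S\<close>.\<close>
  define ex where "ex u x = (if x \<in> K then u x else 0)" for u :: "'a \<Rightarrow> real" and x
  have ex_cont: "continuous_on UNIV (ex u)" if "continuous_on S u" "\<And>x. x \<in> S - K \<Longrightarrow> u x = 0" for u
  proof -
    have "continuous_on S (ex u)"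
      by (rule continuous_on_eq[OF that(1)]) (use that in \<open>auto simp: ex_def\<close>)
    moreover have "continuous_on (-K) (ex u)"
      by (rule continuous_on_eq[of _ "\<lambda>_. 0"]) (auto simp: ex_def)
    ultimately show ?thesis using continuous_on_open_Un[OF S oK] cov by metis
  qed
  define g where "g = ex (\<lambda>x. f x * \<psi> x)"
  define g' where "g' x h = f x * \<psi>' x h + f' x h * \<psi> x" for x h
  have der: "(g has_derivative (\<lambda>h. ex (\<lambda>x. g' x h) x)) (at x)" for x
  proof (cases "x \<in> K")
    case True
    hence "x \<in> S" using K by auto
    have "((\<lambda>x. f x * \<psi> x) has_derivative g' x) (at x)"
      unfolding g'_def by (rule has_derivative_mult[OF f[OF \<open>x \<in> S\<close>] psi])
    hence "(g has_derivative g' x) (at x)"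
      by (rule has_derivative_transform_within_open[OF _ S \<open>x \<in> S\<close>]) (auto simp: g_def ex_def supp)
    thus ?thesis using True by (simp add: ex_def)
  next
    case False
    have "(g has_derivative (\<lambda>_. 0)) (at x)"
      by (rule has_derivative_transform_within_open[of "\<lambda>_. 0" _ _ _ "-K"])
        (use False oK in \<open>auto simp: g_def ex_def\<close>)
    thus ?thesis using False by (simp add: ex_def)
  qed
  have contf: "continuous_on S f"
    using f has_derivative_continuous continuous_at_imp_continuous_on by blast
  have contpsi: "continuous_on A \<psi>" for A
    using psi has_derivative_continuous continuous_at_imp_continuous_on by blast
  have c1: "continuous_on UNIV (ex (\<lambda>x. f x * \<psi>' x e))" for e
    by (rule ex_cont) (auto intro!: continuous_intros contf continuous_on_subset[OF cpsi] simp: psi0)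
  have c2: "continuous_on UNIV (ex (\<lambda>x. f' x e * \<psi> x))" for e
    by (rule ex_cont) (auto intro!: continuous_intros cf contpsi simp: supp)
  have c3: "continuous_on UNIV (\<lambda>x. ex (\<lambda>x. g' x e) x)" for e
    unfolding g'_def by (rule ex_cont)
      (auto intro!: continuous_intros cf contf contpsi continuous_on_subset[OF cpsi] simp: supp psi0)
  obtain L where L: "L > 0" "\<And>x y. \<bar>g x - g y\<bar> \<le> L * norm (x - y)"
    by (rule lipschitz_of_C1_compact_support[of g "\<lambda>x h. ex (\<lambda>x. g' x h) x" K])
      (use der c3 K in \<open>auto simp: ex_def\<close>)
  obtain R where R: "\<And>x. x \<in> K \<Longrightarrow> norm x \<le> R"
    using K compact_imp_bounded bounded_iff by metis
  have g'm: "(\<lambda>x. ex (\<lambda>x. g' x e) x) \<in> borel_measurable lebesgue"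
    using c3[of e] by (simp add: borel_measurable_continuous_onI measurable_completion)
  have z: "integral\<^sup>L lebesgue (\<lambda>x. ex (\<lambda>x. g' x e) x) = 0"
  proof (rule integral_directional_derivative_zero(2)[OF L(2), of R "{}" e])
    show "g x = 0" if "norm x > R" for x
      using R[of x] that by (force simp: g_def ex_def)
    show "((\<lambda>t. g (x + t *\<^sub>R e)) has_real_derivative ex (\<lambda>x. g' x e) x) (at 0)" for x
    proof -
      have "((\<lambda>t. x + t *\<^sub>R e) has_derivative (\<lambda>t. t *\<^sub>R e)) (at 0)"
        by (auto intro!: derivative_eq_intros)
      from has_derivative_compose[OF this, of g] der[of x]
      have "((\<lambda>t. g (x + t *\<^sub>R e)) has_derivative (\<lambda>t. ex (\<lambda>x. g' x (t *\<^sub>R e)) x)) (at 0)" by simp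
      moreover have "ex (\<lambda>x. g' x (t *\<^sub>R e)) x = t * ex (\<lambda>x. g' x e) x" for t
        using linear_scale[OF has_derivative_linear[OF der[of x]], of t e] by simp
      ultimately show ?thesis by (simp add: has_field_derivative_def mult_commute_abs)
    qed
  qed (use g'm in auto)
  have i1: "integrable lebesgue (ex (\<lambda>x. f x * \<psi>' x e))" "integrable lebesgue (ex (\<lambda>x. f' x e * \<psi> x))"
    by (rule integrable_compact_support[OF _ K(1)]; use c1 c2 in \<open>auto simp: ex_def\<close>)+
  have eq1: "(\<lambda>x. indicator S x *\<^sub>R (f x * \<psi>' x e)) = ex (\<lambda>x. f x * \<psi>' x e)"
    "(\<lambda>x. indicator S x *\<^sub>R (f' x e * \<psi> x)) = ex (\<lambda>x. f' x e * \<psi> x)"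
    using K by (auto simp: ex_def indicator_def supp psi0 fun_eq_iff)
  show "set_integrable lebesgue S (\<lambda>x. f x * \<psi>' x e)"
    "set_integrable lebesgue S (\<lambda>x. f' x e * \<psi> x)"
    unfolding set_integrable_def eq1 by (fact i1)+
  have "(\<lambda>x. ex (\<lambda>x. g' x e) x) = (\<lambda>x. ex (\<lambda>x. f x * \<psi>' x e) x + ex (\<lambda>x. f' x e * \<psi> x) x)"
    by (auto simp: ex_def g'_def)
  hence "integral\<^sup>L lebesgue (ex (\<lambda>x. f x * \<psi>' x e)) + integral\<^sup>L lebesgue (ex (\<lambda>x. f' x e * \<psi> x)) = 0"
    using z i1 by (simp add: Bochner_Integration.integral_add)
  thus "(LINT x:S|lebesgue. f x * \<psi>' x e) = - (LINT x:S|lebesgue. f' x e * \<psi> x)"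
    unfolding set_lebesgue_integral_def eq1 by simp
qed


lemma has_derivative_imp_line_derivative:
  fixes g :: "'a::real_normed_vector \<Rightarrow> real"
  assumes "(g has_derivative g') (at x)"
  shows "((\<lambda>t. g (x + t *\<^sub>R e)) has_real_derivative g' e) (at 0)"
proof -
  have "((\<lambda>t. x + t *\<^sub>R e) has_derivative (\<lambda>t. t *\<^sub>R e)) (at 0)"
    by (auto intro!: derivative_eq_intros)
  from has_derivative_compose[OF this, of g] assms
  have "((\<lambda>t. g (x + t *\<^sub>R e)) has_derivative (\<lambda>t. g' (t *\<^sub>R e))) (at 0)" by simp
  moreover have "g' (t *\<^sub>R e) = t * g' e" for t
    using linear_scale[OF has_derivative_linear[OF assms], of t e] by simp
  ultimately show ?thesis by (simp add: has_field_derivative_def mult_commute_abs)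
qed

section \<open>Smooth functions and test functions\<close>

lemma smooth_imp_differentiable: "smooth f \<Longrightarrow> f differentiable (at x)"
  unfolding smooth_def by (drule spec[of _ "[]"]) (simp add: differentiable_on_def)

lemma smooth_partial: "smooth f \<Longrightarrow> smooth (partial i f)"
  unfolding smooth_def
proof
  fix js
  assume "\<forall>is. foldr partial is f differentiable_on UNIV"
  hence "foldr partial (js @ [i]) f differentiable_on UNIV" by blast
  thus "foldr partial js (partial i f) differentiable_on UNIV" by simp
qed

lemma partial_eqI: "(f has_derivative f') (at x) \<Longrightarrow> partial i f x = f' (axis i 1)"
  unfolding partial_def by (metis frechet_derivative_at)

lemma differentiable_has_derivative_partial:
  assumes "f differentiable (at x)"
  shows "(f has_derivative (\<lambda>h. \<Sum>i\<in>UNIV. h $ i * partial i f x)) (at x)"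
proof -
  have D: "(f has_derivative frechet_derivative f (at x)) (at x)"
    using assms by (simp add: frechet_derivative_works)
  hence lin: "linear (frechet_derivative f (at x))" by (rule has_derivative_linear)
  have "frechet_derivative f (at x) h = (\<Sum>i\<in>UNIV. h $ i * partial i f x)" for h
  proof -
    have "h = (\<Sum>i\<in>UNIV. (h $ i) *\<^sub>R axis i 1)"
      using basis_expansion[of h] by (simp add: scalar_mult_eq_scaleR)
    hence "frechet_derivative f (at x) h = frechet_derivative f (at x) (\<Sum>i\<in>UNIV. (h $ i) *\<^sub>R axis i 1)"
      by simp
    also have "\<dots> = (\<Sum>i\<in>UNIV. h $ i * partial i f x)"
      unfolding partial_def using lin by (simp add: linear_sum linear_scale)
    finally show ?thesis .
  qed
  hence "frechet_derivative f (at x) = (\<lambda>h. \<Sum>i\<in>UNIV. h $ i * partial i f x)" by (rule ext)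
  thus ?thesis using D by metis
qed

lemmas smooth_has_derivative = differentiable_has_derivative_partial[OF smooth_imp_differentiable]

lemma smooth_continuous_on: "smooth f \<Longrightarrow> continuous_on A f"
  by (intro continuous_at_imp_continuous_on ballI differentiable_imp_continuous_within smooth_imp_differentiable)

lemma sum_axis_mult:
  fixes f :: "'n::finite \<Rightarrow> real"
  shows "(\<Sum>j\<in>UNIV. axis i 1 $ j * f j) = f i"
  by (simp add: axis_def if_distrib[of "\<lambda>t. t * _"] cong: if_cong)

lemma test_function_support:
  assumes "\<phi> \<in> test_functions S"
  shows "\<exists>K. compact K \<and> K \<subseteq> S \<and> (\<forall>x. x \<notin> K \<longrightarrow> \<phi> x = 0)"
proof (intro exI conjI allI impI)
  show "compact (closure {x. \<phi> x \<noteq> 0})" "closure {x. \<phi> x \<noteq> 0} \<subseteq> S"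
    using assms by (auto simp: test_functions_def)
  show "x \<notin> closure {x. \<phi> x \<noteq> 0} \<Longrightarrow> \<phi> x = 0" for x
    using closure_subset[of "{x. \<phi> x \<noteq> 0}"] by auto
qed

lemma test_functionsI:
  assumes "smooth \<phi>" "compact K" "K \<subseteq> S" "\<And>x. x \<notin> K \<Longrightarrow> \<phi> x = 0"
  shows "\<phi> \<in> test_functions S"
proof -
  have "closure {x. \<phi> x \<noteq> 0} \<subseteq> K"
    by (rule closure_minimal) (use assms compact_imp_closed in auto)
  thus ?thesis unfolding test_functions_def
    using assms compact_Int_closed[OF assms(2) closed_closure, of "{x. \<phi> x \<noteq> 0}"]
    by (auto simp: inf_absorb2)
qed

lemma test_functions_smooth: "\<phi> \<in> test_functions S \<Longrightarrow> smooth \<phi>"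
  by (simp add: test_functions_def)

lemma test_functions_mono: "S \<subseteq> T \<Longrightarrow> test_functions S \<subseteq> test_functions T"
  by (auto simp: test_functions_def)

lemma partial_eq_0_outside:
  assumes "compact K" "\<And>x. x \<notin> K \<Longrightarrow> \<phi> x = 0" "x \<notin> K"
  shows "partial i \<phi> x = 0"
proof -
  have "open (-K)" by (intro open_Compl compact_imp_closed assms)
  have "(\<phi> has_derivative (\<lambda>_. 0)) (at x)"
    by (rule has_derivative_transform_within_open[of "\<lambda>_. 0" _ _ _ "-K"])
      (use assms \<open>open (-K)\<close> in auto)
  thus ?thesis by (rule partial_eqI)
qed

lemma test_functions_partial:
  assumes "\<phi> \<in> test_functions S"
  shows "partial i \<phi> \<in> test_functions S"
proof -
  obtain K where "compact K" "K \<subseteq> S" "\<And>x. x \<notin> K \<Longrightarrow> \<phi> x = 0"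
    using test_function_support[OF assms] by auto
  thus ?thesis
    by (intro test_functionsI[of _ K] smooth_partial test_functions_smooth[OF assms] partial_eq_0_outside[of K])
qed

lemma test_integral_by_parts:
  assumes S: "open S"
    and f: "\<And>x. x \<in> S \<Longrightarrow> (f has_derivative f' x) (at x)"
    and cf: "\<And>e. continuous_on S (\<lambda>x. f' x e)"
    and phi: "\<phi> \<in> test_functions S"
  shows "(LINT x:S|lebesgue. f x * partial i \<phi> x) = - (LINT x:S|lebesgue. f' x (axis i 1) * \<phi> x)"
proof -
  obtain K where K: "compact K" "K \<subseteq> S" "\<And>x. x \<notin> K \<Longrightarrow> \<phi> x = 0"
    using test_function_support[OF phi] by auto
  have c: "continuous_on UNIV (\<lambda>x. \<Sum>j\<in>UNIV. e $ j * partial j \<phi> x)" for e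
    by (intro continuous_intros smooth_continuous_on smooth_partial test_functions_smooth[OF phi])
  show ?thesis
    using integral_by_parts_compact_support(3)[OF S f cf smooth_has_derivative[OF test_functions_smooth[OF phi]]
        c K, where e = "axis i 1"]
    by (simp add: sum_axis_mult)
qed

lemma test_function_lipschitz:
  assumes "\<phi> \<in> test_functions S"
  obtains L where "L > 0" "\<And>x y. \<bar>\<phi> x - \<phi> y\<bar> \<le> L * norm (x - y)"
proof -
  obtain K where K: "compact K" "K \<subseteq> S" "\<And>x. x \<notin> K \<Longrightarrow> \<phi> x = 0"
    using test_function_support[OF assms] by auto
  have c: "continuous_on UNIV (\<lambda>x. \<Sum>j\<in>UNIV. e $ j * partial j \<phi> x)" for e
    by (intro continuous_intros smooth_continuous_on smooth_partial test_functions_smooth[OF assms])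
  show ?thesis
    by (rule lipschitz_of_C1_compact_support[OF smooth_has_derivative[OF test_functions_smooth[OF assms]] c K(1)])
      (use partial_eq_0_outside[OF K(1,3)] that in auto)
qed

lemma test_function_bounded:
  assumes "\<phi> \<in> test_functions S"
  obtains B where "B > 0" "\<And>x. \<bar>\<phi> x\<bar> \<le> B"
proof -
  obtain K where K: "compact K" "K \<subseteq> S" "\<And>x. x \<notin> K \<Longrightarrow> \<phi> x = 0"
    using test_function_support[OF assms] by auto
  have "compact (\<phi> ` K)"
    by (rule compact_continuous_image[OF smooth_continuous_on[OF test_functions_smooth[OF assms]] K(1)])
  then obtain B where B: "\<forall>y\<in>\<phi> ` K. norm y \<le> B" using compact_imp_bounded bounded_iff by metis
  have "\<bar>\<phi> x\<bar> \<le> max B 1" for x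
    using B K(3)[of x] by (cases "x \<in> K") force+
  thus ?thesis using that[of "max B 1"] by auto
qed

section \<open>An algebra of mollifiers\<close>

definition flat_exp :: "real poly \<Rightarrow> real \<Rightarrow> real" where
  "flat_exp P t = (if t > 0 then poly P (1 / t) * exp (- (1 / t)) else 0)"

lemma poly_times_exp_minus_tendsto_0: "((\<lambda>x::real. poly P x * exp (- x)) \<longlongrightarrow> 0) at_top"
proof -
  have "((\<lambda>x::real. \<Sum>i\<le>degree P. coeff P i * (x ^ i / exp x)) \<longlongrightarrow> (\<Sum>i\<le>degree P. coeff P i * 0)) at_top"
    by (intro tendsto_intros tendsto_power_div_exp_0)
  thus ?thesis by (simp add: poly_altdef sum_distrib_right exp_minus divide_inverse mult.assoc)
qed

text \<open>With \<open>s = 1 / t\<close> the derivative of \<open>P(s) exp(-s)\<close> is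
  \<open>s^2 (P(s) - P'(s)) exp(-s)\<close>, because \<open>ds/dt = - s^2\<close>. The family is
  thus closed under differentiation, and \<open>[:0, 0, 1:]\<close> is the factor
  \<open>s^2\<close>.\<close>

lemma flat_exp_has_derivative:
  "(flat_exp P has_real_derivative flat_exp ([:0, 0, 1:] * (P - pderiv P)) t) (at t)"
proof -
  consider "t > 0" | "t < 0" | "t = 0" by linarith
  thus ?thesis
  proof cases
    case 1
    have "((\<lambda>t. poly P (1 / t) * exp (- (1 / t))) has_real_derivative
        poly ([:0, 0, 1:] * (P - pderiv P)) (1 / t) * exp (- (1 / t))) (at t)"
      using 1 by (auto intro!: derivative_eq_intros poly_DERIV[THEN DERIV_chain2]
          simp: field_simps power2_eq_square)
    hence "(flat_exp P has_real_derivative poly ([:0, 0, 1:] * (P - pderiv P)) (1 / t) * exp (- (1 / t))) (at t)"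
      by (rule has_field_derivative_transform_within_open[of _ _ _ "{0<..}"]) (use 1 in \<open>auto simp: flat_exp_def\<close>)
    thus ?thesis using 1 by (simp add: flat_exp_def)
  next
    case 2
    have "(flat_exp P has_real_derivative 0) (at t)"
      by (rule has_field_derivative_transform_within_open[of "\<lambda>_. 0" _ _ "{..<0}"]) (use 2 in \<open>auto simp: flat_exp_def\<close>)
    thus ?thesis using 2 by (simp add: flat_exp_def)
  next
    case 3
    \<comment> \<open>The difference quotient at zero is \<open>P(1/h) exp(-1/h) / h\<close>; the
      factor \<open>[:0, 1:]\<close> absorbs the division by \<open>h\<close>, and the exponential
      beats any polynomial in \<open>1 / h\<close>.\<close>
    have "((\<lambda>h. poly ([:0, 1:] * P) (inverse h) * exp (- inverse h)) \<longlongrightarrow> 0) (at_right (0::real))"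
      by (rule filterlim_compose[OF poly_times_exp_minus_tendsto_0 filterlim_inverse_at_top_right])
    hence r: "((\<lambda>h. flat_exp P h / h) \<longlongrightarrow> 0) (at_right 0)"
      by (rule Lim_transform_eventually) (auto simp: eventually_at_filter flat_exp_def field_simps)
    have l: "((\<lambda>h. flat_exp P h / h) \<longlongrightarrow> 0) (at_left 0)"
      by (rule Lim_transform_eventually[of "\<lambda>_. 0"]) (auto simp: eventually_at_filter flat_exp_def)
    have "((\<lambda>h. flat_exp P h / h) \<longlongrightarrow> 0) (at 0)"
      using r l by (simp add: filterlim_at_split)
    thus ?thesis using 3 by (simp add: DERIV_def flat_exp_def)
  qed
qed

text \<open>An algebra of smooth functions that is closed under partial derivatives by construction and
  in which the mixed partial derivatives visibly commute; it contains the mollifiers.\<close>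

inductive_set bumps :: "(real^'n::finite \<Rightarrow> real) set" where
  base: "(\<lambda>x. flat_exp P (c + d * x $ i)) \<in> bumps"
| add: "f \<in> bumps \<Longrightarrow> g \<in> bumps \<Longrightarrow> (\<lambda>x. f x + g x) \<in> bumps"
| mult: "f \<in> bumps \<Longrightarrow> g \<in> bumps \<Longrightarrow> (\<lambda>x. f x * g x) \<in> bumps"

lemma flat_exp_coordinate_derivative:
  "((\<lambda>x::real^'n::finite. flat_exp P (c + d * x $ i)) has_derivative
     (\<lambda>h. flat_exp ([:0, 0, 1:] * (P - pderiv P)) (c + d * x $ i) * (d * h $ i))) (at x)"
proof -
  have "((\<lambda>x::real^'n. c + d * x $ i) has_derivative (\<lambda>h. d * h $ i)) (at x)"
    by (auto intro!: derivative_eq_intros bounded_linear_imp_has_derivative bounded_linear_vec_nth)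
  from has_derivative_compose[OF this flat_exp_has_derivative[THEN has_field_derivative_imp_has_derivative]]
  show ?thesis by (simp add: mult.commute)
qed

text \<open>A derivative in another coordinate is encoded by the zero polynomial, so that every
  partial derivative has again the shape required by the rule \<open>base\<close>.\<close>

lemma partial_flat_exp_coordinate:
  "partial j (\<lambda>x::real^'n::finite. flat_exp P (c + d * x $ i)) =
     (\<lambda>x. flat_exp (if i = j then smult d ([:0, 0, 1:] * (P - pderiv P)) else 0) (c + d * x $ i))"
  by (rule ext, subst partial_eqI[OF flat_exp_coordinate_derivative])
    (auto simp: axis_def flat_exp_def)

lemma partial_add:
  assumes "f differentiable (at x)" "g differentiable (at x)"
  shows "partial i (\<lambda>x. f x + g x) x = partial i f x + partial i g x"
  using has_derivative_add[OF assms[unfolded frechet_derivative_works]]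
  by (subst partial_eqI) (auto simp: partial_def)

lemma partial_mult:
  assumes "f differentiable (at x)" "g differentiable (at x)"
  shows "partial i (\<lambda>x. f x * g x) x = f x * partial i g x + partial i f x * g x"
  using has_derivative_mult[OF assms[unfolded frechet_derivative_works]]
  by (subst partial_eqI) (auto simp: partial_def)

lemma bumps_differentiable: "f \<in> bumps \<Longrightarrow> f differentiable (at x)"
proof (induction rule: bumps.induct)
  case (base P c d i)
  thus ?case using flat_exp_coordinate_derivative differentiableI by blast
qed auto

lemma bumps_partial: "f \<in> bumps \<Longrightarrow> partial i f \<in> bumps"
proof (induction rule: bumps.induct)
  case (base P c d j)
  show ?case unfolding partial_flat_exp_coordinate by (rule bumps.base)
next
  case (add f g)
  have "partial i (\<lambda>x. f x + g x) = (\<lambda>x. partial i f x + partial i g x)"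
    using add bumps_differentiable by (intro ext partial_add) auto
  thus ?case using add by (auto intro: bumps.intros)
next
  case (mult f g)
  have "partial i (\<lambda>x. f x * g x) = (\<lambda>x. f x * partial i g x + partial i f x * g x)"
    using mult bumps_differentiable by (intro ext partial_mult) auto
  thus ?case using mult by (auto intro: bumps.intros)
qed

lemma bumps_smooth: "f \<in> bumps \<Longrightarrow> smooth f"
  unfolding smooth_def
proof
  fix "is" assume f: "f \<in> bumps"
  have "foldr partial is f \<in> bumps" by (induction "is") (auto intro: bumps_partial f)
  thus "foldr partial is f differentiable_on UNIV"
    by (simp add: differentiable_on_def bumps_differentiable)
qed

text \<open>Schwarz's theorem by induction along the generation of the algebra: for a generator both
  mixed derivatives in distinct coordinates vanish, and the product rule is symmetric in the two
  differentiations. \<open>cut_field_laplacian\<close> depends on this exchange.\<close>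

lemma bumps_partial_commute: "f \<in> bumps \<Longrightarrow> partial i (partial j f) = partial j (partial i f)"
proof (induction rule: bumps.induct)
  case (base P c d k)
  show ?case by (auto simp: partial_flat_exp_coordinate)
next
  case (add f g)
  have 1: "partial i (\<lambda>x. f x + g x) = (\<lambda>x. partial i f x + partial i g x)" for i
    using add bumps_differentiable by (intro ext partial_add) auto
  have "partial i (\<lambda>x. partial j f x + partial j g x) = (\<lambda>x. partial i (partial j f) x + partial i (partial j g) x)" for i j
    using add bumps_differentiable bumps_partial by (intro ext partial_add) auto
  thus ?case using add by (simp add: 1)
next
  case (mult f g)
  note d = bumps_differentiable bumps_partial mult.hyps
  have 1: "partial i (\<lambda>x. f x * g x) = (\<lambda>x. f x * partial i g x + partial i f x * g x)" for i
    by (intro ext partial_mult d)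
  have "partial i (\<lambda>x. f x * partial j g x + partial j f x * g x) =
     (\<lambda>x. (f x * partial i (partial j g) x + partial i f x * partial j g x) +
       (partial j f x * partial i g x + partial i (partial j f) x * g x))" for i j
    by (intro ext, subst partial_add) (auto intro!: differentiable_mult d simp: partial_mult d)
  thus ?case using mult by (simp add: 1 algebra_simps)
qed

text \<open>Product of four one-sided cut-offs, positive exactly on the open square of half side
  \<open>r\<close> centred at \<open>a\<close>. The factors \<open>1\<close> and \<open>(-1)\<close>
  stand before the coordinates to match the affine arguments of \<open>bumps.base\<close>.\<close>

definition box_bump :: "real \<Rightarrow> real^2 \<Rightarrow> real^2 \<Rightarrow> real" where
  "box_bump r a x = flat_exp 1 ((r - a $ 1) + 1 * x $ 1) * flat_exp 1 ((r + a $ 1) + (-1) * x $ 1) *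
     (flat_exp 1 ((r - a $ 2) + 1 * x $ 2) * flat_exp 1 ((r + a $ 2) + (-1) * x $ 2))"

lemma box_bump_in_bumps: "box_bump r a \<in> bumps"
  unfolding box_bump_def[abs_def] by (intro bumps.intros)

lemma box_bump_shift: "box_bump r a x = box_bump r 0 (x - a)"
  by (simp add: box_bump_def algebra_simps)

lemma flat_exp_1_nonneg: "flat_exp 1 t \<ge> 0" by (simp add: flat_exp_def)

lemma box_bump_nonneg: "box_bump r a x \<ge> 0"
  unfolding box_bump_def by (intro mult_nonneg_nonneg flat_exp_1_nonneg)

lemma box_bump_pos: "norm (x - a) < r \<Longrightarrow> box_bump r a x > 0"
  using component_le_norm_cart[of "x - a" 1] component_le_norm_cart[of "x - a" 2]
  unfolding box_bump_def by (intro mult_pos_pos) (auto simp: flat_exp_def abs_if split: if_splits)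

text \<open>The sum of the coordinate moduli is at least the norm, so one of them reaches
  \<open>r\<close>. The crude radius \<open>2 * r\<close> is the support radius used from here
  on.\<close>

lemma box_bump_eq_0:
  assumes "norm (x - a) \<ge> 2 * r"
  shows "box_bump r a x = 0"
proof -
  have "norm (x - a) \<le> \<bar>(x - a) $ 1\<bar> + \<bar>(x - a) $ 2\<bar>"
    using norm_le_l1_cart[of "x - a"] by (simp add: sum_2)
  hence "\<bar>(x - a) $ 1\<bar> \<ge> r \<or> \<bar>(x - a) $ 2\<bar> \<ge> r" using assms by linarith
  thus ?thesis unfolding box_bump_def by (auto simp: flat_exp_def abs_if split: if_splits)
qed

lemma box_bump_test_function:
  assumes "cball a (2 * r) \<subseteq> S"
  shows "box_bump r a \<in> test_functions S"
  by (rule test_functionsI[OF bumps_smooth[OF box_bump_in_bumps] compact_cball assms])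
    (auto intro!: box_bump_eq_0 simp: dist_norm norm_minus_commute)

lemma integrable_box_bump: "integrable lebesgue (box_bump r a)"
  by (rule integrable_compact_support[OF _ compact_cball, of _ a "2 * r"])
    (auto intro!: box_bump_eq_0 smooth_continuous_on bumps_smooth box_bump_in_bumps simp: dist_norm norm_minus_commute)

lemma integral_box_bump: "integral\<^sup>L lebesgue (box_bump r a) = integral\<^sup>L lebesgue (box_bump r 0)"
proof -
  have "box_bump r 0 \<in> borel_measurable borel"
    by (intro borel_measurable_continuous_onI smooth_continuous_on bumps_smooth box_bump_in_bumps)
  from integral_lebesgue_translation[OF this, of "-a"]
  show ?thesis by (simp add: box_bump_shift[of r a, abs_def])
qed

lemma integral_box_bump_pos:
  assumes "r > 0"
  shows "integral\<^sup>L lebesgue (box_bump r a) > 0"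
proof -
  have "integral\<^sup>L lebesgue (box_bump r a) \<noteq> 0"
  proof
    assume "integral\<^sup>L lebesgue (box_bump r a) = 0"
    hence "AE x in lebesgue. box_bump r a x = 0"
      using integral_nonneg_eq_0_iff_AE[OF integrable_box_bump] box_bump_nonneg by auto
    hence "AE x in lebesgue. x \<notin> ball a r"
      by eventually_elim (use box_bump_pos[of _ a r] in \<open>force simp: dist_norm norm_minus_commute\<close>)
    hence "negligible (ball a r)"
      by (simp add: negligible_iff_null_sets AE_iff_null_sets)
    thus False using assms open_not_negligible[of "ball a r"] by simp
  qed
  moreover have "integral\<^sup>L lebesgue (box_bump r a) \<ge> 0"
    by (intro integral_nonneg_AE) (simp add: box_bump_nonneg)
  ultimately show ?thesis by linarith
qed


section \<open>Complex coordinates and weak harmonicity\<close>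

definition cx :: "real^2 \<Rightarrow> complex" where "cx x = Complex (x $ 1) (x $ 2)"

lemma bounded_linear_cx: "bounded_linear cx"
proof -
  have "linear cx" by (intro linearI) (simp_all add: cx_def complex_eq_iff)
  thus ?thesis using linear_conv_bounded_linear by blast
qed

lemmas cx_has_derivative = bounded_linear_imp_has_derivative[OF bounded_linear_cx]

lemma continuous_on_cx [continuous_intros]: "continuous_on A cx"
  by (rule linear_continuous_on[OF bounded_linear_cx])

lemma cx_add: "cx (x + y) = cx x + cx y"
  and cx_diff: "cx (x - y) = cx x - cx y"
  and cx_scaleR: "cx (c *\<^sub>R x) = of_real c * cx x"
  by (simp_all add: cx_def complex_eq_iff)

lemma cx_axis [simp]: "cx (axis 1 1) = 1" "cx (axis 2 1) = \<i>"
  by (simp_all add: cx_def complex_eq_iff axis_def)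

lemma norm_cx: "norm (cx x) = norm x"
  by (simp add: cx_def cmod_def norm_vec_def L2_set_def sum_2)

lemma UNIV_2_eq: "UNIV = {1, 2::2}"
  using exhaust_2 by auto

lemma distr_laplacian_regular:
  "distr_laplacian (regular_distr S u) \<phi> =
     (\<Sum>i\<in>UNIV. LINT x:S|lebesgue. u x * partial i (partial i \<phi>) x)"
  by (simp add: distr_laplacian_def distr_partial_def regular_distr_def)

text \<open>The gradient of the real part of a holomorphic function with derivative \<open>G\<close>, written so that
  no global primitive of \<open>G\<close> is needed.\<close>

lemma weakly_harmonic_of_holomorphic_gradient:
  fixes v :: "real^2 \<Rightarrow> real"
  assumes U: "open U" and G: "G holomorphic_on U" and S: "S = cx -` U"
    and v: "\<And>x. x \<in> S \<Longrightarrow> (v has_derivative (\<lambda>h. Re (G (cx x) * cx h))) (at x)"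
    and phi: "\<phi> \<in> test_functions S"
  shows "distr_laplacian (regular_distr S v) \<phi> = 0"
proof -
  have oS: "open S"
    unfolding S using continuous_on_cx U by (metis open_vimage)
  have cG: "continuous_on S (\<lambda>x. G (cx x))"
    by (rule continuous_on_compose2[OF holomorphic_on_imp_continuous_on[OF G] continuous_on_cx]) (auto simp: S)
  have cG': "continuous_on S (\<lambda>x. deriv G (cx x))"
    by (rule continuous_on_compose2[OF holomorphic_on_imp_continuous_on[OF holomorphic_deriv[OF G U]] continuous_on_cx])
      (auto simp: S)
  have dG: "((\<lambda>x. G (cx x)) has_derivative (\<lambda>h. deriv G (cx x) * cx h)) (at x)" if "x \<in> S" for x
  proof -
    have "(G has_derivative (*) (deriv G (cx x))) (at (cx x))"
      using holomorphic_derivI[OF G U] that by (auto simp: S has_field_derivative_def)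
    from has_derivative_compose[OF cx_has_derivative this] show ?thesis .
  qed
  note p = test_functions_partial[OF phi]
  have 1: "(LINT x:S|lebesgue. v x * partial i (partial i \<phi>) x) =
      - (LINT x:S|lebesgue. Re (G (cx x) * cx (axis i 1)) * partial i \<phi> x)" for i
    by (rule test_integral_by_parts[OF oS v _ p]) (auto intro!: continuous_intros cG)
  have 2: "(LINT x:S|lebesgue. Re (G (cx x) * cx (axis i 1)) * partial i \<phi> x) =
      - (LINT x:S|lebesgue. Re (deriv G (cx x) * cx (axis i 1) * cx (axis i 1)) * \<phi> x)" for i
  proof (rule test_integral_by_parts[OF oS _ _ phi, where f' = "\<lambda>x h. Re (deriv G (cx x) * cx h * cx (axis i 1))"])
    fix x assume "x \<in> S"
    from has_derivative_Re[OF has_derivative_mult_left[OF dG[OF this], of "cx (axis i 1)"]]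
    show "((\<lambda>x. Re (G (cx x) * cx (axis i 1))) has_derivative
        (\<lambda>h. Re (deriv G (cx x) * cx h * cx (axis i 1)))) (at x)" .
  qed (auto intro!: continuous_intros cG')
  \<comment> \<open>The directions \<open>axis 1 1\<close> and \<open>axis 2 1\<close> become
    \<open>1\<close> and \<open>\<i>\<close>, whose squares are opposite, so the two second
    derivatives cancel.\<close>
  show ?thesis
    unfolding distr_laplacian_regular 1 2
    by (simp add: sum_2 mult.assoc set_lebesgue_integral_def)
qed

lemma continuous_bounded_imp_set_integrable:
  fixes u \<phi> :: "real^2 \<Rightarrow> real"
  assumes u: "locally_integrable_on u S" and phi: "\<phi> \<in> test_functions S"
  shows "set_integrable lebesgue S (\<lambda>x. u x * \<phi> x)"
proof -
  obtain K where K: "compact K" "K \<subseteq> S" "\<And>x. x \<notin> K \<Longrightarrow> \<phi> x = 0"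
    using test_function_support[OF phi] by auto
  obtain B where B: "B > 0" "\<And>x. \<bar>\<phi> x\<bar> \<le> B" using test_function_bounded[OF phi] by blast
  have uK: "integrable lebesgue (\<lambda>x. indicator K x *\<^sub>R u x)"
    using u K unfolding locally_integrable_on_def set_integrable_def by blast
  have phim: "\<phi> \<in> borel_measurable lebesgue"
    using smooth_continuous_on[OF test_functions_smooth[OF phi], of UNIV]
    by (simp add: borel_measurable_continuous_onI measurable_completion)
  have "integrable lebesgue (\<lambda>x. (indicator K x *\<^sub>R u x) * \<phi> x)"
  proof (rule Bochner_Integration.integrable_bound[of _ "\<lambda>x. B *\<^sub>R (indicator K x *\<^sub>R u x)"])
    show "integrable lebesgue (\<lambda>x. B *\<^sub>R (indicator K x *\<^sub>R u x))" using uK by simp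
    show "(\<lambda>x. (indicator K x *\<^sub>R u x) * \<phi> x) \<in> borel_measurable lebesgue"
      by (intro borel_measurable_times borel_measurable_integrable[OF uK] phim)
    show "AE x in lebesgue. norm ((indicator K x *\<^sub>R u x) * \<phi> x) \<le> norm (B *\<^sub>R (indicator K x *\<^sub>R u x))"
      by (rule AE_I2) (use B in \<open>auto simp: abs_mult indicator_def mult.commute intro!: mult_right_mono\<close>)
  qed
  moreover have "(\<lambda>x. (indicator K x *\<^sub>R u x) * \<phi> x) = (\<lambda>x. indicator S x *\<^sub>R (u x * \<phi> x))"
    using K by (auto simp: indicator_def fun_eq_iff)
  ultimately show ?thesis unfolding set_integrable_def by metis
qed

lemma regular_laplacian_linear:
  fixes u v :: "real^2 \<Rightarrow> real"
  assumes u: "locally_integrable_on u S" and v: "locally_integrable_on v S" and phi: "\<phi> \<in> test_functions S"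
  shows "distr_laplacian (regular_distr S (\<lambda>x. a * u x + b * v x)) \<phi> =
    a * distr_laplacian (regular_distr S u) \<phi> + b * distr_laplacian (regular_distr S v) \<phi>"
proof -
  have "(LINT x:S|lebesgue. (a * u x + b * v x) * partial i (partial i \<phi>) x) =
     a * (LINT x:S|lebesgue. u x * partial i (partial i \<phi>) x) +
     b * (LINT x:S|lebesgue. v x * partial i (partial i \<phi>) x)" for i
  proof -
    note p = test_functions_partial[OF test_functions_partial[OF phi]]
    have "(LINT x:S|lebesgue. (a * u x + b * v x) * partial i (partial i \<phi>) x) =
       (LINT x:S|lebesgue. a * (u x * partial i (partial i \<phi>) x) + b * (v x * partial i (partial i \<phi>) x))"
      by (simp add: algebra_simps)
    also have "\<dots> = (LINT x:S|lebesgue. a * (u x * partial i (partial i \<phi>) x)) +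
        (LINT x:S|lebesgue. b * (v x * partial i (partial i \<phi>) x))"
      by (intro set_integral_add set_integrable_mult_right continuous_bounded_imp_set_integrable u v p)
    finally show ?thesis by simp
  qed
  thus ?thesis
    unfolding distr_laplacian_regular by (simp add: sum.distrib sum_distrib_left)
qed

lemma locally_integrable_on_continuous:
  fixes u :: "real^2 \<Rightarrow> real"
  assumes "continuous_on S u"
  shows "locally_integrable_on u S"
  unfolding locally_integrable_on_def set_integrable_def
proof (intro allI impI)
  fix K assume K: "compact K \<and> K \<subseteq> S"
  have "integrable lborel (\<lambda>x. indicator K x *\<^sub>R u x)"
    by (rule borel_integrable_compact) (use K continuous_on_subset[OF assms, of K] in auto)
  thus "integrable lebesgue (\<lambda>x. indicator K x *\<^sub>R u x)"
    by (metis integrable_completion borel_measurable_integrable)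
qed

lemma locally_integrable_on_add:
  "locally_integrable_on u S \<Longrightarrow> locally_integrable_on v S \<Longrightarrow> locally_integrable_on (\<lambda>x. a * u x + b * v x) S"
  unfolding locally_integrable_on_def
  by (intro allI impI set_integral_add set_integrable_mult_right) auto

section \<open>The dipole potential\<close>

lemma measure_ball_2: "r \<ge> 0 \<Longrightarrow> measure lebesgue (ball (p::real^2) r) = pi * r^2"
  using content_ball[of r p] by (simp add: unit_ball_vol_2 measure_completion)

text \<open>Dyadic summation: at distance between \<open>2^-(k+1)\<close> and \<open>2^-k\<close>
  from \<open>p\<close> the function is at most \<open>2^(k+1)\<close>, while the disk of radius
  \<open>2^-k\<close> has area \<open>pi * 4^-k\<close>. The integrals of the majorants are
  \<open>2 * pi * 2^-k\<close> and have a finite sum.\<close>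

lemma integrable_inverse_norm_ball:
  fixes p :: "real^2"
  shows "integrable lebesgue (\<lambda>x. indicator (ball p 1) x / norm (x - p))"
proof (rule integrableI_bounded)
  define F where "F n x = ennreal (2 ^ Suc n) * indicator (cball p ((1/2) ^ n)) x" for n and x :: "real^2"
  have m: "(\<lambda>x. indicator (ball p 1) x / norm (x - p)) \<in> borel_measurable borel"
    by (intro borel_measurable_divide borel_measurable_indicator) auto
  thus "(\<lambda>x. indicator (ball p 1) x / norm (x - p)) \<in> borel_measurable lebesgue"
    by (simp add: measurable_completion)
  have le: "ennreal (norm (indicator (ball p 1) x / norm (x - p))) \<le> (\<Sum>n. F n x)" for x
  proof (cases "x \<in> ball p 1 \<and> x \<noteq> p")
    case False
    thus ?thesis by (auto simp: indicator_def)
  next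
    case True
    define d where "d = norm (x - p)"
    have d: "d > 0" "d < 1" using True by (auto simp: d_def dist_norm norm_minus_commute)
    obtain N where N: "(1/2::real) ^ N < d" using real_arch_pow_inv[of d "1/2"] d by auto
    \<comment> \<open>The least such index cannot be \<open>0\<close> because \<open>d < 1\<close>;
      its predecessor \<open>k\<close> gives the dyadic ring that contains \<open>x\<close>.\<close>
    define n where "n = (LEAST n. (1/2::real) ^ n < d)"
    have n1: "(1/2::real) ^ n < d" unfolding n_def by (rule LeastI[where P = "\<lambda>n. (1/2::real) ^ n < d", OF N])
    then obtain k where k: "n = Suc k" using d by (cases n) auto
    have n2: "d \<le> (1/2::real) ^ k" using not_less_Least[of k "\<lambda>n. (1/2::real) ^ n < d"] k
      by (simp add: n_def)
    have "x \<in> cball p ((1/2) ^ k)" using n2 by (simp add: d_def dist_norm norm_minus_commute)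
    hence "F k x = ennreal (2 ^ Suc k)" by (simp add: F_def)
    moreover have "1 / d \<le> 2 ^ Suc k" using n1 d k by (simp add: field_simps power_divide)
    ultimately have "ennreal (1 / d) \<le> F k x" by (simp add: ennreal_leI)
    also have "F k x = (\<Sum>n\<in>{k}. F n x)" by simp
    also have "\<dots> \<le> (\<Sum>n. F n x)" by (rule sum_le_suminf) auto
    finally show ?thesis using True by (simp add: d_def)
  qed
  have Fi: "(\<integral>\<^sup>+ x. F n x \<partial>lebesgue) = ennreal (2 * pi * (1/2) ^ n)" for n
  proof -
    have "emeasure lebesgue (cball p ((1/2) ^ n)) = ennreal (pi * ((1/2) ^ n)\<^sup>2)"
      using content_cball[of "(1/2) ^ n" p] emeasure_bounded_finite[of "cball p ((1/2) ^ n)"]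
      by (simp add: unit_ball_vol_2 emeasure_eq_ennreal_measure less_top)
    hence "(\<integral>\<^sup>+ x. F n x \<partial>lebesgue) = ennreal (2 ^ Suc n) * ennreal (pi * ((1/2) ^ n)\<^sup>2)"
      unfolding F_def by (subst nn_integral_cmult_indicator) auto
    also have "\<dots> = ennreal (2 ^ Suc n * (pi * ((1/2) ^ n)\<^sup>2))" by (simp add: ennreal_mult)
    also have "2 ^ Suc n * (pi * ((1/2) ^ n)\<^sup>2) = 2 * pi * (1/2::real) ^ n"
      by (simp add: power_divide field_simps power2_eq_square)
    finally show ?thesis .
  qed
  have Fm: "F n \<in> borel_measurable lebesgue" for n
  proof -
    have "F n = (\<lambda>x. ennreal (2 ^ Suc n) * indicator (cball p ((1/2) ^ n)) x)" by (simp add: F_def fun_eq_iff)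
    thus ?thesis by (simp only:) (intro borel_measurable_times_ennreal borel_measurable_indicator borel_measurable_const, simp)
  qed
  have "(\<integral>\<^sup>+ x. ennreal (norm (indicator (ball p 1) x / norm (x - p))) \<partial>lebesgue)
      \<le> (\<integral>\<^sup>+ x. (\<Sum>n. F n x) \<partial>lebesgue)"
    by (intro nn_integral_mono le)
  also have "\<dots> = (\<Sum>n. ennreal (2 * pi * (1/2) ^ n))"
    by (subst nn_integral_suminf) (auto simp: Fi Fm)
  also have "\<dots> < \<infinity>"
  proof -
    have "summable (\<lambda>n. 2 * pi * (1/2) ^ n)" by (intro summable_mult summable_geometric) simp
    hence "(\<Sum>n. ennreal (2 * pi * (1/2) ^ n)) \<noteq> top" by (rule ennreal_suminf_neq_top) simp
    thus ?thesis by (simp add: less_top)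
  qed
  finally show "(\<integral>\<^sup>+ x. ennreal (norm (indicator (ball p 1) x / norm (x - p))) \<partial>lebesgue) < \<infinity>" .
qed

lemma inverse_norm_split:
  fixes p x :: "'a::real_normed_vector"
  shows "1 / norm (x - p) \<le> 1 + indicator (ball p 1) x / norm (x - p)"
proof (cases "x \<in> ball p 1")
  case False
  hence "1 / norm (x - p) \<le> 1 / 1"
    by (intro frac_le) (auto simp: dist_norm norm_minus_commute)
  thus ?thesis using False by simp
qed simp

text \<open>Here \<open>X\<close>, \<open>Y\<close> and \<open>z\<close> stand for the squared norms
  of two vectors and their inner product; the left side is the squared distance of their truncated
  inversions. With both points outside, the difference of the two sides is
  \<open>(X - 2z + Y) (1/\<eta>^2 - 1/(XY))\<close>; with one inside and one outside it factors as
  in \<open>mixed\<close>.\<close>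

lemma cut_inversion_aux:
  fixes X Y z \<eta> :: real
  assumes "\<eta> > 0" "2 * z \<le> X + Y" "X \<ge> 0" "Y \<ge> 0"
  shows "X / (max X \<eta>)\<^sup>2 - 2 * z / (max X \<eta> * max Y \<eta>) + Y / (max Y \<eta>)\<^sup>2 \<le> (X - 2 * z + Y) / \<eta>\<^sup>2"
proof -
  have mixed: "X / \<eta>\<^sup>2 - 2 * z / (\<eta> * Y) + Y / Y\<^sup>2 \<le> (X - 2 * z + Y) / \<eta>\<^sup>2"
    if "X \<le> \<eta>" "\<eta> < Y" "2 * z \<le> X + Y" for X Y
  proof -
    have "(X - 2 * z + Y) / \<eta>\<^sup>2 - (X / \<eta>\<^sup>2 - 2 * z / (\<eta> * Y) + Y / Y\<^sup>2) = (Y - \<eta>) * (Y + \<eta> - 2 * z) / (\<eta>\<^sup>2 * Y)"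
      using assms(1) that by (simp add: field_simps power2_eq_square)
    moreover have "\<dots> \<ge> 0" using assms(1) that by (intro divide_nonneg_nonneg mult_nonneg_nonneg) auto
    ultimately show ?thesis by linarith
  qed
  consider "X \<le> \<eta>" "Y \<le> \<eta>" | "X \<le> \<eta>" "Y > \<eta>" | "X > \<eta>" "Y \<le> \<eta>" | "X > \<eta>" "Y > \<eta>" by linarith
  thus ?thesis
  proof cases
    case 1 thus ?thesis by (simp add: max_def power2_eq_square add_divide_distrib diff_divide_distrib)
  next
    case 2 thus ?thesis using mixed[of X Y] assms by (simp add: max_def)
  next
    case 3 thus ?thesis using mixed[of Y X] assms by (simp add: max_def algebra_simps)
  next
    case 4
    have "(X - 2 * z + Y) / \<eta>\<^sup>2 - (X / X\<^sup>2 - 2 * z / (X * Y) + Y / Y\<^sup>2) = (X - 2 * z + Y) * (1 / \<eta>\<^sup>2 - 1 / (X * Y))"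
      using assms(1) 4 by (simp add: field_simps power2_eq_square)
    moreover have "\<eta>\<^sup>2 \<le> X * Y" using 4 assms(1) by (simp add: power2_eq_square mult_mono)
    hence "1 / \<eta>\<^sup>2 - 1 / (X * Y) \<ge> 0" using assms(1) by (simp add: frac_le)
    ultimately show ?thesis using 4 assms(2)
      by (smt (verit) max_def mult_nonneg_nonneg)
  qed
qed

text \<open>The map is the homothety by \<open>1 / \<eta>\<close> inside the disk of radius
  \<open>sqrt \<eta>\<close> and the inversion outside, and both stretch by at most
  \<open>1 / \<eta>\<close>. Expanding the squares avoids following a segment across the
  circle.\<close>

lemma cut_inversion_lipschitz:
  fixes x y :: "'a::real_inner"
  assumes "\<eta> > 0"
  shows "norm (x /\<^sub>R max (x \<bullet> x) \<eta> - y /\<^sub>R max (y \<bullet> y) \<eta>) \<le> norm (x - y) / \<eta>"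
proof (rule power2_le_imp_le)
  have z: "2 * (x \<bullet> y) \<le> x \<bullet> x + y \<bullet> y"
    using inner_ge_zero[of "x - y"] by (simp add: inner_diff inner_commute)
  have m: "max (x \<bullet> x) \<eta> > 0" "max (y \<bullet> y) \<eta> > 0" using assms by auto
  have "(norm (x /\<^sub>R max (x \<bullet> x) \<eta> - y /\<^sub>R max (y \<bullet> y) \<eta>))\<^sup>2 =
     (x \<bullet> x) / (max (x \<bullet> x) \<eta>)\<^sup>2 - 2 * (x \<bullet> y) / (max (x \<bullet> x) \<eta> * max (y \<bullet> y) \<eta>) + (y \<bullet> y) / (max (y \<bullet> y) \<eta>)\<^sup>2"
    unfolding power2_norm_eq_inner using m
    by (simp add: inner_diff inner_commute power2_eq_square divide_inverse algebra_simps)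
  also have "\<dots> \<le> (x \<bullet> x - 2 * (x \<bullet> y) + y \<bullet> y) / \<eta>\<^sup>2"
    by (rule cut_inversion_aux[OF assms z]) auto
  also have "\<dots> = (norm (x - y) / \<eta>)\<^sup>2"
    by (simp add: power_divide power2_norm_eq_inner inner_diff inner_commute)
  finally show "(norm (x /\<^sub>R max (x \<bullet> x) \<eta> - y /\<^sub>R max (y \<bullet> y) \<eta>))\<^sup>2 \<le> (norm (x - y) / \<eta>)\<^sup>2" .
qed (use assms in auto)

text \<open>The components of \<open>(x - p) / |x - p|\<^sup>2\<close>, made Lipschitz near \<open>p\<close>; the divergence of the
  modified field is the normalised indicator of a small disk.\<close>

definition cut_field :: "real \<Rightarrow> real^2 \<Rightarrow> 2 \<Rightarrow> real^2 \<Rightarrow> real" where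
  "cut_field \<eta> p i x = (x - p) $ i / max ((x - p) \<bullet> (x - p)) \<eta>"

definition cut_field_deriv :: "real \<Rightarrow> real^2 \<Rightarrow> 2 \<Rightarrow> 2 \<Rightarrow> real^2 \<Rightarrow> real" where
  "cut_field_deriv \<eta> p i j x = (if (x - p) \<bullet> (x - p) < \<eta> then (if i = j then 1 / \<eta> else 0)
     else (if i = j then 1 / ((x - p) \<bullet> (x - p)) else 0) - 2 * (x - p) $ i * (x - p) $ j / ((x - p) \<bullet> (x - p))\<^sup>2)"

lemma cut_field_lipschitz:
  assumes "\<eta> > 0"
  shows "\<bar>cut_field \<eta> p i x - cut_field \<eta> p i y\<bar> \<le> norm (x - y) / \<eta>"
proof -
  have "cut_field \<eta> p i x - cut_field \<eta> p i y =
     ((x - p) /\<^sub>R max ((x - p) \<bullet> (x - p)) \<eta> - (y - p) /\<^sub>R max ((y - p) \<bullet> (y - p)) \<eta>) $ i"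
    by (simp add: cut_field_def divide_inverse mult.commute)
  also have "\<bar>\<dots>\<bar> \<le> norm ((x - p) /\<^sub>R max ((x - p) \<bullet> (x - p)) \<eta> - (y - p) /\<^sub>R max ((y - p) \<bullet> (y - p)) \<eta>)"
    by (rule component_le_norm_cart)
  also have "\<dots> \<le> norm ((x - p) - (y - p)) / \<eta>" by (rule cut_inversion_lipschitz[OF assms])
  finally show ?thesis by simp
qed

lemma cut_field_bound:
  assumes "\<eta> > 0"
  shows "\<bar>cut_field \<eta> p i x\<bar> \<le> 1 / norm (x - p)"
proof (cases "x = p")
  case False
  define d where "d = norm (x - p)"
  have d: "d > 0" using False by (simp add: d_def)
  have "\<bar>(x - p) $ i\<bar> \<le> d" unfolding d_def by (rule component_le_norm_cart)
  moreover have "max ((x - p) \<bullet> (x - p)) \<eta> \<ge> d\<^sup>2" by (simp add: d_def power2_norm_eq_inner)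
  ultimately have "\<bar>(x - p) $ i\<bar> / max ((x - p) \<bullet> (x - p)) \<eta> \<le> d / d\<^sup>2"
    using d by (intro frac_le) auto
  moreover have "\<bar>max ((x - p) \<bullet> (x - p)) \<eta>\<bar> = max ((x - p) \<bullet> (x - p)) \<eta>" using assms by (intro abs_of_pos) auto
  ultimately show ?thesis using d by (simp add: cut_field_def abs_divide d_def[symmetric] power2_eq_square)
qed (simp add: cut_field_def)

lemma cut_field_bound':
  assumes "\<eta> > 0"
  shows "\<bar>cut_field \<eta> p i x\<bar> \<le> norm (x - p) / \<eta>"
  using cut_field_lipschitz[OF assms, of p i x p] assms by (simp add: cut_field_def)

lemma cut_field_has_derivative:
  assumes eta: "\<eta> > 0" and x: "(x - p) \<bullet> (x - p) \<noteq> \<eta>"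
  shows "\<exists>F'. (cut_field \<eta> p i has_derivative F') (at x) \<and> (\<forall>j. F' (axis j 1) = cut_field_deriv \<eta> p i j x)"
proof (cases "(x - p) \<bullet> (x - p) < \<eta>")
  case True
  have "((\<lambda>x. (x - p) $ i / \<eta>) has_derivative (\<lambda>h. h $ i / \<eta>)) (at x)"
    using eta by (auto intro!: derivative_eq_intros bounded_linear_imp_has_derivative bounded_linear_vec_nth)
  hence "(cut_field \<eta> p i has_derivative (\<lambda>h. h $ i / \<eta>)) (at x)"
    by (rule has_derivative_transform_within_open[of _ _ _ _ "{x. (x - p) \<bullet> (x - p) < \<eta>}"])
      (use True in \<open>auto intro!: open_Collect_less continuous_intros simp: cut_field_def max_def\<close>)
  thus ?thesis using True by (intro exI conjI) (auto simp: cut_field_deriv_def axis_def)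
next
  case False
  define D where "D = (x - p) \<bullet> (x - p)"
  have D: "D > \<eta>" "D \<noteq> 0" using False x eta by (auto simp: D_def)
  have "((\<lambda>x. (x - p) $ i / ((x - p) \<bullet> (x - p))) has_derivative
      (\<lambda>h. h $ i / D - (x - p) $ i * (2 * ((x - p) \<bullet> h)) / D\<^sup>2)) (at x)"
  proof -
    have n: "((\<lambda>x. (x - p) $ i) has_derivative (\<lambda>h. h $ i)) (at x)"
      by (auto intro!: derivative_eq_intros bounded_linear_imp_has_derivative bounded_linear_vec_nth)
    have d: "((\<lambda>x. (x - p) \<bullet> (x - p)) has_derivative (\<lambda>h. 2 * ((x - p) \<bullet> h))) (at x)"
      by (rule has_derivative_eq_rhs, rule has_derivative_inner, (rule derivative_intros)+) (simp add: inner_commute)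
    show ?thesis
      by (rule has_derivative_eq_rhs[OF has_derivative_divide'[OF n d]])
        (use D in \<open>simp_all add: D_def[symmetric] diff_divide_distrib power2_eq_square\<close>)
  qed
  hence "(cut_field \<eta> p i has_derivative (\<lambda>h. h $ i / D - (x - p) $ i * (2 * ((x - p) \<bullet> h)) / D\<^sup>2)) (at x)"
    by (rule has_derivative_transform_within_open[of _ _ _ _ "{x. \<eta> < (x - p) \<bullet> (x - p)}"])
      (use D in \<open>auto intro!: open_Collect_less continuous_intros simp: cut_field_def max_def D_def\<close>)
  moreover have "axis j 1 $ i / D - (x - p) $ i * (2 * ((x - p) \<bullet> axis j 1)) / D\<^sup>2 = cut_field_deriv \<eta> p i j x" for j
  proof -
    have "(x - p) \<bullet> axis j 1 = (x - p) $ j" by (simp add: inner_axis)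
    thus ?thesis unfolding cut_field_deriv_def D_def[symmetric] using D
      by (simp add: axis_def mult.commute mult.left_commute del: vector_minus_component)
  qed
  ultimately show ?thesis by blast
qed

text \<open>On the circle of radius \<open>sqrt \<eta>\<close> the field has a kink, so the rule for
  continuously differentiable functions does not apply. The circle is negligible and the product
  with \<open>\<phi>\<close> is Lipschitz, which is enough for
  \<open>integral_directional_derivative_zero\<close>.\<close>

lemma cut_field_by_parts:
  assumes eta: "\<eta> > 0" and phi: "\<phi> \<in> test_functions UNIV"
  shows "integrable lebesgue (\<lambda>x. cut_field \<eta> p i x * partial j \<phi> x)"
    "integrable lebesgue (\<lambda>x. cut_field_deriv \<eta> p i j x * \<phi> x)"
    "integral\<^sup>L lebesgue (\<lambda>x. cut_field \<eta> p i x * partial j \<phi> x) =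
       - integral\<^sup>L lebesgue (\<lambda>x. cut_field_deriv \<eta> p i j x * \<phi> x)"
proof -
  obtain K where K: "compact K" "\<And>x. x \<notin> K \<Longrightarrow> \<phi> x = 0" using test_function_support[OF phi] by auto
  obtain R where R: "R > 0" "\<And>x. x \<in> K \<Longrightarrow> norm x \<le> R"
    using compact_imp_bounded[OF K(1)] bounded_pos by metis
  obtain L where L: "L > 0" "\<And>x y. \<bar>\<phi> x - \<phi> y\<bar> \<le> L * norm (x - y)" using test_function_lipschitz[OF phi] by blast
  obtain B where B: "B > 0" "\<And>x. \<bar>\<phi> x\<bar> \<le> B" using test_function_bounded[OF phi] by blast
  define g where "g x = cut_field \<eta> p i x * \<phi> x" for x
  define g' where "g' x = cut_field \<eta> p i x * partial j \<phi> x + cut_field_deriv \<eta> p i j x * \<phi> x" for x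
  define C where "C = (R + norm p) / \<eta> * L + B / \<eta>"
  have half: "\<bar>g x - g y\<bar> \<le> C * norm (x - y)" if "x \<in> K" for x y
  proof -
    have "norm (x - p) \<le> R + norm p" using R(2)[OF that] norm_triangle_ineq4[of x p] by linarith
    hence "\<bar>cut_field \<eta> p i x\<bar> \<le> (R + norm p) / \<eta>"
      using cut_field_bound'[OF eta, of p i x] eta by (meson divide_right_mono less_imp_le order_trans)
    hence "\<bar>cut_field \<eta> p i x\<bar> * \<bar>\<phi> x - \<phi> y\<bar> \<le> (R + norm p) / \<eta> * (L * norm (x - y))"
      using L(2)[of x y] R(1) eta by (intro mult_mono) auto
    moreover have "\<bar>\<phi> y\<bar> * \<bar>cut_field \<eta> p i x - cut_field \<eta> p i y\<bar> \<le> B * (norm (x - y) / \<eta>)"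
      using cut_field_lipschitz[OF eta] B by (intro mult_mono) auto
    ultimately have "\<bar>cut_field \<eta> p i x * (\<phi> x - \<phi> y)\<bar> + \<bar>\<phi> y * (cut_field \<eta> p i x - cut_field \<eta> p i y)\<bar> \<le> C * norm (x - y)"
      unfolding C_def abs_mult by (simp add: algebra_simps)
    moreover have "g x - g y = cut_field \<eta> p i x * (\<phi> x - \<phi> y) + \<phi> y * (cut_field \<eta> p i x - cut_field \<eta> p i y)"
      by (simp add: g_def algebra_simps)
    ultimately show ?thesis by (metis abs_triangle_ineq order_trans)
  qed
  have C0: "C \<ge> 0" unfolding C_def using R B L eta by (intro add_nonneg_nonneg mult_nonneg_nonneg divide_nonneg_nonneg) auto
  \<comment> \<open>If neither point lies in \<open>K\<close> both products vanish; otherwise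
    \<open>half\<close> applies after a possible exchange of the points.\<close>
  have lip: "\<bar>g x - g y\<bar> \<le> C * norm (x - y)" for x y
    using half[of x y] half[of y x] K(2)[of x] K(2)[of y] C0
    by (cases "x \<in> K"; cases "y \<in> K") (auto simp: abs_minus_commute norm_minus_commute g_def)
  have supp: "g x = 0" if "norm x > R" for x
    using R(2)[of x] K(2)[of x] that by (cases "x \<in> K") (auto simp: g_def)
  have N: "negligible (sphere p (sqrt \<eta>))" by (rule negligible_sphere)
  have sph: "(x - p) \<bullet> (x - p) \<noteq> \<eta>" if "x \<notin> sphere p (sqrt \<eta>)" for x
    using that dist_commute[of x p] by (auto simp: dist_norm[of x p] norm_eq_sqrt_inner)
  have der: "((\<lambda>t. g (x + t *\<^sub>R axis j 1)) has_real_derivative g' x) (at 0)" if x: "x \<notin> sphere p (sqrt \<eta>)" for x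
  proof -
    obtain F' where F': "(cut_field \<eta> p i has_derivative F') (at x)" "\<And>j. F' (axis j 1) = cut_field_deriv \<eta> p i j x"
      using cut_field_has_derivative[OF eta sph[OF x]] by blast
    have "(g has_derivative (\<lambda>h. cut_field \<eta> p i x * (\<Sum>k\<in>UNIV. h $ k * partial k \<phi> x) + F' h * \<phi> x)) (at x)"
      unfolding g_def by (rule has_derivative_mult[OF F'(1) smooth_has_derivative[OF test_functions_smooth[OF phi]]])
    from has_derivative_imp_line_derivative[OF this, of "axis j 1"]
    show ?thesis by (simp add: g'_def F'(2) sum_axis_mult)
  qed
  have cm: "continuous_on UNIV (cut_field \<eta> p i)"
  proof -
    have "(1 / \<eta>)-lipschitz_on UNIV (cut_field \<eta> p i)"
      using cut_field_lipschitz[OF eta] eta by (auto simp: lipschitz_on_def dist_norm)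
    thus ?thesis by (rule lipschitz_on_continuous_on)
  qed
  have pc: "continuous_on UNIV \<phi>" "continuous_on UNIV (partial j \<phi>)"
    by (intro smooth_continuous_on smooth_partial test_functions_smooth[OF phi])+
  have c1: "(\<lambda>x. cut_field_deriv \<eta> p i j x) \<in> borel_measurable borel"
  proof -
    have [measurable]: "(\<lambda>x. (x - p) \<bullet> (x - p)) \<in> borel_measurable borel" "(\<lambda>x. (x - p) $ k) \<in> borel_measurable borel" for k
      by (intro borel_measurable_continuous_onI continuous_intros)+
    show ?thesis unfolding cut_field_deriv_def by measurable
  qed
  have [measurable]: "cut_field \<eta> p i \<in> borel_measurable borel" "\<phi> \<in> borel_measurable borel" "partial j \<phi> \<in> borel_measurable borel"
    using cm pc by (auto intro: borel_measurable_continuous_onI)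
  have g'm: "g' \<in> borel_measurable lebesgue"
  proof -
    have "g' \<in> borel_measurable borel" unfolding g'_def[abs_def] using c1 by measurable
    thus ?thesis by (simp add: measurable_completion)
  qed
  note z = integral_directional_derivative_zero[where g = g and L = C and R = R and g' = g', OF lip supp N der g'm]
  show i1: "integrable lebesgue (\<lambda>x. cut_field \<eta> p i x * partial j \<phi> x)"
    by (rule integrable_compact_support[OF _ K(1)])
      (auto intro!: continuous_intros cm pc partial_eq_0_outside[OF K])
  have "integrable lebesgue (\<lambda>x. g' x - cut_field \<eta> p i x * partial j \<phi> x)"
    by (rule Bochner_Integration.integrable_diff[OF z(1) i1])
  thus i2: "integrable lebesgue (\<lambda>x. cut_field_deriv \<eta> p i j x * \<phi> x)"
    by (simp add: g'_def)
  show "integral\<^sup>L lebesgue (\<lambda>x. cut_field \<eta> p i x * partial j \<phi> x) =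
       - integral\<^sup>L lebesgue (\<lambda>x. cut_field_deriv \<eta> p i j x * \<phi> x)"
    using z(2) i1 i2 by (simp add: g'_def[abs_def])
qed

lemma cut_field_deriv_commute: "cut_field_deriv \<eta> p i j x = cut_field_deriv \<eta> p j i x"
  by (auto simp: cut_field_deriv_def algebra_simps)

text \<open>The field is curl-free: the derivative of component \<open>i\<close> in direction
  \<open>k\<close> is that of component \<open>k\<close> in direction \<open>i\<close>. With the
  mixed derivatives of \<open>\<phi>\<close> exchanged, integrations by parts therefore collect both
  terms of the Laplacian into the divergence of the field against \<open>partial i \<phi>\<close>,
  and the divergence is \<open>2 / \<eta>\<close> inside the disk and zero outside.\<close>

lemma cut_field_laplacian:
  assumes eta: "\<eta> > 0" and phi: "\<phi> \<in> test_functions UNIV" "\<phi> \<in> bumps" and ik: "i \<noteq> k"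
  shows "integral\<^sup>L lebesgue (\<lambda>x. cut_field \<eta> p i x * (\<Sum>j\<in>UNIV. partial j (partial j \<phi>) x)) =
     - (2 / \<eta>) * integral\<^sup>L lebesgue (\<lambda>x. indicator (ball p (sqrt \<eta>)) x * partial i \<phi> x)"
proof -
  have UN: "UNIV = {i, k}" using ik exhaust_2[of i] exhaust_2[of k] UNIV_2_eq by auto
  note t = test_functions_partial[OF phi(1)]
  let ?I = "integral\<^sup>L lebesgue"
  have "?I (\<lambda>x. cut_field \<eta> p i x * (\<Sum>j\<in>UNIV. partial j (partial j \<phi>) x)) =
     ?I (\<lambda>x. cut_field \<eta> p i x * partial i (partial i \<phi>) x + cut_field \<eta> p i x * partial k (partial k \<phi>) x)"
    unfolding UN using ik by (simp add: algebra_simps)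
  also have "\<dots> = - ?I (\<lambda>x. cut_field_deriv \<eta> p i i x * partial i \<phi> x) - ?I (\<lambda>x. cut_field_deriv \<eta> p i k x * partial k \<phi> x)"
    by (simp add: cut_field_by_parts[OF eta t])
  also have "?I (\<lambda>x. cut_field_deriv \<eta> p i k x * partial k \<phi> x) = ?I (\<lambda>x. cut_field_deriv \<eta> p k i x * partial k \<phi> x)"
    by (subst cut_field_deriv_commute) (rule refl)
  also have "\<dots> = - ?I (\<lambda>x. cut_field \<eta> p k x * partial i (partial k \<phi>) x)"
    by (simp add: cut_field_by_parts[OF eta t])
  also have "partial i (partial k \<phi>) = partial k (partial i \<phi>)" by (rule bumps_partial_commute[OF phi(2)])
  also have "?I (\<lambda>x. cut_field \<eta> p k x * partial k (partial i \<phi>) x) = - ?I (\<lambda>x. cut_field_deriv \<eta> p k k x * partial i \<phi> x)"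
    by (simp add: cut_field_by_parts[OF eta t])
  also have "- ?I (\<lambda>x. cut_field_deriv \<eta> p i i x * partial i \<phi> x) - (- (- ?I (\<lambda>x. cut_field_deriv \<eta> p k k x * partial i \<phi> x))) =
     - ?I (\<lambda>x. cut_field_deriv \<eta> p i i x * partial i \<phi> x + cut_field_deriv \<eta> p k k x * partial i \<phi> x)"
    by (simp add: cut_field_by_parts[OF eta t])
  also have "(\<lambda>x. cut_field_deriv \<eta> p i i x * partial i \<phi> x + cut_field_deriv \<eta> p k k x * partial i \<phi> x) =
     (\<lambda>x. (2 / \<eta>) * (indicator (ball p (sqrt \<eta>)) x * partial i \<phi> x))"
  proof
    fix x
    define D where "D = (x - p) \<bullet> (x - p)"
    have D: "D = (x - p) $ i * (x - p) $ i + (x - p) $ k * (x - p) $ k"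
      unfolding D_def inner_vec_def UN using ik by simp
    have b: "x \<in> ball p (sqrt \<eta>) \<longleftrightarrow> D < \<eta>"
    proof -
      have "dist p x = sqrt D" by (simp add: D_def dist_norm norm_minus_commute[of p] flip: norm_eq_sqrt_inner)
      thus ?thesis by simp
    qed
    have "cut_field_deriv \<eta> p i i x + cut_field_deriv \<eta> p k k x = (2 / \<eta>) * indicator (ball p (sqrt \<eta>)) x"
    proof (cases "D < \<eta>")
      case True
      thus ?thesis using b by (simp add: cut_field_deriv_def D_def[symmetric])
    next
      case False
      hence "D > 0" using eta by linarith
      have "cut_field_deriv \<eta> p i i x + cut_field_deriv \<eta> p k k x =
         2 / D - 2 * ((x - p) $ i * (x - p) $ i + (x - p) $ k * (x - p) $ k) / D\<^sup>2"
        using False by (simp add: cut_field_deriv_def D_def[symmetric] add_divide_distrib distrib_left mult.assoc del: vector_minus_component)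
      also have "\<dots> = 0" unfolding D[symmetric] using \<open>D > 0\<close> by (simp add: power2_eq_square)
      finally show ?thesis using False b by simp
    qed
    thus "cut_field_deriv \<eta> p i i x * partial i \<phi> x + cut_field_deriv \<eta> p k k x * partial i \<phi> x =
       (2 / \<eta>) * (indicator (ball p (sqrt \<eta>)) x * partial i \<phi> x)"
      by (metis distrib_right mult.assoc)
  qed
  finally show ?thesis by simp
qed

text \<open>Let \<open>\<eta>\<close> tend to zero in \<open>cut_field_laplacian\<close>. The disk
  has area \<open>pi * \<eta>\<close>, so the right side is \<open>- 2 * pi\<close> times the mean
  of \<open>partial i \<phi>\<close> over it, and a Lipschitz bound makes this mean converge to the
  value at \<open>p\<close>.\<close>

lemma integral_inverse_field_laplacian:
  fixes i :: 2
  assumes phi: "\<phi> \<in> test_functions UNIV" "\<phi> \<in> bumps"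
  shows "integral\<^sup>L lebesgue (\<lambda>x. (x - p) $ i / ((x - p) \<bullet> (x - p)) * (\<Sum>j\<in>UNIV. partial j (partial j \<phi>) x)) =
     - 2 * pi * partial i \<phi> p"
proof -
  define lap where "lap x = (\<Sum>j\<in>UNIV. partial j (partial j \<phi>) x)" for x
  \<comment> \<open>The square makes the disk radius \<open>sqrt (\<eta> n)\<close> equal to
    \<open>1 / (n + 1)\<close>.\<close>
  define \<eta> where "\<eta> n = (inverse (real (Suc n)))\<^sup>2" for n
  have eta: "\<eta> n > 0" for n by (simp add: \<eta>_def)
  have sq: "sqrt (\<eta> n) = inverse (real (Suc n))" for n by (simp add: \<eta>_def)
  obtain k where ik: "i \<noteq> k" using exhaust_2[of i] by (metis zero_neq_one one_neq_zero)
  obtain K where K: "compact K" "\<And>x. x \<notin> K \<Longrightarrow> \<phi> x = 0" using test_function_support[OF phi(1)] by auto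
  have lap0: "lap x = 0" if "x \<notin> K" for x
    unfolding lap_def using that by (intro sum.neutral ballI partial_eq_0_outside[OF K(1) partial_eq_0_outside[OF K]])
  have lapc: "continuous_on UNIV lap"
    unfolding lap_def[abs_def] by (intro continuous_intros smooth_continuous_on smooth_partial test_functions_smooth[OF phi(1)])
  have "compact (lap ` K)" by (rule compact_continuous_image[OF continuous_on_subset[OF lapc] K(1)]) auto
  then obtain B where B: "B > 0" "\<forall>y\<in>lap ` K. norm y \<le> B" using compact_imp_bounded bounded_pos by metis
  define w where "w x = B * indicator K x + B * (indicator (ball p 1) x / norm (x - p))" for x
  have wint: "integrable lebesgue w"
  proof -
    have "emeasure lebesgue K < \<infinity>" using emeasure_bounded_finite[OF compact_imp_bounded[OF K(1)]] compact_imp_closed[OF K(1)] by simp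
    hence "integrable lebesgue (indicator K :: real^2 \<Rightarrow> real)"
      by (intro integrable_real_indicator) (auto simp: compact_imp_closed[OF K(1)])
    thus ?thesis unfolding w_def[abs_def]
      by (intro Bochner_Integration.integrable_add integrable_mult_right integrable_inverse_norm_ball)
  qed
  have "(\<lambda>n. integral\<^sup>L lebesgue (\<lambda>x. cut_field (\<eta> n) p i x * lap x)) \<longlonglongrightarrow>
     integral\<^sup>L lebesgue (\<lambda>x. (x - p) $ i / ((x - p) \<bullet> (x - p)) * lap x)"
  proof (rule integral_dominated_convergence[OF _ _ wint])
    have [measurable]: "lap \<in> borel_measurable borel" by (rule borel_measurable_continuous_onI[OF lapc])
    have [measurable]: "(\<lambda>x. (x - p) \<bullet> (x - p)) \<in> borel_measurable borel" "(\<lambda>x. (x - p) $ k) \<in> borel_measurable borel" for k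
      by (intro borel_measurable_continuous_onI continuous_intros)+
    have "(\<lambda>x. (x - p) $ i / ((x - p) \<bullet> (x - p)) * lap x) \<in> borel_measurable borel" by measurable
    thus "(\<lambda>x. (x - p) $ i / ((x - p) \<bullet> (x - p)) * lap x) \<in> borel_measurable lebesgue" by (simp add: measurable_completion)
    have "(\<lambda>x. cut_field (\<eta> n) p i x * lap x) \<in> borel_measurable borel" for n unfolding cut_field_def by measurable
    thus "(\<lambda>x. cut_field (\<eta> n) p i x * lap x) \<in> borel_measurable lebesgue" for n by (simp add: measurable_completion)
    show "AE x in lebesgue. (\<lambda>n. cut_field (\<eta> n) p i x * lap x) \<longlonglongrightarrow> (x - p) $ i / ((x - p) \<bullet> (x - p)) * lap x"
    proof (rule AE_I2)
      \<comment> \<open>For a fixed point the truncation is eventually inactive, so the sequence is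
        eventually constant; at \<open>x = p\<close> both sides are \<open>0\<close> because the
        numerator is.\<close>
      fix x
      have "\<forall>\<^sub>F n in sequentially. cut_field (\<eta> n) p i x * lap x = (x - p) $ i / ((x - p) \<bullet> (x - p)) * lap x"
      proof (cases "x = p")
        case True thus ?thesis by (simp add: cut_field_def)
      next
        case False
        hence "(x - p) \<bullet> (x - p) > 0" by simp
        moreover have "\<eta> \<longlonglongrightarrow> 0"
          unfolding \<eta>_def using tendsto_power[OF LIMSEQ_inverse_real_of_nat, of 2] by simp
        ultimately have "\<forall>\<^sub>F n in sequentially. \<eta> n < (x - p) \<bullet> (x - p)" by (rule order_tendstoD(2)[rotated])
        thus ?thesis by eventually_elim (simp add: cut_field_def max_def)
      qed
      thus "(\<lambda>n. cut_field (\<eta> n) p i x * lap x) \<longlonglongrightarrow> (x - p) $ i / ((x - p) \<bullet> (x - p)) * lap x"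
        by (rule tendsto_eventually)
    qed
    show "AE x in lebesgue. norm (cut_field (\<eta> n) p i x * lap x) \<le> w x" for n
    proof (rule AE_I2)
      fix x
      show "norm (cut_field (\<eta> n) p i x * lap x) \<le> w x"
      proof (cases "x \<in> K")
        case False thus ?thesis using B lap0 by (simp add: w_def)
      next
        case True
        have "\<bar>cut_field (\<eta> n) p i x\<bar> * \<bar>lap x\<bar> \<le> 1 / norm (x - p) * B"
          using cut_field_bound[OF eta] B True by (intro mult_mono) auto
        also have "1 / norm (x - p) \<le> 1 + indicator (ball p 1) x / norm (x - p)"
          by (rule inverse_norm_split)
        finally show ?thesis using True B by (simp add: w_def abs_mult algebra_simps)
      qed
    qed
  qed
  hence lim1: "(\<lambda>n. - (2 / \<eta> n) * integral\<^sup>L lebesgue (\<lambda>x. indicator (ball p (sqrt (\<eta> n))) x * partial i \<phi> x)) \<longlonglongrightarrow>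
     integral\<^sup>L lebesgue (\<lambda>x. (x - p) $ i / ((x - p) \<bullet> (x - p)) * lap x)"
    unfolding lap_def cut_field_laplacian[OF eta phi ik] .
  obtain L where L: "L > 0" "\<And>x y. \<bar>partial i \<phi> x - partial i \<phi> y\<bar> \<le> L * norm (x - y)"
    using test_function_lipschitz[OF test_functions_partial[OF phi(1)]] by blast
  have near: "\<bar>- (2 / \<eta> n) * integral\<^sup>L lebesgue (\<lambda>x. indicator (ball p (sqrt (\<eta> n))) x * partial i \<phi> x) - (- 2 * pi * partial i \<phi> p)\<bar>
     \<le> 2 * pi * L * inverse (real (Suc n))" for n
  proof -
    define b where "b = ball p (sqrt (\<eta> n))"
    have mb: "measure lebesgue b = pi * \<eta> n" unfolding b_def using measure_ball_2[of "sqrt (\<eta> n)" p] eta[of n] by simp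
    have fb: "emeasure lebesgue b < \<infinity>" unfolding b_def using emeasure_bounded_finite[of "ball p (sqrt (\<eta> n))"] by simp
    have ib: "integrable lebesgue (indicator b :: real^2 \<Rightarrow> real)"
      using fb by (intro integrable_real_indicator) (auto simp: b_def)
    have pm: "partial i \<phi> \<in> borel_measurable lebesgue"
      using smooth_continuous_on[OF smooth_partial[OF test_functions_smooth[OF phi(1)]], of UNIV i]
      by (simp add: borel_measurable_continuous_onI measurable_completion)
    have i1: "integrable lebesgue (\<lambda>x. indicator b x * partial i \<phi> x)"
    proof -
      obtain B' where B': "B' > 0" "\<And>x. \<bar>partial i \<phi> x\<bar> \<le> B'" using test_function_bounded[OF test_functions_partial[OF phi(1)]] by blast
      show ?thesis
      proof (rule Bochner_Integration.integrable_bound[OF integrable_mult_right[OF ib, of B']])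
        show "(\<lambda>x. indicator b x * partial i \<phi> x) \<in> borel_measurable lebesgue"
          by (intro borel_measurable_times borel_measurable_integrable[OF ib] pm)
        show "AE x in lebesgue. norm (indicator b x * partial i \<phi> x) \<le> norm (B' * indicator b x)"
          by (rule AE_I2) (use B' in \<open>auto simp: indicator_def abs_of_pos\<close>)
      qed
    qed
    have "integral\<^sup>L lebesgue (\<lambda>x. indicator b x * partial i \<phi> x) - pi * \<eta> n * partial i \<phi> p =
       integral\<^sup>L lebesgue (\<lambda>x. indicator b x * partial i \<phi> x - indicator b x * partial i \<phi> p)"
      using i1 ib mb by (simp add: Bochner_Integration.integral_diff)
    also have "\<bar>\<dots>\<bar> \<le> integral\<^sup>L lebesgue (\<lambda>x. indicator b x * (L * sqrt (\<eta> n)))"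
    proof (rule order_trans[OF integral_abs_bound integral_mono])
      show "integrable lebesgue (\<lambda>x. \<bar>indicator b x * partial i \<phi> x - indicator b x * partial i \<phi> p\<bar>)"
        using i1 ib by (intro integrable_abs Bochner_Integration.integrable_diff integrable_mult_left)
      show "integrable lebesgue (\<lambda>x. indicator b x * (L * sqrt (\<eta> n)))" by (intro integrable_mult_left ib)
      show "\<bar>indicator b x * partial i \<phi> x - indicator b x * partial i \<phi> p\<bar> \<le> indicator b x * (L * sqrt (\<eta> n))" for x
      proof (cases "x \<in> b")
        case True
        hence "norm (x - p) \<le> sqrt (\<eta> n)" by (simp add: b_def dist_norm norm_minus_commute)
        hence "L * norm (x - p) \<le> L * sqrt (\<eta> n)" using L(1) by simp
        thus ?thesis using True L(2)[of x p] by simp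
      qed simp
    qed
    also have "\<dots> = pi * \<eta> n * (L * sqrt (\<eta> n))" using mb by simp
    finally have *: "\<bar>integral\<^sup>L lebesgue (\<lambda>x. indicator b x * partial i \<phi> x) - pi * \<eta> n * partial i \<phi> p\<bar> \<le> pi * \<eta> n * (L * sqrt (\<eta> n))" .
    have "- (2 / \<eta> n) * integral\<^sup>L lebesgue (\<lambda>x. indicator b x * partial i \<phi> x) - (- 2 * pi * partial i \<phi> p) =
      - (2 / \<eta> n) * (integral\<^sup>L lebesgue (\<lambda>x. indicator b x * partial i \<phi> x) - pi * \<eta> n * partial i \<phi> p)"
      using eta[of n] by (simp add: field_simps)
    also have "\<bar>\<dots>\<bar> = (2 / \<eta> n) * \<bar>integral\<^sup>L lebesgue (\<lambda>x. indicator b x * partial i \<phi> x) - pi * \<eta> n * partial i \<phi> p\<bar>"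
      unfolding abs_mult using eta[of n] by simp
    also have "\<dots> \<le> (2 / \<eta> n) * (pi * \<eta> n * (L * sqrt (\<eta> n)))" using * eta[of n] by (intro mult_left_mono) auto
    also have "\<dots> = 2 * pi * L * inverse (real (Suc n))" unfolding sq using eta[of n] by simp
    finally show ?thesis unfolding b_def .
  qed
  have "(\<lambda>n. 2 * pi * L * inverse (real (Suc n))) \<longlonglongrightarrow> 2 * pi * L * 0"
    by (intro tendsto_mult tendsto_const LIMSEQ_inverse_real_of_nat)
  hence z: "(\<lambda>n. 2 * pi * L * inverse (real (Suc n))) \<longlonglongrightarrow> 0" by simp
  have "(\<lambda>n. - (2 / \<eta> n) * integral\<^sup>L lebesgue (\<lambda>x. indicator (ball p (sqrt (\<eta> n))) x * partial i \<phi> x) - (- 2 * pi * partial i \<phi> p)) \<longlonglongrightarrow> 0"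
    by (rule Lim_null_comparison[OF _ z]) (use near in \<open>simp only: real_norm_def eventually_True\<close>)
  hence "(\<lambda>n. - (2 / \<eta> n) * integral\<^sup>L lebesgue (\<lambda>x. indicator (ball p (sqrt (\<eta> n))) x * partial i \<phi> x)) \<longlonglongrightarrow> - 2 * pi * partial i \<phi> p"
    by (rule LIM_zero_cancel)
  from LIMSEQ_unique[OF lim1 this] show ?thesis by (simp add: lap_def)
qed

text \<open>The derivative in direction \<open>a\<close> of the fundamental solution
  \<open>ln |x - p| / (2 * pi)\<close> of the Laplacian, that is, the dipole potential of the whole
  plane.\<close>

definition dipole_field :: "real^2 \<Rightarrow> real^2 \<Rightarrow> real^2 \<Rightarrow> real" where
  "dipole_field a p x = (a \<bullet> (x - p)) / (2 * pi * ((x - p) \<bullet> (x - p)))"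

lemma dipole_field_locally_integrable: "locally_integrable_on (dipole_field a p) S"
  unfolding locally_integrable_on_def set_integrable_def
proof (intro allI impI)
  fix K assume K: "compact K \<and> K \<subseteq> S"
  have fin: "emeasure lebesgue K < \<infinity>"
    using emeasure_bounded_finite[OF compact_imp_bounded[OF conjunct1[OF K]]] K by (simp add: compact_imp_closed)
  have iK: "integrable lebesgue (indicator K :: real^2 \<Rightarrow> real)"
    using fin K by (intro integrable_real_indicator) (auto simp: compact_imp_closed)
  show "integrable lebesgue (\<lambda>x. indicator K x *\<^sub>R dipole_field a p x)"
  proof (rule Bochner_Integration.integrable_bound)
    show "integrable lebesgue (\<lambda>x. norm a * (indicator K x + indicator (ball p 1) x / norm (x - p)))"
      by (intro integrable_mult_right Bochner_Integration.integrable_add iK integrable_inverse_norm_ball)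
    have [measurable]: "(\<lambda>x. (x - p) \<bullet> (x - p)) \<in> borel_measurable borel" "(\<lambda>x. a \<bullet> (x - p)) \<in> borel_measurable borel"
      by (intro borel_measurable_continuous_onI continuous_intros)+
    have "dipole_field a p \<in> borel_measurable borel" unfolding dipole_field_def[abs_def] by measurable
    hence "dipole_field a p \<in> borel_measurable lebesgue" by (simp add: measurable_completion)
    thus "(\<lambda>x. indicator K x *\<^sub>R dipole_field a p x) \<in> borel_measurable lebesgue"
      by (intro borel_measurable_scaleR borel_measurable_integrable[OF iK])
    show "AE x in lebesgue. norm (indicator K x *\<^sub>R dipole_field a p x) \<le>
        norm (norm a * (indicator K x + indicator (ball p 1) x / norm (x - p)))"
    proof (rule AE_I2)
      fix x
      define d where "d = norm (x - p)"
      have i1: "1 / d \<le> 1 + indicator (ball p 1) x / d"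
        unfolding d_def by (rule inverse_norm_split)
      have "\<bar>dipole_field a p x\<bar> \<le> norm a * (1 / d)"
      proof (cases "d = 0")
        case True thus ?thesis by (simp add: d_def dipole_field_def)
      next
        case False
        hence d: "d > 0" by (simp add: d_def)
        have "\<bar>a \<bullet> (x - p)\<bar> \<le> norm a * d" unfolding d_def by (rule Cauchy_Schwarz_ineq2)
        moreover have "2 * pi * (d * d) \<ge> d * d" using d pi_gt3 by simp
        ultimately have le: "\<bar>a \<bullet> (x - p)\<bar> / (2 * pi * (d * d)) \<le> norm a * d / (d * d)"
          using d by (intro frac_le) auto
        have e: "(x - p) \<bullet> (x - p) = d * d" by (simp add: d_def dot_square_norm power2_eq_square)
        have "\<bar>dipole_field a p x\<bar> = \<bar>a \<bullet> (x - p)\<bar> / (2 * pi * (d * d))"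
          unfolding dipole_field_def e abs_divide by simp
        also note le
        also have "norm a * d / (d * d) = norm a * (1 / d)" using d by simp
        finally show ?thesis .
      qed
      also have "\<dots> \<le> norm a * (1 + indicator (ball p 1) x / d)" using i1 by (intro mult_left_mono) auto
      finally show "norm (indicator K x *\<^sub>R dipole_field a p x) \<le>
        norm (norm a * (indicator K x + indicator (ball p 1) x / norm (x - p)))"
        by (auto simp: indicator_def d_def)
    qed
  qed
qed

text \<open>The Laplacian of \<open>\<phi>\<close> vanishes off \<open>S\<close>, so the integral
  extends to the plane, where \<open>integral_inverse_field_laplacian\<close> treats the components
  one by one; the factor \<open>2 * pi\<close> cancels.\<close>

lemma dipole_field_laplacian:
  assumes phi: "\<phi> \<in> test_functions S" "\<phi> \<in> bumps"
  shows "distr_laplacian (regular_distr S (dipole_field a p)) \<phi> = distr_dir_deriv a (dirac p) \<phi>"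
proof -
  define lap where "lap x = (\<Sum>j\<in>UNIV. partial j (partial j \<phi>) x)" for x
  have phiU: "\<phi> \<in> test_functions UNIV" using phi(1) test_functions_mono by blast
  note t = test_functions_partial[OF test_functions_partial[OF phi(1)]]
  obtain K where K: "compact K" "K \<subseteq> S" "\<And>x. x \<notin> K \<Longrightarrow> \<phi> x = 0" using test_function_support[OF phi(1)] by auto
  have lap0: "lap x = 0" if "x \<notin> S" for x
    unfolding lap_def using that K(2) by (intro sum.neutral ballI partial_eq_0_outside[OF K(1) partial_eq_0_outside[OF K(1,3)]]) auto
  have lint: "locally_integrable_on (\<lambda>x. (x - p) $ i / ((x - p) \<bullet> (x - p))) T" for i T
  proof -
    have "(\<lambda>x. (x - p) $ i / ((x - p) \<bullet> (x - p))) = (\<lambda>x. (2 * pi) * dipole_field (axis i 1) p x + 0 * dipole_field (axis i 1) p x)"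
      by (auto simp: dipole_field_def inner_axis' fun_eq_iff)
    thus ?thesis using locally_integrable_on_add[OF dipole_field_locally_integrable dipole_field_locally_integrable] by metis
  qed
  have i1: "integrable lebesgue (\<lambda>x. (x - p) $ i / ((x - p) \<bullet> (x - p)) * lap x)" for i
  proof -
    have "set_integrable lebesgue UNIV (\<lambda>x. \<Sum>j\<in>UNIV. (x - p) $ i / ((x - p) \<bullet> (x - p)) * partial j (partial j \<phi>) x)"
      unfolding set_integrable_def scaleR_sum_right
      by (intro Bochner_Integration.integrable_sum
          continuous_bounded_imp_set_integrable[unfolded set_integrable_def, OF lint test_functions_partial[OF test_functions_partial[OF phiU]]])
    thus ?thesis by (simp add: set_integrable_def lap_def sum_distrib_left)
  qed
  have "distr_laplacian (regular_distr S (dipole_field a p)) \<phi> =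
     (LINT x:S|lebesgue. (\<Sum>j\<in>UNIV. dipole_field a p x * partial j (partial j \<phi>) x))"
    unfolding distr_laplacian_regular set_lebesgue_integral_def scaleR_sum_right
    by (subst Bochner_Integration.integral_sum)
      (rule continuous_bounded_imp_set_integrable[unfolded set_integrable_def, OF dipole_field_locally_integrable t] refl)+
  also have "\<dots> = integral\<^sup>L lebesgue (\<lambda>x. \<Sum>i\<in>UNIV. a $ i / (2 * pi) * ((x - p) $ i / ((x - p) \<bullet> (x - p)) * lap x))"
    unfolding set_lebesgue_integral_def
  proof (rule Bochner_Integration.integral_cong[OF refl])
    fix x
    have "(\<Sum>j\<in>UNIV. dipole_field a p x * partial j (partial j \<phi>) x) = dipole_field a p x * lap x"
      by (simp add: lap_def sum_distrib_left)
    moreover have "dipole_field a p x * lap x = (\<Sum>i\<in>UNIV. a $ i / (2 * pi) * ((x - p) $ i / ((x - p) \<bullet> (x - p)) * lap x))"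
      by (simp add: dipole_field_def inner_vec_def[of a] sum_divide_distrib sum_distrib_right mult.assoc)
    ultimately show "indicator S x *\<^sub>R (\<Sum>j\<in>UNIV. dipole_field a p x * partial j (partial j \<phi>) x) =
        (\<Sum>i\<in>UNIV. a $ i / (2 * pi) * ((x - p) $ i / ((x - p) \<bullet> (x - p)) * lap x))"
      using lap0[of x] by (cases "x \<in> S") auto
  qed
  also have "\<dots> = (\<Sum>i\<in>UNIV. a $ i / (2 * pi) * integral\<^sup>L lebesgue (\<lambda>x. (x - p) $ i / ((x - p) \<bullet> (x - p)) * lap x))"
    by (subst Bochner_Integration.integral_sum[OF integrable_mult_right[OF i1]])
      (intro sum.cong refl integral_mult_right_zero)
  also have "\<dots> = (\<Sum>i\<in>UNIV. a $ i * - partial i \<phi> p)"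
    unfolding lap_def integral_inverse_field_laplacian[OF phiU phi(2)] by (intro sum.cong) auto
  finally show ?thesis by (simp add: distr_dir_deriv_def distr_partial_def dirac_def)
qed


section \<open>A maximum principle for distributional harmonic functions\<close>

text \<open>The point \<open>x\<close> enters only through the mollifier, so a partial derivative
  falls on \<open>\<rho>\<close> with a minus sign. The difference quotients are dominated by
  \<open>L * \<bar>h y\<bar>\<close> with \<open>L\<close> a Lipschitz constant of
  \<open>\<rho>\<close>, so integrability of \<open>h\<close> is enough.\<close>

lemma differentiable_under_mollifier:
  fixes h \<rho> :: "real^2 \<Rightarrow> real"
  assumes h: "integrable lebesgue h" and rho: "\<rho> \<in> test_functions UNIV"
  shows "integrable lebesgue (\<lambda>y. h y * \<rho> (y - x))"
    and "((\<lambda>t. integral\<^sup>L lebesgue (\<lambda>y. h y * \<rho> (y - (x + t *\<^sub>R axis i 1)))) has_real_derivative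
           - integral\<^sup>L lebesgue (\<lambda>y. h y * partial i \<rho> (y - x))) (at 0)"
proof -
  obtain B where B: "B > 0" "\<And>x. \<bar>\<rho> x\<bar> \<le> B" using test_function_bounded[OF rho] by blast
  obtain L where L: "L > 0" "\<And>x y. \<bar>\<rho> x - \<rho> y\<bar> \<le> L * norm (x - y)" using test_function_lipschitz[OF rho] by blast
  have shm: "(\<lambda>y. f (y - z)) \<in> borel_measurable lebesgue" if "continuous_on UNIV f" for f :: "real^2 \<Rightarrow> real" and z
  proof -
    have "continuous_on UNIV (\<lambda>y. f (y - z))"
      by (rule continuous_on_compose2[OF that]) (auto intro!: continuous_intros)
    thus ?thesis by (simp add: borel_measurable_continuous_onI measurable_completion)
  qed
  have rc: "continuous_on UNIV \<rho>" "continuous_on UNIV (partial i \<rho>)"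
    by (intro smooth_continuous_on smooth_partial test_functions_smooth[OF rho])+
  have hm: "h \<in> borel_measurable lebesgue" using h by (rule borel_measurable_integrable)
  show int: "integrable lebesgue (\<lambda>y. h y * \<rho> (y - x))" for x
  proof (rule Bochner_Integration.integrable_bound[OF integrable_mult_right[OF h, of B]])
    show "(\<lambda>y. h y * \<rho> (y - x)) \<in> borel_measurable lebesgue"
      by (intro borel_measurable_times hm shm rc)
    show "AE y in lebesgue. norm (h y * \<rho> (y - x)) \<le> norm (B * h y)"
    proof (rule AE_I2)
      fix y
      show "norm (h y * \<rho> (y - x)) \<le> norm (B * h y)"
        using mult_right_mono[OF B(2)[of "y - x"] abs_ge_zero[of "h y"]] B(1) by (simp add: abs_mult mult.commute)
    qed
  qed
  let ?e = "axis i 1 :: real^2"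
  define I where "I t = integral\<^sup>L lebesgue (\<lambda>y. h y * \<rho> (y - (x + t *\<^sub>R ?e)))" for t
  have "((\<lambda>t. (I t - I 0) / t) \<longlongrightarrow> - integral\<^sup>L lebesgue (\<lambda>y. h y * partial i \<rho> (y - x))) (at 0)"
    unfolding tendsto_at_iff_sequentially
  proof (intro allI impI)
    fix X :: "nat \<Rightarrow> real" assume X: "\<forall>n. X n \<in> UNIV - {0}" "X \<longlonglongrightarrow> 0"
    have X0: "X n \<noteq> 0" for n using X(1) by auto
    define s where "s n y = h y * ((\<rho> (y - (x + X n *\<^sub>R ?e)) - \<rho> (y - x)) / X n)" for n y
    have eq: "((\<lambda>t. (I t - I 0) / t) \<circ> X) = (\<lambda>n. integral\<^sup>L lebesgue (s n))"
    proof
      fix n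
      have "I (X n) - I 0 = integral\<^sup>L lebesgue (\<lambda>y. h y * \<rho> (y - (x + X n *\<^sub>R ?e)) - h y * \<rho> (y - x))"
        unfolding I_def using int[of "x + X n *\<^sub>R ?e"] int[of x] by (simp add: Bochner_Integration.integral_diff)
      hence "(I (X n) - I 0) / X n = integral\<^sup>L lebesgue (\<lambda>y. (h y * \<rho> (y - (x + X n *\<^sub>R ?e)) - h y * \<rho> (y - x)) / X n)"
        by simp
      thus "((\<lambda>t. (I t - I 0) / t) \<circ> X) n = integral\<^sup>L lebesgue (s n)"
        by (simp add: s_def[abs_def] right_diff_distrib)
    qed
    have "(\<lambda>n. integral\<^sup>L lebesgue (s n)) \<longlonglongrightarrow> integral\<^sup>L lebesgue (\<lambda>y. h y * - partial i \<rho> (y - x))"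
    proof (rule integral_dominated_convergence[where w = "\<lambda>y. L * \<bar>h y\<bar>"])
      show "(\<lambda>y. h y * - partial i \<rho> (y - x)) \<in> borel_measurable lebesgue"
        by (intro borel_measurable_times borel_measurable_uminus hm shm rc)
      show "s n \<in> borel_measurable lebesgue" for n
        unfolding s_def[abs_def] by (intro borel_measurable_times borel_measurable_divide borel_measurable_diff borel_measurable_const hm shm rc)
      show "integrable lebesgue (\<lambda>y. L * \<bar>h y\<bar>)" using h by (intro integrable_mult_right integrable_abs)
      show "AE y in lebesgue. (\<lambda>n. s n y) \<longlonglongrightarrow> h y * - partial i \<rho> (y - x)"
      proof (rule AE_I2)
        fix y
        have "((\<lambda>t. \<rho> ((y - x) + t *\<^sub>R (- ?e))) has_real_derivative
            (\<Sum>j\<in>UNIV. (- ?e) $ j * partial j \<rho> (y - x))) (at 0)"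
          by (rule has_derivative_imp_line_derivative[OF smooth_has_derivative[OF test_functions_smooth[OF rho]]])
        moreover have "(\<Sum>j\<in>UNIV. (- ?e) $ j * partial j \<rho> (y - x)) = - partial i \<rho> (y - x)"
          using sum_axis_mult[of i "\<lambda>j. partial j \<rho> (y - x)"] by (simp add: sum_negf)
        ultimately have "((\<lambda>t. (\<rho> (y - x + t *\<^sub>R (- ?e)) - \<rho> (y - x)) / t) \<longlongrightarrow> - partial i \<rho> (y - x)) (at 0)"
          by (simp add: DERIV_def)
        hence "((\<lambda>t. (\<rho> (y - x + t *\<^sub>R (- ?e)) - \<rho> (y - x)) / t) \<circ> X) \<longlonglongrightarrow> - partial i \<rho> (y - x)"
          using X unfolding tendsto_at_iff_sequentially by blast
        hence "(\<lambda>n. (\<rho> (y - (x + X n *\<^sub>R ?e)) - \<rho> (y - x)) / X n) \<longlonglongrightarrow> - partial i \<rho> (y - x)"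
          by (simp add: o_def diff_diff_eq)
        thus "(\<lambda>n. s n y) \<longlonglongrightarrow> h y * - partial i \<rho> (y - x)"
          unfolding s_def by (intro tendsto_mult tendsto_const)
      qed
      show "AE y in lebesgue. norm (s n y) \<le> L * \<bar>h y\<bar>" for n
      proof (rule AE_I2)
        fix y
        have "\<bar>\<rho> (y - (x + X n *\<^sub>R ?e)) - \<rho> (y - x)\<bar> \<le> L * norm (X n *\<^sub>R ?e)"
          using L(2)[of "y - (x + X n *\<^sub>R ?e)" "y - x"] by simp
        also have "\<dots> = L * \<bar>X n\<bar>" by simp
        finally have "\<bar>\<rho> (y - (x + X n *\<^sub>R ?e)) - \<rho> (y - x)\<bar> / \<bar>X n\<bar> \<le> L" using X0[of n] by (simp add: divide_le_eq)
        hence "\<bar>h y\<bar> * (\<bar>\<rho> (y - (x + X n *\<^sub>R ?e)) - \<rho> (y - x)\<bar> / \<bar>X n\<bar>) \<le> \<bar>h y\<bar> * L"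
          by (intro mult_left_mono) auto
        thus "norm (s n y) \<le> L * \<bar>h y\<bar>" by (simp add: s_def abs_mult abs_divide mult.commute)
      qed
    qed
    thus "((\<lambda>t. (I t - I 0) / t) \<circ> X) \<longlonglongrightarrow> - integral\<^sup>L lebesgue (\<lambda>y. h y * partial i \<rho> (y - x))"
      unfolding eq by simp
  qed
  hence "(I has_real_derivative - integral\<^sup>L lebesgue (\<lambda>y. h y * partial i \<rho> (y - x))) (at 0)"
    by (simp add: DERIV_def)
  thus "((\<lambda>t. integral\<^sup>L lebesgue (\<lambda>y. h y * \<rho> (y - (x + t *\<^sub>R ?e)))) has_real_derivative
           - integral\<^sup>L lebesgue (\<lambda>y. h y * partial i \<rho> (y - x))) (at 0)"
    unfolding I_def .
qed

text \<open>A positive second derivative would make the first derivative positive just to the right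
  of its zero at the maximum, and the mean value theorem would then give a larger value.\<close>

lemma second_derivative_le_0_at_max:
  fixes j j1 :: "real \<Rightarrow> real"
  assumes d: "d > 0" and j: "\<And>t. \<bar>t\<bar> < d \<Longrightarrow> (j has_real_derivative j1 t) (at t)"
    and j1: "(j1 has_real_derivative j2) (at 0)"
    and max: "\<And>t. \<bar>t\<bar> < d \<Longrightarrow> j t \<le> j 0"
  shows "j2 \<le> 0"
proof (rule ccontr)
  assume "\<not> j2 \<le> 0"
  have "j1 0 = 0"
    by (rule DERIV_local_max[OF j[of 0] d]) (use max d in auto)
  with DERIV_pos_inc_right[OF j1] \<open>\<not> j2 \<le> 0\<close>
  obtain e where e: "e > 0" "\<And>t. 0 < t \<Longrightarrow> t < e \<Longrightarrow> j1 t > 0" by auto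
  define t where "t = min d e / 2"
  have t: "0 < t" "t < d" "t < e" using d e by (auto simp: t_def)
  have "\<exists>z. 0 < z \<and> z < t \<and> j t - j 0 = (t - 0) * j1 z"
    by (rule MVT2[OF t(1)]) (use t in \<open>auto intro!: j\<close>)
  then obtain z where "0 < z" "z < t" "j t - j 0 = t * j1 z" by auto
  moreover have "t * j1 z > 0" using e(2)[of z] t calculation by (intro mult_pos_pos) auto
  ultimately have "j t > j 0" by linarith
  thus False using max[of t] t by simp
qed

text \<open>Testing against \<open>bumps\<close> alone fits both ends of the argument: the Laplacian
  of the dipole field is computed there, and the maximum principle tests only with a translate of
  one \<open>box_bump\<close>.\<close>

definition weakly_harmonic :: "(real^2) set \<Rightarrow> (real^2 \<Rightarrow> real) \<Rightarrow> bool" where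
  "weakly_harmonic S h \<longleftrightarrow> locally_integrable_on h S \<and>
     (\<forall>\<phi>\<in>test_functions S \<inter> bumps. distr_laplacian (regular_distr S h) \<phi> = 0)"

text \<open>Only mollifications of \<open>h\<close> are differentiated; hence no regularity of \<open>h\<close> at the exceptional
  point \<open>p\<close> is needed.\<close>

lemma weak_maximum_principle:
  fixes h :: "real^2 \<Rightarrow> real"
  assumes S: "open S" and wh: "weakly_harmonic S h" and cont: "continuous_on (S - {p}) h"
    and V: "open V" "bounded V" "closure V \<subseteq> S" "p \<notin> frontier V"
    and bd: "\<And>x. x \<in> frontier V \<Longrightarrow> h x \<le> m" and x0: "x0 \<in> V" "x0 \<noteq> p"
  shows "h x0 \<le> m"
proof (rule ccontr)
  assume "\<not> h x0 \<le> m"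
  \<comment> \<open>With a quarter of the excess, \<open>h < m + \<eta>\<close> near the frontier
    and \<open>h > m + 3 * \<eta>\<close> near \<open>x0\<close>. The remaining gap
    \<open>2 * \<eta>\<close> survives mollification and leaves room for a quadratic perturbation of
    size \<open>\<eta> / 2\<close>.\<close>
  define \<eta> where "\<eta> = (h x0 - m) / 4"
  have eta: "\<eta> > 0" using \<open>\<not> h x0 \<le> m\<close> by (simp add: \<eta>_def)
  have oSp: "open (S - {p})" using S by (simp add: open_delete)
  have cV: "compact (closure V)" and cF: "compact (frontier V)"
    using V by (auto simp: compact_closure compact_frontier_bounded)
  have "open {y \<in> S - {p}. h y < m + \<eta>}"
    using continuous_open_preimage[OF cont oSp open_lessThan[of "m + \<eta>"]] by (simp add: vimage_def Int_def conj_commute)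
  moreover have "frontier V \<subseteq> {y \<in> S - {p}. h y < m + \<eta>}"
    using V bd eta by (force simp: frontier_def)
  ultimately obtain d1 where d1: "d1 > 0" "(\<Union>x\<in>frontier V. ball x d1) \<subseteq> {y \<in> S - {p}. h y < m + \<eta>}"
    using compact_subset_open_imp_ball_epsilon_subset[OF cF] by blast
  have "open {y \<in> S - {p}. h x0 - \<eta> < h y}"
    using continuous_open_preimage[OF cont oSp open_greaterThan[of "h x0 - \<eta>"]] by (simp add: vimage_def Int_def conj_commute)
  moreover have "x0 \<in> {y \<in> S - {p}. h x0 - \<eta> < h y}" using x0 V eta closure_subset by auto
  ultimately obtain d2 where d2: "d2 > 0" "ball x0 d2 \<subseteq> {y \<in> S - {p}. h x0 - \<eta> < h y}"
    by (rule openE)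
  obtain d3 where d3: "d3 > 0" "(\<Union>x\<in>closure V. cball x d3) \<subseteq> S"
    using compact_subset_open_imp_cball_epsilon_subset[OF cV S V(3)] by blast
  define K where "K = (\<Union>x\<in>closure V. cball x d3)"
  have cK: "compact K"
  proof -
    have "K = (\<lambda>z. fst z + snd z) ` (closure V \<times> cball 0 d3)"
    proof (intro set_eqI iffI)
      fix y assume "y \<in> K"
      then obtain x where x: "x \<in> closure V" "y \<in> cball x d3" by (auto simp: K_def)
      hence "(x, y - x) \<in> closure V \<times> cball 0 d3" by (auto simp: dist_norm norm_minus_commute)
      moreover have "y = fst (x, y - x) + snd (x, y - x)" by simp
      ultimately show "y \<in> (\<lambda>z. fst z + snd z) ` (closure V \<times> cball 0 d3)" by blast
    qed (auto simp: K_def dist_norm intro!: bexI)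
    moreover have "compact (closure V \<times> cball (0::real^2) d3)" by (intro compact_Times cV compact_cball)
    ultimately show ?thesis by (auto intro!: compact_continuous_image continuous_intros)
  qed
  have KS: "K \<subseteq> S" using d3 by (simp add: K_def)
  \<comment> \<open>\<open>box_bump r\<close> lives within distance \<open>2 * r\<close> of its
    centre; the quarter keeps that inside all three neighbourhoods.\<close>
  define r where "r = min (min d1 d2) d3 / 4"
  have r: "r > 0" "2 * r < d1" "2 * r < d2" "2 * r \<le> d3" using d1 d2 d3 by (auto simp: r_def)
  \<comment> \<open>Truncation to \<open>K\<close> makes \<open>h\<close> integrable over the plane
    without changing the mollification at points of \<open>closure V\<close>.\<close>
  define h0 where "h0 y = indicator K y *\<^sub>R h y" for y
  have h0: "integrable lebesgue h0"
    using wh cK KS unfolding weakly_harmonic_def locally_integrable_on_def set_integrable_def h0_def by blast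
  define \<rho> where "\<rho> = box_bump r 0"
  have rho: "\<rho> \<in> test_functions UNIV" "\<rho> \<in> bumps"
    unfolding \<rho>_def by (auto intro: box_bump_test_function box_bump_in_bumps)
  have rsh: "\<rho> (y - x) = box_bump r x y" for x y unfolding \<rho>_def by (rule box_bump_shift[symmetric])
  define c where "c = integral\<^sup>L lebesgue \<rho>"
  have c: "c > 0" unfolding c_def \<rho>_def by (rule integral_box_bump_pos[OF r(1)])
  have cx: "integral\<^sup>L lebesgue (\<lambda>y. \<rho> (y - x)) = c" for x
    unfolding rsh c_def using integral_box_bump[of r x] by (simp add: \<rho>_def)
  have irho: "integrable lebesgue (\<lambda>y. \<rho> (y - x))" for x unfolding rsh by (rule integrable_box_bump)
  define I where "I x = integral\<^sup>L lebesgue (\<lambda>y. h0 y * \<rho> (y - x))" for x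
  have Ifr: "I x \<le> (m + \<eta>) * c" if x: "x \<in> frontier V" for x
  proof -
    have "I x \<le> integral\<^sup>L lebesgue (\<lambda>y. (m + \<eta>) * \<rho> (y - x))"
      unfolding I_def
    proof (intro integral_mono differentiable_under_mollifier(1)[OF h0 rho(1)] integrable_mult_right irho)
      fix y
      show "h0 y * \<rho> (y - x) \<le> (m + \<eta>) * \<rho> (y - x)"
      proof (cases "norm (y - x) \<ge> 2 * r")
        case True thus ?thesis unfolding rsh by (simp add: box_bump_eq_0)
      next
        case False
        hence y: "y \<in> ball x d1" "y \<in> cball x d3" using r by (auto simp: dist_norm norm_minus_commute)
        have "y \<in> K" using x y(2) unfolding K_def frontier_def by blast
        hence "h0 y \<le> m + \<eta>" using d1(2) x y(1) unfolding h0_def by fastforce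
        thus ?thesis unfolding rsh by (intro mult_right_mono box_bump_nonneg)
      qed
    qed
    thus ?thesis using cx[of x] by simp
  qed
  have I0: "I x0 \<ge> (h x0 - \<eta>) * c"
  proof -
    have "integral\<^sup>L lebesgue (\<lambda>y. (h x0 - \<eta>) * \<rho> (y - x0)) \<le> I x0"
      unfolding I_def
    proof (intro integral_mono differentiable_under_mollifier(1)[OF h0 rho(1)] integrable_mult_right irho)
      fix y
      show "(h x0 - \<eta>) * \<rho> (y - x0) \<le> h0 y * \<rho> (y - x0)"
      proof (cases "norm (y - x0) \<ge> 2 * r")
        case True thus ?thesis unfolding rsh by (simp add: box_bump_eq_0)
      next
        case False
        hence y: "y \<in> ball x0 d2" "y \<in> cball x0 d3" using r by (auto simp: dist_norm norm_minus_commute)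
        have "x0 \<in> closure V" using x0 closure_subset by blast
        hence "y \<in> K" using y(2) unfolding K_def by blast
        hence "h x0 - \<eta> \<le> h0 y" using d2(2) y(1) unfolding h0_def by fastforce
        thus ?thesis unfolding rsh by (intro mult_right_mono box_bump_nonneg)
      qed
    qed
    thus ?thesis using cx[of x0] by simp
  qed
  obtain R where R: "R > 0" "\<And>x. x \<in> closure V \<Longrightarrow> norm x \<le> R"
    using compact_imp_bounded[OF cV] bounded_pos by metis
  \<comment> \<open>Chosen so that \<open>\<kappa> * (x \<bullet> x)\<close> stays at most
    \<open>\<eta> * c / 2\<close> on \<open>closure V\<close>, too little to move the maximum to the
    frontier, while its Laplacian is strictly positive.\<close>
  define \<kappa> where "\<kappa> = \<eta> * c / (2 * R\<^sup>2)"
  have kap: "\<kappa> > 0" using eta c R by (simp add: \<kappa>_def)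
  define J where "J x = I x + \<kappa> * (x \<bullet> x)" for x
  have Jfr: "J x < J x0" if "x \<in> frontier V" for x
  proof -
    have "norm x \<le> R" using that R(2) by (simp add: frontier_def)
    hence "x \<bullet> x \<le> R\<^sup>2" by (simp add: dot_square_norm power_mono)
    hence "\<kappa> * (x \<bullet> x) \<le> \<kappa> * R\<^sup>2" using kap by (intro mult_left_mono) auto
    also have "\<kappa> * R\<^sup>2 = \<eta> * c / 2" using R by (simp add: \<kappa>_def)
    finally have "J x \<le> (m + \<eta>) * c + \<eta> * c / 2" using Ifr[OF that] by (simp add: J_def)
    also have "\<dots> < (h x0 - \<eta>) * c"
    proof -
      have "h x0 = m + 4 * \<eta>" by (simp add: \<eta>_def field_simps)
      thus ?thesis using mult_pos_pos[OF eta c] by (simp add: algebra_simps)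
    qed
    also have "\<dots> \<le> J x0" using I0 kap by (simp add: J_def add_increasing2)
    finally show ?thesis .
  qed
  have Icont: "continuous_on UNIV I"
  proof -
    obtain L where L: "L > 0" "\<And>x y. \<bar>\<rho> x - \<rho> y\<bar> \<le> L * norm (x - y)" using test_function_lipschitz[OF rho(1)] by blast
    define A where "A = integral\<^sup>L lebesgue (\<lambda>y. \<bar>h0 y\<bar>)"
    have "A \<ge> 0" unfolding A_def by (intro integral_nonneg_AE) simp
    have "\<bar>I x - I z\<bar> \<le> (L * A) * norm (x - z)" for x z
    proof -
      have "I x - I z = integral\<^sup>L lebesgue (\<lambda>y. h0 y * \<rho> (y - x) - h0 y * \<rho> (y - z))"
        unfolding I_def by (intro Bochner_Integration.integral_diff[symmetric] differentiable_under_mollifier(1)[OF h0 rho(1)])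
      also have "\<bar>\<dots>\<bar> \<le> integral\<^sup>L lebesgue (\<lambda>y. \<bar>h0 y\<bar> * (L * norm (x - z)))"
      proof (rule order_trans[OF integral_abs_bound integral_mono])
        show "integrable lebesgue (\<lambda>y. \<bar>h0 y * \<rho> (y - x) - h0 y * \<rho> (y - z)\<bar>)"
          by (intro integrable_abs Bochner_Integration.integrable_diff differentiable_under_mollifier(1)[OF h0 rho(1)])
        show "integrable lebesgue (\<lambda>y. \<bar>h0 y\<bar> * (L * norm (x - z)))" using h0 by (intro integrable_mult_left integrable_abs)
        fix y
        have "\<bar>\<rho> (y - x) - \<rho> (y - z)\<bar> \<le> L * norm (x - z)"
          using L(2)[of "y - x" "y - z"] by (simp add: norm_minus_commute)
        hence "\<bar>h0 y\<bar> * \<bar>\<rho> (y - x) - \<rho> (y - z)\<bar> \<le> \<bar>h0 y\<bar> * (L * norm (x - z))" by (intro mult_left_mono) auto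
        thus "\<bar>h0 y * \<rho> (y - x) - h0 y * \<rho> (y - z)\<bar> \<le> \<bar>h0 y\<bar> * (L * norm (x - z))"
          by (simp add: abs_mult flip: right_diff_distrib)
      qed
      also have "\<dots> = (L * A) * norm (x - z)" by (simp add: A_def)
      finally show ?thesis .
    qed
    hence "(L * A)-lipschitz_on UNIV I" using L(1) \<open>A \<ge> 0\<close> by (auto simp: lipschitz_on_def dist_norm)
    thus ?thesis by (rule lipschitz_on_continuous_on)
  qed
  have "continuous_on (closure V) J" unfolding J_def by (intro continuous_intros continuous_on_subset[OF Icont]) auto
  moreover have "closure V \<noteq> {}" using x0 closure_subset by blast
  ultimately obtain x1 where x1: "x1 \<in> closure V" "\<And>x. x \<in> closure V \<Longrightarrow> J x \<le> J x1"
    using continuous_attains_sup[OF cV] by blast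
  have "x0 \<in> closure V" using x0 closure_subset by blast
  hence "x1 \<notin> frontier V" using Jfr[of x1] x1(2)[of x0] by force
  hence "x1 \<in> V" using x1(1) V(1) by (simp add: frontier_def interior_open)
  obtain d where d: "d > 0" "ball x1 d \<subseteq> V" by (rule openE[OF V(1) \<open>x1 \<in> V\<close>])
  \<comment> \<open>At the interior maximum each pure second derivative of \<open>J\<close> is
    nonpositive; summing over the axes makes the Laplacian of the mollified function at most
    \<open>- 4 * \<kappa>\<close>, against harmonicity.\<close>
  have second: "integral\<^sup>L lebesgue (\<lambda>y. h0 y * partial i (partial i \<rho>) (y - x1)) + 2 * \<kappa> \<le> 0" for i
  proof (rule second_derivative_le_0_at_max[OF d(1)])
    let ?e = "axis i 1 :: real^2"
    note t = test_functions_partial[OF rho(1), of i]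
    have sh: "(f has_real_derivative D) (at t)" if "((\<lambda>s. f (t + s)) has_real_derivative D) (at 0)" for f D and t :: real
      using that DERIV_shift[of f D 0 t] by (simp add: add.commute)
    have q: "((\<lambda>s. \<kappa> * ((x1 + s *\<^sub>R ?e) \<bullet> (x1 + s *\<^sub>R ?e))) has_real_derivative 2 * \<kappa> * ((x1 + t *\<^sub>R ?e) $ i)) (at t)" for t
    proof -
      have "(x1 + s *\<^sub>R ?e) \<bullet> (x1 + s *\<^sub>R ?e) = x1 \<bullet> x1 + 2 * s * (x1 $ i) + s * s" for s
        by (simp add: inner_add inner_axis inner_axis' algebra_simps)
      moreover have "((\<lambda>s. \<kappa> * (x1 \<bullet> x1 + 2 * s * (x1 $ i) + s * s)) has_real_derivative 2 * \<kappa> * ((x1 + t *\<^sub>R ?e) $ i)) (at t)"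
        by (auto intro!: derivative_eq_intros simp: algebra_simps)
      ultimately show ?thesis by simp
    qed
    show "((\<lambda>t. J (x1 + t *\<^sub>R ?e)) has_real_derivative
        - integral\<^sup>L lebesgue (\<lambda>y. h0 y * partial i \<rho> (y - (x1 + t *\<^sub>R ?e))) + 2 * \<kappa> * ((x1 + t *\<^sub>R ?e) $ i)) (at t)" for t
    proof -
      have "((\<lambda>s. I (x1 + (t + s) *\<^sub>R ?e)) has_real_derivative
          - integral\<^sup>L lebesgue (\<lambda>y. h0 y * partial i \<rho> (y - (x1 + t *\<^sub>R ?e)))) (at 0)"
        using differentiable_under_mollifier(2)[OF h0 rho(1), of "x1 + t *\<^sub>R ?e" i]
        unfolding I_def by (simp add: scaleR_add_left add.assoc)
      from DERIV_add[OF sh[OF this] q] show ?thesis unfolding J_def .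
    qed
    have "((\<lambda>t. - integral\<^sup>L lebesgue (\<lambda>y. h0 y * partial i \<rho> (y - (x1 + t *\<^sub>R ?e)))) has_real_derivative
        - (- integral\<^sup>L lebesgue (\<lambda>y. h0 y * partial i (partial i \<rho>) (y - x1)))) (at 0)"
      by (rule DERIV_minus[OF differentiable_under_mollifier(2)[OF h0 t]])
    moreover have "((\<lambda>t. 2 * \<kappa> * ((x1 + t *\<^sub>R ?e) $ i)) has_real_derivative 2 * \<kappa>) (at 0)"
      by (auto intro!: derivative_eq_intros)
    ultimately show "((\<lambda>t. - integral\<^sup>L lebesgue (\<lambda>y. h0 y * partial i \<rho> (y - (x1 + t *\<^sub>R ?e))) + 2 * \<kappa> * ((x1 + t *\<^sub>R ?e) $ i))
        has_real_derivative integral\<^sup>L lebesgue (\<lambda>y. h0 y * partial i (partial i \<rho>) (y - x1)) + 2 * \<kappa>) (at 0)"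
      using DERIV_add by fastforce
    show "J (x1 + t *\<^sub>R ?e) \<le> J (x1 + 0 *\<^sub>R ?e)" if "\<bar>t\<bar> < d" for t
    proof -
      have "x1 + t *\<^sub>R ?e \<in> ball x1 d" using that by (simp add: dist_norm)
      hence "x1 + t *\<^sub>R ?e \<in> closure V" using d(2) closure_subset[of V] by blast
      thus ?thesis using x1(2) by simp
    qed
  qed
  \<comment> \<open>The translate of the mollifier to \<open>x1\<close> is itself a test function,
    and testing \<open>h\<close> with it evaluates the Laplacian of the mollified function at
    \<open>x1\<close>.\<close>
  define \<phi> where "\<phi> = box_bump r x1"
  have cb: "cball x1 (2 * r) \<subseteq> K" using x1(1) r(4) unfolding K_def by (auto intro!: bexI[of _ x1])
  have phi: "\<phi> \<in> test_functions S" "\<phi> \<in> bumps"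
    unfolding \<phi>_def using cb KS by (auto intro: box_bump_test_function box_bump_in_bumps)
  have phi0: "\<phi> x = 0" if "x \<notin> cball x1 (2 * r)" for x
    using that unfolding \<phi>_def by (intro box_bump_eq_0) (auto simp: dist_norm norm_minus_commute)
  have psh: "partial i (\<lambda>y. f (y - x1)) y = partial i f (y - x1)" if "smooth f" for f i y
  proof -
    have "((\<lambda>y. y - x1) has_derivative (\<lambda>h. h)) (at y)" by (auto intro!: derivative_eq_intros)
    from has_derivative_compose[OF this smooth_has_derivative[OF that]]
    show ?thesis by (simp add: partial_eqI sum_axis_mult)
  qed
  have p2: "partial i (partial i \<phi>) y = partial i (partial i \<rho>) (y - x1)" for i y
  proof -
    have "\<phi> = (\<lambda>y. \<rho> (y - x1))" by (simp add: rsh \<phi>_def)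
    moreover have "partial i (\<lambda>y. \<rho> (y - x1)) = (\<lambda>y. partial i \<rho> (y - x1))"
      by (intro ext psh test_functions_smooth[OF rho(1)])
    ultimately show ?thesis by (simp add: psh smooth_partial test_functions_smooth[OF rho(1)])
  qed
  have "0 = distr_laplacian (regular_distr S h) \<phi>" using wh phi unfolding weakly_harmonic_def by auto
  also have "\<dots> = (\<Sum>i\<in>UNIV. integral\<^sup>L lebesgue (\<lambda>y. h0 y * partial i (partial i \<rho>) (y - x1)))"
    unfolding distr_laplacian_regular set_lebesgue_integral_def
  proof (intro sum.cong refl Bochner_Integration.integral_cong)
    fix i :: 2 and y
    show "indicator S y *\<^sub>R (h y * partial i (partial i \<phi>) y) = h0 y * partial i (partial i \<rho>) (y - x1)"
    proof (cases "y \<in> cball x1 (2 * r)")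
      case True
      hence "y \<in> K" "y \<in> S" using cb KS by auto
      thus ?thesis by (simp add: h0_def p2)
    next
      case False
      hence "partial i (partial i \<phi>) y = 0"
        by (intro partial_eq_0_outside[OF compact_cball partial_eq_0_outside[OF compact_cball phi0]])
      thus ?thesis using p2 by simp
    qed
  qed
  also have "\<dots> = integral\<^sup>L lebesgue (\<lambda>y. h0 y * partial 1 (partial 1 \<rho>) (y - x1)) +
     integral\<^sup>L lebesgue (\<lambda>y. h0 y * partial 2 (partial 2 \<rho>) (y - x1))" by (simp add: sum_2)
  also have "\<dots> < 0" using second[of 1] second[of 2] kap by linarith
  finally show False by simp
qed


section \<open>The dipole potential of a strip and its periodisation\<close>

lemma exp_double_times: "exp (2 * y) = exp y * exp y" for y :: real
  by (simp flip: exp_add)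

lemma cmod_sin_squared: "(cmod (sin w))\<^sup>2 = (sin (Re w))\<^sup>2 + (sinh (Im w))\<^sup>2"
  unfolding norm_sin_squared cos_double_sin sinh_field_def exp_double_times exp_minus
  by (simp add: power2_eq_square field_simps)

lemma cmod_cos_squared: "(cmod (cos w))\<^sup>2 = (cos (Re w))\<^sup>2 + (sinh (Im w))\<^sup>2"
  unfolding norm_cos_squared cos_double_cos sinh_field_def exp_double_times exp_minus
  by (simp add: power2_eq_square field_simps)

lemma sinh_real_ge_arg: "y \<le> sinh y" if "y \<ge> 0" for y :: real
proof (cases "y = 0")
  case False
  hence "0 < y" using that by simp
  have "\<exists>z. 0 < z \<and> z < y \<and> sinh y - sinh 0 = (y - 0) * cosh z"
    by (rule MVT2[OF \<open>0 < y\<close>]) (auto intro!: derivative_eq_intros)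
  then obtain z where "sinh y = y * cosh z" by auto
  moreover have "y * 1 \<le> y * cosh z" using \<open>0 < y\<close> cosh_real_ge_1[of z] by (intro mult_left_mono) auto
  ultimately show ?thesis by simp
qed simp

lemma sinh_abs_squared: "(sinh \<bar>y\<bar>)\<^sup>2 = (sinh y)\<^sup>2" for y :: real
  by (cases "y \<ge> 0") (auto simp: abs_if)

lemma sinh_squared_ge: "y\<^sup>2 \<le> (sinh y)\<^sup>2" for y :: real
  using power_mono[OF sinh_real_ge_arg[of "\<bar>y\<bar>"], of 2] by (simp add: sinh_abs_squared)

text \<open>Halving the argument, \<open>sinh (2 t) = 2 sinh t cosh t\<close> with
  \<open>sinh t \<ge> t\<close> and \<open>cosh t \<ge> exp t / 2\<close> for nonnegative
  \<open>t\<close>. The factor \<open>y^2\<close> is kept beside the exponential so that one bound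
  serves both near the pole and far along the strip.\<close>

lemma sinh_squared_ge_exp: "y\<^sup>2 * exp \<bar>y\<bar> / 4 \<le> (sinh y)\<^sup>2" for y :: real
proof -
  define t where "t = \<bar>y\<bar> / 2"
  have t: "t \<ge> 0" by (simp add: t_def)
  have "cosh t \<ge> exp t / 2" by (simp add: cosh_def)
  hence "2 * (t * (exp t / 2)) \<le> 2 * (sinh t * cosh t)"
    using sinh_real_ge_arg[OF t] t by (intro mult_left_mono mult_mono) auto
  hence "t * exp t \<le> sinh \<bar>y\<bar>" using sinh_double[of t] by (simp add: t_def)
  hence "(t * exp t)\<^sup>2 \<le> (sinh \<bar>y\<bar>)\<^sup>2" using t by (intro power_mono) auto
  moreover have "(t * exp t)\<^sup>2 = y\<^sup>2 * exp \<bar>y\<bar> / 4"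
  proof -
    have "(exp t)\<^sup>2 = exp \<bar>y\<bar>" by (simp add: t_def power2_eq_square flip: exp_add)
    thus ?thesis by (simp add: power_mult_distrib t_def power_divide)
  qed
  ultimately show ?thesis by (simp add: sinh_abs_squared)
qed

lemma sinh_ge_exp_quarter: "exp y / 4 \<le> sinh y" if "y \<ge> 1" for y :: real
proof -
  define b where "b = exp (- y)"
  have "2 \<le> exp y" using exp_ge_add_one_self[of y] that by linarith
  moreover have "b \<le> 1" using that by (simp add: b_def)
  moreover have "4 * sinh y = 2 * exp y - 2 * b" by (simp add: sinh_field_def b_def)
  ultimately have "exp y \<le> 4 * sinh y" by linarith
  thus ?thesis by simp
qed

lemma sinh_squared_le: "(sinh y)\<^sup>2 \<le> 4 * y\<^sup>2" if "\<bar>y\<bar> \<le> 1" for y :: real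
proof -
  define t where "t = \<bar>y\<bar>"
  have t: "0 \<le> t" "t \<le> 1" using that by (auto simp: t_def)
  define a b where "a = exp t" and "b = exp (- t)"
  have "a \<le> 1 + t + t\<^sup>2" unfolding a_def using exp_bound t by auto
  moreover have "b \<ge> 1 - t" unfolding b_def using exp_ge_add_one_self[of "-t"] by simp
  moreover have "t\<^sup>2 \<le> t" using t by (simp add: power2_eq_square mult_left_le)
  moreover have "2 * sinh t = a - b" by (simp add: sinh_field_def a_def b_def)
  ultimately have "2 * sinh t \<le> 2 * (2 * t)" using t by linarith
  hence "sinh t \<le> 2 * t" by simp
  hence "(sinh t)\<^sup>2 \<le> (2 * t)\<^sup>2" using t by (intro power_mono) auto
  thus ?thesis by (simp add: t_def sinh_abs_squared power_mult_distrib)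
qed

lemma sin_squared_ge_half: "x\<^sup>2 / 2 \<le> (sin x)\<^sup>2" if "\<bar>x\<bar> \<le> pi / 4" for x :: real
proof (cases "x = 0")
  case False
  define t where "t = \<bar>x\<bar>"
  have t: "0 < t" "t \<le> pi / 4" using False that by (auto simp: t_def)
  have "\<exists>z. 0 < z \<and> z < t \<and> sin t - sin 0 = (t - 0) * cos z"
    by (rule MVT2[OF t(1)]) (auto intro!: derivative_eq_intros)
  then obtain z where z: "0 < z" "z < t" "sin t = t * cos z" by auto
  have "cos z \<ge> cos (pi / 4)" using z t by (intro cos_monotone_0_pi_le) auto
  hence "(cos z)\<^sup>2 \<ge> (cos (pi / 4))\<^sup>2" by (intro power_mono) (auto simp: cos_45)
  hence "(cos z)\<^sup>2 \<ge> 1 / 2" by (simp add: cos_45 power_divide)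
  hence "t\<^sup>2 * (1 / 2) \<le> t\<^sup>2 * (cos z)\<^sup>2" by (intro mult_left_mono) auto
  hence "t\<^sup>2 / 2 \<le> (sin t)\<^sup>2" using z by (simp add: power_mult_distrib)
  thus ?thesis by (cases "x \<ge> 0") (auto simp: t_def abs_if)
qed simp

lemma cos_squared_ge_half: "1 / 2 \<le> (cos x)\<^sup>2" if "\<bar>x\<bar> \<le> pi / 4" for x :: real
proof -
  have "cos \<bar>x\<bar> \<ge> cos (pi / 4)" using that by (intro cos_monotone_0_pi_le) auto
  hence "(cos \<bar>x\<bar>)\<^sup>2 \<ge> (cos (pi / 4))\<^sup>2" by (intro power_mono) (auto simp: cos_45)
  thus ?thesis by (simp add: cos_45 power_divide)
qed

lemma cmod_sin_squared_ge: "(cmod w)\<^sup>2 / 2 \<le> (cmod (sin w))\<^sup>2" if "\<bar>Re w\<bar> \<le> pi / 4"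
  using sin_squared_ge_half[OF that] sinh_squared_ge[of "Im w"] zero_le_power2[of "Im w"] cmod_power2[of w]
  unfolding cmod_sin_squared by argo

lemma sinh_squared_ge_exp_cmod:
  assumes "\<bar>Re w\<bar> \<le> pi / 4" "\<bar>Im w\<bar> > 1"
  shows "(cmod w)\<^sup>2 * exp (cmod w) / 36 \<le> (sinh (Im w))\<^sup>2"
proof -
  have r1: "\<bar>Re w\<bar> \<le> 1" using assms(1) pi_less_4 by linarith
  have "(Re w)\<^sup>2 \<le> 1" using r1 by (simp add: abs_square_le_1)
  moreover have "1 \<le> (Im w)\<^sup>2" using assms(2) one_le_power[of "\<bar>Im w\<bar>" 2] by simp
  ultimately have c2: "(cmod w)\<^sup>2 \<le> 2 * (Im w)\<^sup>2" by (simp add: cmod_power2)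
  have "cmod w \<le> \<bar>Im w\<bar> + 1" using cmod_le[of w] r1 by linarith
  hence "exp (cmod w) \<le> exp \<bar>Im w\<bar> * exp 1" by (simp flip: exp_add)
  also have "\<dots> \<le> exp \<bar>Im w\<bar> * 3" using exp_le by (intro mult_left_mono) auto
  finally have "(cmod w)\<^sup>2 * exp (cmod w) \<le> (2 * (Im w)\<^sup>2) * (exp \<bar>Im w\<bar> * 3)"
    using c2 by (intro mult_mono) auto
  also have "\<dots> = 6 * ((Im w)\<^sup>2 * exp \<bar>Im w\<bar>)" by simp
  finally have "(cmod w)\<^sup>2 * exp (cmod w) \<le> 6 * ((Im w)\<^sup>2 * exp \<bar>Im w\<bar>)" .
  moreover have "(Im w)\<^sup>2 * exp \<bar>Im w\<bar> \<ge> 0" by simp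
  ultimately show ?thesis using sinh_squared_ge_exp[of "Im w"] by argo
qed

lemma exp_cmod_le_9:
  assumes "\<bar>Re w\<bar> \<le> pi / 4" "\<bar>Im w\<bar> \<le> 1"
  shows "exp (cmod w) \<le> 9" "(cmod w)\<^sup>2 \<le> 2"
proof -
  have r1: "\<bar>Re w\<bar> \<le> 1" using assms(1) pi_less_4 by linarith
  have "cmod w \<le> 2" using cmod_le[of w] r1 assms by linarith
  hence "exp (cmod w) \<le> exp (1 + 1)" by simp
  also have "\<dots> = exp 1 * exp (1::real)" by (rule exp_add)
  also have "\<dots> \<le> 3 * 3" using exp_le by (intro mult_mono) auto
  finally show "exp (cmod w) \<le> 9" by simp
  show "(cmod w)\<^sup>2 \<le> 2" using r1 assms(2) abs_square_le_1[of "Re w"] abs_square_le_1[of "Im w"]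
    by (simp add: cmod_power2)
qed

lemma inverse_bound_exp:
  assumes "w \<noteq> 0" "(cmod w)\<^sup>2 * exp (cmod w) / 36 \<le> (cmod z)\<^sup>2"
  shows "cmod (c / z\<^sup>2) \<le> 36 * cmod c * exp (- cmod w) / (cmod w)\<^sup>2"
proof -
  have p: "(cmod w)\<^sup>2 * exp (cmod w) / 36 > 0" using assms(1) by simp
  hence "(cmod z)\<^sup>2 > 0" using assms(2) by linarith
  hence "cmod c / (cmod z)\<^sup>2 \<le> cmod c / ((cmod w)\<^sup>2 * exp (cmod w) / 36)"
    using assms(2) p by (intro divide_left_mono mult_pos_pos) auto
  also have "\<dots> = 36 * cmod c * exp (- cmod w) / (cmod w)\<^sup>2" by (simp add: exp_minus field_simps)
  finally show ?thesis by (simp add: norm_divide norm_power)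
qed

text \<open>The constant \<open>36\<close> serves sine and cosine alike. For
  \<open>\<bar>Im w\<bar> > 1\<close> the hyperbolic part would allow \<open>24\<close>; in the
  remaining box \<open>exp (cmod w) \<le> 9\<close> and \<open>(cmod w)^2 \<le> 2\<close>, and the
  lower bound \<open>1 / 2\<close> of the squared cosine then asks for
  \<open>2 * 9 / 36\<close>.\<close>

lemma cmod_sin_squared_ge_exp:
  assumes "\<bar>Re w\<bar> \<le> pi / 4"
  shows "(cmod w)\<^sup>2 * exp (cmod w) / 36 \<le> (cmod (sin w))\<^sup>2"
proof (cases "\<bar>Im w\<bar> > 1")
  case True
  thus ?thesis using sinh_squared_ge_exp_cmod[OF assms True] by (simp add: cmod_sin_squared add_increasing)
next
  case False
  hence "(cmod w)\<^sup>2 * exp (cmod w) \<le> (cmod w)\<^sup>2 * 9"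
    using exp_cmod_le_9(1)[OF assms] by (intro mult_left_mono) auto
  thus ?thesis using cmod_sin_squared_ge[OF assms] zero_le_power2[of "cmod w"] by argo
qed

lemma cmod_cos_squared_ge_exp:
  assumes "\<bar>Re w\<bar> \<le> pi / 4"
  shows "(cmod w)\<^sup>2 * exp (cmod w) / 36 \<le> (cmod (cos w))\<^sup>2"
proof (cases "\<bar>Im w\<bar> > 1")
  case True
  thus ?thesis using sinh_squared_ge_exp_cmod[OF assms True] by (simp add: cmod_cos_squared add_increasing)
next
  case False
  hence "(cmod w)\<^sup>2 * exp (cmod w) \<le> 2 * 9"
    using exp_cmod_le_9[OF assms] by (intro mult_mono) auto
  thus ?thesis using cos_squared_ge_half[OF assms] by (simp add: cmod_cos_squared add_increasing2)
qed

section \<open>The dipole in a strip\<close>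

text \<open>The potential of a dipole at \<open>0\<close>, with polar part \<open>- a / w\<close>,
  in the strip \<open>\<bar>Re w\<bar> \<le> pi / 4\<close>. An odd number of reflections in the two
  boundary lines carries the pole to the odd multiples of \<open>pi / 2\<close>, the poles of
  \<open>tan\<close>, and conjugates the moment; an even number gives the other poles of
  \<open>cot\<close>.\<close>

definition strip_dipole :: "complex \<Rightarrow> complex \<Rightarrow> complex" where
  "strip_dipole a w = - a * cot w + cnj a * tan w"

definition strip_dipole_deriv :: "complex \<Rightarrow> complex \<Rightarrow> complex" where
  "strip_dipole_deriv a w = a / (sin w)\<^sup>2 + cnj a / (cos w)\<^sup>2"

lemma strip_dipole_minus: "strip_dipole a (- w) = - strip_dipole a w"
  by (simp add: strip_dipole_def cot_def tan_def)

lemma cos_nonzero_strip: "\<bar>Re w\<bar> < pi / 2 \<Longrightarrow> cos w \<noteq> 0"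
proof
  assume w: "\<bar>Re w\<bar> < pi / 2" "cos w = 0"
  have "cos (Re w) > 0" using w by (intro cos_gt_zero_pi) auto
  moreover have "(cos (Re w))\<^sup>2 + (sinh (Im w))\<^sup>2 = 0" using w cmod_cos_squared[of w] by simp
  ultimately show False by (metis less_irrefl power2_eq_iff_nonneg sum_power2_eq_zero_iff)
qed

lemma sin_nonzero_strip: "\<bar>Re w\<bar> < pi / 2 \<Longrightarrow> w \<noteq> 0 \<Longrightarrow> sin w \<noteq> 0"
proof
  assume w: "\<bar>Re w\<bar> < pi / 2" "w \<noteq> 0" "sin w = 0"
  have "(sin (Re w))\<^sup>2 + (sinh (Im w))\<^sup>2 = 0" using w cmod_sin_squared[of w] by simp
  hence z: "sin (Re w) = 0" "sinh (Im w) = 0" by (auto simp: sum_power2_eq_zero_iff)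
  have "Re w = 0"
  proof (rule ccontr)
    assume "Re w \<noteq> 0"
    hence "sin \<bar>Re w\<bar> > 0" using w by (intro sin_gt_zero) auto
    thus False using z by (auto simp: abs_if split: if_splits)
  qed
  thus False using z w by (auto simp: complex_eq_iff)
qed

lemma strip_dipole_has_derivative:
  assumes "\<bar>Re w\<bar> < pi / 2" "w \<noteq> 0"
  shows "(strip_dipole a has_field_derivative strip_dipole_deriv a w) (at w)"
proof -
  have nz: "sin w \<noteq> 0" "cos w \<noteq> 0" using assms cos_nonzero_strip sin_nonzero_strip by auto
  have "((\<lambda>w. - a * cot w + cnj a * tan w) has_field_derivative
      - a * (- inverse ((sin w)\<^sup>2)) + cnj a * inverse ((cos w)\<^sup>2)) (at w)"
    by (intro DERIV_add DERIV_cmult DERIV_cot DERIV_tan nz)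
  thus ?thesis unfolding strip_dipole_def[abs_def] strip_dipole_deriv_def by (simp add: divide_inverse)
qed

lemma cmod_sin_ge_sinh: "Im w \<ge> 0 \<Longrightarrow> sinh (Im w) \<le> cmod (sin w)"
  and cmod_cos_ge_sinh: "Im w \<ge> 0 \<Longrightarrow> sinh (Im w) \<le> cmod (cos w)"
  using cmod_sin_squared[of w] cmod_cos_squared[of w] by (auto intro!: power2_le_imp_le[of "sinh (Im w)"])

text \<open>Upwards \<open>cot\<close> tends to \<open>- \<i>\<close> and \<open>tan\<close> to
  \<open>\<i>\<close>, with the exact errors \<open>exp (\<i> w) / sin w\<close> and
  \<open>- \<i> exp (\<i> w) / cos w\<close>. By oddness the limit at the lower end is the opposite
  one, which is the source of the period of the image sum.\<close>

lemma strip_dipole_limit: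
  assumes "Im w \<ge> 1"
  shows "cmod (strip_dipole a w - 2 * \<i> * Re a) \<le> 8 * cmod a * exp (- 2 * Im w)"
proof -
  have s: "cmod (sin w) \<ge> exp (Im w) / 4" "cmod (cos w) \<ge> exp (Im w) / 4"
    using cmod_sin_ge_sinh[of w] cmod_cos_ge_sinh[of w] sinh_ge_exp_quarter[OF assms] assms by auto
  hence nz: "sin w \<noteq> 0" "cos w \<noteq> 0" using exp_gt_zero[of "Im w"] by auto
  have e: "exp (\<i> * w) = cos w + \<i> * sin w" using exp_Euler by simp
  have c: "cot w + \<i> = exp (\<i> * w) / sin w" using nz by (simp add: e cot_def field_simps)
  have t: "tan w - \<i> = - \<i> * exp (\<i> * w) / cos w" using nz by (simp add: e tan_def field_simps)
  have "strip_dipole a w - 2 * \<i> * Re a = - a * (cot w + \<i>) + cnj a * (tan w - \<i>)"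
  proof -
    have "2 * complex_of_real (Re a) = a + cnj a" by (simp add: complex_add_cnj)
    hence "2 * \<i> * Re a = \<i> * (a + cnj a)" by (metis mult.assoc mult.commute)
    thus ?thesis by (simp add: strip_dipole_def algebra_simps)
  qed
  also have "cmod \<dots> \<le> cmod (- a * (cot w + \<i>)) + cmod (cnj a * (tan w - \<i>))"
    by (rule norm_triangle_ineq)
  also have "\<dots> = cmod a * cmod (cot w + \<i>) + cmod a * cmod (tan w - \<i>)" by (simp add: norm_mult)
  also have "\<dots> = cmod a * (exp (- Im w) / cmod (sin w)) + cmod a * (exp (- Im w) / cmod (cos w))"
    unfolding c t by (simp add: norm_mult norm_divide)
  also have "\<dots> \<le> cmod a * (exp (- Im w) / (exp (Im w) / 4)) + cmod a * (exp (- Im w) / (exp (Im w) / 4))"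
    using s by (intro add_mono mult_left_mono divide_left_mono mult_pos_pos) (auto simp: nz)
  also have "exp (- Im w) / (exp (Im w) / 4) = 4 * exp (- 2 * Im w)"
    by (simp add: exp_minus field_simps flip: exp_add)
  finally show ?thesis by simp
qed

lemma strip_dipole_deriv_le:
  assumes "\<bar>Im w\<bar> \<ge> 1"
  shows "cmod (strip_dipole_deriv a w) \<le> 32 * cmod a * exp (- 2 * \<bar>Im w\<bar>)"
proof -
  define y where "y = \<bar>Im w\<bar>"
  have "exp y / 4 \<le> sinh y" using assms unfolding y_def by (rule sinh_ge_exp_quarter)
  hence "(exp y / 4)\<^sup>2 \<le> (sinh y)\<^sup>2" by (intro power_mono) auto
  hence s: "(exp y)\<^sup>2 / 16 \<le> (cmod (sin w))\<^sup>2" "(exp y)\<^sup>2 / 16 \<le> (cmod (cos w))\<^sup>2"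
    by (auto simp: power_divide y_def sinh_abs_squared cmod_sin_squared cmod_cos_squared intro: add_increasing)
  have p: "0 < (exp y)\<^sup>2 / 16" by simp
  have "cmod (strip_dipole_deriv a w) \<le> cmod a / (cmod (sin w))\<^sup>2 + cmod a / (cmod (cos w))\<^sup>2"
    unfolding strip_dipole_deriv_def by (rule order_trans[OF norm_triangle_ineq]) (simp add: norm_divide norm_power)
  also have "\<dots> \<le> cmod a / ((exp y)\<^sup>2 / 16) + cmod a / ((exp y)\<^sup>2 / 16)"
    using s p by (intro add_mono divide_left_mono mult_pos_pos) (auto intro: less_le_trans[OF p])
  also have "\<dots> = 32 * cmod a * exp (- 2 * y)"
    by (simp add: exp_minus power2_eq_square field_simps flip: exp_add)
  finally show ?thesis by (simp add: y_def)
qed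

section \<open>Summation over the periodic images\<close>

text \<open>The two images at equal distance are added first: single terms tend to
  \<open>2 * \<i> * Re a\<close> or to its negative and in general have no convergent sum.\<close>

definition tail_term :: "complex \<Rightarrow> real \<Rightarrow> nat \<Rightarrow> complex \<Rightarrow> complex" where
  "tail_term a \<tau> n w = strip_dipole a (w + \<i> * (\<tau> * real (Suc n))) + strip_dipole a (w - \<i> * (\<tau> * real (Suc n)))"

definition tail_term_deriv :: "complex \<Rightarrow> real \<Rightarrow> nat \<Rightarrow> complex \<Rightarrow> complex" where
  "tail_term_deriv a \<tau> n w =
     strip_dipole_deriv a (w + \<i> * (\<tau> * real (Suc n))) + strip_dipole_deriv a (w - \<i> * (\<tau> * real (Suc n)))"

definition strip_tail :: "complex \<Rightarrow> real \<Rightarrow> complex \<Rightarrow> complex" where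
  "strip_tail a \<tau> w = (\<Sum>n. tail_term a \<tau> n w)"

definition strip_tail_deriv :: "complex \<Rightarrow> real \<Rightarrow> complex \<Rightarrow> complex" where
  "strip_tail_deriv a \<tau> w = (\<Sum>n. tail_term_deriv a \<tau> n w)"

text \<open>Wider than the strip \<open>\<bar>Re w\<bar> \<le> pi / 4\<close>, so that boundary
  points of the strip are interior points, and free of all poles except the one at
  \<open>0\<close>.\<close>

definition period_box :: "real \<Rightarrow> complex set" where
  "period_box \<tau> = {w. \<bar>Re w\<bar> < pi / 2 \<and> \<bar>Im w\<bar> < \<tau>}"

lemma open_period_box: "open (period_box \<tau>)"
  unfolding period_box_def
  by (intro open_Collect_conj open_Collect_less continuous_intros)

lemma tail_term_has_derivative:
  assumes "\<tau> > 0" "w \<in> period_box \<tau>"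
  shows "(tail_term a \<tau> n has_field_derivative tail_term_deriv a \<tau> n w) (at w)"
proof -
  have t: "\<tau> * real (Suc n) \<ge> \<tau>" using assms(1) by simp
  have "\<bar>Im w\<bar> < \<tau> * real (Suc n)" using assms(2) t by (simp add: period_box_def del: of_nat_Suc)
  hence "Im (w + \<i> * (\<tau> * real (Suc n))) > 0" "Im (w - \<i> * (\<tau> * real (Suc n))) < 0"
    by (auto simp del: of_nat_Suc)
  hence nz: "w + \<i> * (\<tau> * real (Suc n)) \<noteq> 0" "w - \<i> * (\<tau> * real (Suc n)) \<noteq> 0"
    by (metis less_irrefl zero_complex.sel(2))+
  have 1: "((\<lambda>w. strip_dipole a (w + c)) has_field_derivative strip_dipole_deriv a (w + c)) (at w)"
    if "Re c = 0" "w + c \<noteq> 0" for c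
  proof -
    have "\<bar>Re (w + c)\<bar> < pi / 2" using that assms by (simp add: period_box_def)
    moreover have "((\<lambda>w. w + c) has_field_derivative 1) (at w)" by (auto intro!: derivative_eq_intros)
    ultimately show ?thesis using DERIV_chain2[where f = "strip_dipole a" and g = "\<lambda>w. w + c" and x = w, OF strip_dipole_has_derivative] that(2) by fastforce
  qed
  have "((\<lambda>w. strip_dipole a (w + \<i> * (\<tau> * real (Suc n))) + strip_dipole a (w + - (\<i> * (\<tau> * real (Suc n))))) has_field_derivative
     strip_dipole_deriv a (w + \<i> * (\<tau> * real (Suc n))) + strip_dipole_deriv a (w + - (\<i> * (\<tau> * real (Suc n))))) (at w)"
    by (intro DERIV_add 1) (use nz in auto)
  thus ?thesis by (simp add: tail_term_def[abs_def] tail_term_deriv_def)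
qed

text \<open>Since \<open>strip_dipole\<close> is odd, the contribution of one of the images is minus
  a value high up in the strip. Subtracting the common limit from both values leaves two
  exponentially small errors.\<close>

lemma tail_term_bound:
  assumes "\<tau> > 0" "\<bar>Im w\<bar> \<le> Y" "\<tau> * real (Suc n) \<ge> Y + 1"
  shows "cmod (tail_term a \<tau> n w) \<le> 16 * cmod a * exp (2 * Y) * exp (- 2 * \<tau>) ^ Suc n"
proof -
  define b where "b = \<tau> * real (Suc n)"
  have b: "b \<ge> Y + 1" using assms by (simp add: b_def)
  have e: "exp (- 2 * \<tau>) ^ Suc n = exp (- 2 * b)"
    unfolding exp_of_nat_mult[symmetric] b_def by (simp only: mult.commute mult.left_commute)
  have one: "cmod (strip_dipole a v - 2 * \<i> * Re a) \<le> 8 * cmod a * (exp (2 * Y) * exp (- 2 * b))"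
    if "Im v \<ge> b - Y" for v
  proof -
    have "cmod (strip_dipole a v - 2 * \<i> * Re a) \<le> 8 * cmod a * exp (- 2 * Im v)"
      by (rule strip_dipole_limit) (use that b in linarith)
    also have "\<dots> \<le> 8 * cmod a * exp (2 * Y + - 2 * b)" using that by (intro mult_left_mono) auto
    finally show ?thesis by (simp only: exp_add)
  qed
  have "tail_term a \<tau> n w = (strip_dipole a (w + \<i> * b) - 2 * \<i> * Re a) - (strip_dipole a (\<i> * b - w) - 2 * \<i> * Re a)"
    using strip_dipole_minus[of a "\<i> * b - w"] by (simp add: tail_term_def b_def)
  also have "cmod \<dots> \<le> 8 * cmod a * (exp (2 * Y) * exp (- 2 * b)) + 8 * cmod a * (exp (2 * Y) * exp (- 2 * b))"
    by (rule order_trans[OF norm_triangle_ineq4 add_mono[OF one one]]) (use assms(2) in auto)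
  finally show ?thesis unfolding e by simp
qed

text \<open>Domination by a geometric series, uniform on the box, allows termwise differentiation.
  The bound requires the image to lie at least one unit beyond the box, which holds from some index
  on.\<close>

lemma strip_tail_sums:
  assumes tau: "\<tau> > 0"
  shows "\<And>w. w \<in> period_box \<tau> \<Longrightarrow> (\<lambda>n. tail_term a \<tau> n w) sums strip_tail a \<tau> w"
    and "\<And>w. w \<in> period_box \<tau> \<Longrightarrow> (\<lambda>n. tail_term_deriv a \<tau> n w) sums strip_tail_deriv a \<tau> w"
    and "\<And>w. w \<in> period_box \<tau> \<Longrightarrow> (strip_tail a \<tau> has_field_derivative strip_tail_deriv a \<tau> w) (at w)"
proof -
  have ex: "\<exists>d h. 0 < d \<and> summable h \<and> (\<forall>\<^sub>F n in sequentially. \<forall>y\<in>ball x d \<inter> period_box \<tau>. cmod (tail_term a \<tau> n y) \<le> h n)"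
    if "x \<in> period_box \<tau>" for x
  proof -
    define h where "h n = 16 * cmod a * exp (2 * \<tau>) * exp (- 2 * \<tau>) ^ Suc n" for n
    have "summable (\<lambda>n. exp (- 2 * \<tau>) ^ Suc n)"
      using tau by (subst summable_Suc_iff) (auto intro!: summable_geometric)
    hence "summable h" unfolding h_def by (intro summable_mult)
    moreover obtain N where N: "real N * \<tau> > \<tau> + 1" using reals_Archimedean3[OF tau] by blast
    have "\<forall>\<^sub>F n in sequentially. \<forall>y\<in>ball x 1 \<inter> period_box \<tau>. cmod (tail_term a \<tau> n y) \<le> h n"
    proof (rule eventually_sequentiallyI[of N], intro ballI)
      fix n y assume n: "n \<ge> N" and y: "y \<in> ball x 1 \<inter> period_box \<tau>"
      have "real N * \<tau> \<le> real (Suc n) * \<tau>" using n tau by (intro mult_right_mono) auto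
      hence "\<tau> * real (Suc n) \<ge> \<tau> + 1" using N by (simp add: mult.commute)
      thus "cmod (tail_term a \<tau> n y) \<le> h n"
        unfolding h_def using y by (intro tail_term_bound[OF tau]) (auto simp: period_box_def)
    qed
    ultimately show ?thesis by (intro exI[of _ 1] exI[of _ h]) auto
  qed
  obtain g g' where g: "\<And>x. x \<in> period_box \<tau> \<Longrightarrow> (\<lambda>n. tail_term a \<tau> n x) sums g x"
      "\<And>x. x \<in> period_box \<tau> \<Longrightarrow> (\<lambda>n. tail_term_deriv a \<tau> n x) sums g' x"
      "\<And>x. x \<in> period_box \<tau> \<Longrightarrow> (g has_field_derivative g' x) (at x)"
    using series_and_derivative_comparison_local[OF open_period_box tail_term_has_derivative[OF tau] ex] by blast
  have eq: "strip_tail a \<tau> x = g x" "strip_tail_deriv a \<tau> x = g' x" if "x \<in> period_box \<tau>" for x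
    using g(1,2)[OF that] by (auto simp: strip_tail_def strip_tail_deriv_def sums_iff)
  fix w assume w: "w \<in> period_box \<tau>"
  show "(\<lambda>n. tail_term a \<tau> n w) sums strip_tail a \<tau> w" "(\<lambda>n. tail_term_deriv a \<tau> n w) sums strip_tail_deriv a \<tau> w"
    using g[OF w] eq[OF w] by auto
  show "(strip_tail a \<tau> has_field_derivative strip_tail_deriv a \<tau> w) (at w)"
    unfolding eq(2)[OF w]
    by (rule has_field_derivative_transform_within_open[OF g(3)[OF w] open_period_box w]) (simp add: eq)
qed

definition strip_potential :: "complex \<Rightarrow> real \<Rightarrow> complex \<Rightarrow> complex" where
  "strip_potential a \<tau> w = strip_dipole a w + strip_tail a \<tau> w - of_real (4 * Re a / \<tau>) * w"

definition strip_potential_deriv :: "complex \<Rightarrow> real \<Rightarrow> complex \<Rightarrow> complex" where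
  "strip_potential_deriv a \<tau> w = strip_dipole_deriv a w + strip_tail_deriv a \<tau> w - of_real (4 * Re a / \<tau>)"

lemma strip_potential_has_derivative:
  assumes "\<tau> > 0" "w \<in> period_box \<tau>" "w \<noteq> 0"
  shows "(strip_potential a \<tau> has_field_derivative strip_potential_deriv a \<tau> w) (at w)"
proof -
  have "((\<lambda>w. strip_dipole a w + strip_tail a \<tau> w - of_real (4 * Re a / \<tau>) * w) has_field_derivative
     strip_dipole_deriv a w + strip_tail_deriv a \<tau> w - of_real (4 * Re a / \<tau>) * 1) (at w)"
    using assms by (intro DERIV_add DERIV_diff DERIV_cmult DERIV_ident strip_dipole_has_derivative strip_tail_sums(3))
      (auto simp: period_box_def)
  thus ?thesis unfolding strip_potential_def[abs_def] strip_potential_deriv_def by simp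
qed

text \<open>A shift by one period telescopes the partial sums, leaving a value far up minus a value
  far down. These tend to \<open>2 * \<i> * Re a\<close> and its negative, so the image sum grows by
  \<open>4 * \<i> * Re a\<close>, which is exactly the increment of the subtracted linear
  term.\<close>

lemma strip_potential_periodic:
  assumes tau: "\<tau> > 0" and w: "w \<in> period_box \<tau>" "w + \<i> * \<tau> \<in> period_box \<tau>"
  shows "strip_potential a \<tau> (w + \<i> * \<tau>) = strip_potential a \<tau> w"
proof -
  define T where "T N w = strip_dipole a w + (\<Sum>n<N. tail_term a \<tau> n w)" for N w
  have tele: "T N (w + \<i> * \<tau>) - T N w =
      strip_dipole a (w + \<i> * (\<tau> * real (Suc N))) - strip_dipole a (w - \<i> * (\<tau> * real N))" for N
  proof (induction N)
    case (Suc N)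
    have e: "w + \<i> * \<tau> + \<i> * (\<tau> * real (Suc N)) = w + \<i> * (\<tau> * real (Suc (Suc N)))"
      "w + \<i> * \<tau> - \<i> * (\<tau> * real (Suc N)) = w - \<i> * (\<tau> * real N)" by (simp_all add: algebra_simps)
    have TS: "T (Suc N) v = T N v + tail_term a \<tau> N v" for v by (simp add: T_def)
    have r: "tail_term a \<tau> N (w + \<i> * \<tau>) =
        strip_dipole a (w + \<i> * (\<tau> * real (Suc (Suc N)))) + strip_dipole a (w - \<i> * (\<tau> * real N))"
      unfolding tail_term_def e ..
    have aux: "X - Y = A - B \<Longrightarrow> (X + (C + B)) - (Y + (A + D)) = C - D" for X Y A B C D :: complex
      by (simp add: algebra_simps)
    show ?case unfolding TS r tail_term_def[of a \<tau> N w] by (rule aux[OF Suc])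
  qed (simp add: T_def)
  have lim: "(\<lambda>N. strip_dipole a (v + \<i> * (\<tau> * real N))) \<longlonglongrightarrow> 2 * \<i> * Re a" for v
  proof (rule LIM_zero_cancel, rule Lim_null_comparison)
    obtain N where N: "real N * \<tau> > \<bar>Im v\<bar> + 1" using reals_Archimedean3[OF tau] by blast
    show "\<forall>\<^sub>F n in sequentially. norm (strip_dipole a (v + \<i> * (\<tau> * real n)) - 2 * \<i> * Re a)
        \<le> 8 * cmod a * exp (- 2 * Im v) * exp (- 2 * \<tau>) ^ n"
    proof (rule eventually_sequentiallyI[of N])
      fix n assume "n \<ge> N"
      hence "real N * \<tau> \<le> real n * \<tau>" using tau by (intro mult_right_mono) auto
      hence "Im (v + \<i> * (\<tau> * real n)) \<ge> 1" using N by (simp add: mult.commute)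
      from strip_dipole_limit[OF this, of a]
      show "norm (strip_dipole a (v + \<i> * (\<tau> * real n)) - 2 * \<i> * Re a) \<le> 8 * cmod a * exp (- 2 * Im v) * exp (- 2 * \<tau>) ^ n"
        by (simp add: exp_of_nat_mult[symmetric] algebra_simps flip: exp_add)
    qed
    have "(\<lambda>n. exp (- 2 * \<tau>) ^ n) \<longlonglongrightarrow> 0" using tau by (intro LIMSEQ_power_zero) auto
    from tendsto_mult_left[OF this, of "8 * cmod a * exp (- 2 * Im v)"]
    show "(\<lambda>n. 8 * cmod a * exp (- 2 * Im v) * exp (- 2 * \<tau>) ^ n) \<longlonglongrightarrow> 0" by simp
  qed
  have l1: "(\<lambda>N. T N v) \<longlonglongrightarrow> strip_dipole a v + strip_tail a \<tau> v" if "v \<in> period_box \<tau>" for v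
    unfolding T_def using strip_tail_sums(1)[OF tau that, of a] by (intro tendsto_add tendsto_const) (simp add: sums_def)
  have "(\<lambda>N. T N (w + \<i> * \<tau>) - T N w) \<longlonglongrightarrow>
     (strip_dipole a (w + \<i> * \<tau>) + strip_tail a \<tau> (w + \<i> * \<tau>)) - (strip_dipole a w + strip_tail a \<tau> w)"
    by (intro tendsto_diff l1 w)
  moreover have "(\<lambda>N. T N (w + \<i> * \<tau>) - T N w) \<longlonglongrightarrow> 2 * \<i> * Re a - (- (2 * \<i> * Re a))"
  proof -
    have "strip_dipole a (w - \<i> * (\<tau> * real N)) = - strip_dipole a (- w + \<i> * (\<tau> * real N))" for N
      using strip_dipole_minus[of a "- w + \<i> * (\<tau> * real N)"] by simp
    thus ?thesis unfolding tele using LIMSEQ_Suc[OF lim[of w]] tendsto_minus[OF lim[of "-w"]]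
      by (intro tendsto_diff) simp_all
  qed
  ultimately have "(strip_dipole a (w + \<i> * \<tau>) + strip_tail a \<tau> (w + \<i> * \<tau>)) - (strip_dipole a w + strip_tail a \<tau> w)
      = 4 * \<i> * Re a" using LIMSEQ_unique by fastforce
  moreover have "of_real (4 * Re a / \<tau>) * (w + \<i> * \<tau>) - of_real (4 * Re a / \<tau>) * w = 4 * \<i> * Re a"
    using tau by (simp add: field_simps)
  ultimately show ?thesis unfolding strip_potential_def by (simp add: algebra_simps)
qed

text \<open>On the line \<open>Re v = pi / 4\<close> conjugation is the map
  \<open>pi / 2 - v\<close>, so the conjugate of the sine is the cosine. Then \<open>tan v\<close>
  is the conjugate of \<open>cot v\<close> and the value has the form \<open>- X + cnj X\<close>.
  The other line follows by oddness.\<close>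

lemma Re_strip_dipole_boundary:
  assumes "\<bar>Re w\<bar> = pi / 4"
  shows "Re (strip_dipole a w) = 0"
proof -
  have pos: "Re (strip_dipole a v) = 0" if "Re v = pi / 4" for v
  proof -
    have c: "cnj v = of_real pi / 2 - v" using that by (simp add: complex_eq_iff)
    have "cnj (sin v) = cos v" unfolding cnj_sin c cos_sin_eq[of v] ..
    hence "sin v = cnj (cos v)" by (metis complex_cnj_cnj)
    hence "tan v = cnj (cot v)" using \<open>cnj (sin v) = cos v\<close> by (simp add: tan_def cot_def)
    hence "strip_dipole a v = - (a * cot v) + cnj (a * cot v)" by (simp add: strip_dipole_def)
    thus ?thesis by simp
  qed
  have "Re w = pi / 4 \<or> Re (- w) = pi / 4" using assms by (auto simp: abs_if split: if_splits)
  thus ?thesis using pos[of w] pos[of "- w"] strip_dipole_minus[of a w] by auto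
qed

text \<open>The images are shifted in the imaginary direction and so are purely imaginary on the
  same lines; only the linear term contributes, and it has constant real part on each line.\<close>

lemma Re_strip_potential_boundary:
  assumes tau: "\<tau> > 0" and w: "w \<in> period_box \<tau>" "\<bar>Re w\<bar> = pi / 4"
  shows "Re (strip_potential a \<tau> w) = - (4 * Re a / \<tau>) * Re w"
proof -
  have "Re (tail_term a \<tau> n w) = 0" for n
    unfolding tail_term_def using w(2) by (simp add: Re_strip_dipole_boundary)
  hence "(\<lambda>n. 0) sums Re (strip_tail a \<tau> w)" using sums_Re[OF strip_tail_sums(1)[OF tau w(1), of a]] by simp
  hence "Re (strip_tail a \<tau> w) = 0" using sums_unique2 sums_zero by blast
  moreover have "Re (complex_of_real (4 * Re a / \<tau>) * w) = (4 * Re a / \<tau>) * Re w" by simp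
  ultimately show ?thesis by (simp add: strip_potential_def Re_strip_dipole_boundary[OF w(2)])
qed

lemma strip_potential_pole:
  assumes tau: "\<tau> > 0"
  shows "((\<lambda>w. w * strip_potential a \<tau> w) \<longlongrightarrow> - a) (at 0)"
proof -
  have box: "0 \<in> period_box \<tau>" using tau by (simp add: period_box_def)
  have tl: "(strip_tail a \<tau> \<longlongrightarrow> strip_tail a \<tau> 0) (at 0)"
    using strip_tail_sums(3)[OF tau box, THEN DERIV_isCont] by (simp add: isCont_def)
  have s: "((\<lambda>w::complex. sin w / w) \<longlongrightarrow> 1) (at 0)"
    using DERIV_sin[of "0::complex"] by (simp add: DERIV_def)
  have "((\<lambda>w::complex. cos w) \<longlongrightarrow> cos 0) (at 0)" "((\<lambda>w::complex. tan w) \<longlongrightarrow> tan 0) (at 0)"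
    by (rule tendsto_cos[OF tendsto_ident_at], rule tendsto_tan[OF tendsto_ident_at], simp)
  hence cosl: "((\<lambda>w::complex. cos w) \<longlongrightarrow> 1) (at 0)" and tanl: "((\<lambda>w::complex. tan w) \<longlongrightarrow> 0) (at 0)" by simp_all
  have "((\<lambda>w. - a * (cos w / (sin w / w)) + w * (cnj a * tan w + strip_tail a \<tau> w - of_real (4 * Re a / \<tau>) * w))
      \<longlongrightarrow> - a * (1 / 1) + 0 * (cnj a * 0 + strip_tail a \<tau> 0 - of_real (4 * Re a / \<tau>) * (0::complex))) (at 0)"
    by (intro tendsto_add tendsto_diff tendsto_mult tendsto_divide tendsto_const tendsto_ident_at s cosl tanl tl) simp
  moreover have "\<forall>\<^sub>F w in at 0. - a * (cos w / (sin w / w)) + w * (cnj a * tan w + strip_tail a \<tau> w - of_real (4 * Re a / \<tau>) * w)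
      = w * strip_potential a \<tau> w"
    by (auto simp: eventually_at_filter strip_potential_def strip_dipole_def cot_def algebra_simps)
  ultimately show ?thesis using Lim_transform_eventually by fastforce
qed

text \<open>\<open>\<kappa>\<close> is the clearance to the height of the nearest image poles. The
  terms decay geometrically from \<open>exp (- 2 * \<kappa>)\<close>; replacing the exponential by
  an inverse square is affordable because \<open>\<kappa>\<close> will have order
  \<open>1 / sqrt \<epsilon>\<close>.\<close>

lemma strip_tail_deriv_bound:
  assumes tau: "\<tau> > 0" and w: "\<bar>Re w\<bar> < pi / 2" "\<bar>Im w\<bar> \<le> \<tau> - \<kappa>" and kappa: "\<kappa> \<ge> 1"
  shows "cmod (strip_tail_deriv a \<tau> w) \<le> 64 * cmod a / \<kappa>\<^sup>2"
proof -
  have box: "w \<in> period_box \<tau>" using w kappa by (auto simp: period_box_def)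
  have tk: "\<tau> \<ge> \<kappa>" using w(2) by (smt (verit) abs_ge_zero)
  have half: "exp (- 2 * \<tau>) \<le> 1 / 2"
  proof -
    have "2 \<le> exp (2 * \<tau>)" using exp_ge_add_one_self[of "2 * \<tau>"] tk kappa by linarith
    thus ?thesis by (simp add: exp_minus field_simps)
  qed
  have tm: "cmod (tail_term_deriv a \<tau> n w) \<le> 64 * cmod a * exp (- 2 * \<kappa>) * (1 / 2) ^ n" for n
  proof -
    have one: "cmod (strip_dipole_deriv a v) \<le> 32 * cmod a * (exp (- 2 * \<kappa>) * (1 / 2) ^ n)"
      if "\<bar>Im v\<bar> \<ge> \<tau> * real n + \<kappa>" for v
    proof -
      have n0: "\<tau> * real n \<ge> 0" using tau by simp
      have "cmod (strip_dipole_deriv a v) \<le> 32 * cmod a * exp (- 2 * \<bar>Im v\<bar>)"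
        by (rule strip_dipole_deriv_le) (use that kappa n0 in linarith)
      also have "\<dots> \<le> 32 * cmod a * exp (- 2 * \<kappa> + - 2 * (\<tau> * real n))" using that by (intro mult_left_mono) auto
      also have "exp (- 2 * \<kappa> + - 2 * (\<tau> * real n)) = exp (- 2 * \<kappa>) * exp (- 2 * \<tau>) ^ n"
        unfolding exp_add by (simp add: exp_of_nat_mult[symmetric] algebra_simps)
      also have "32 * cmod a * (exp (- 2 * \<kappa>) * exp (- 2 * \<tau>) ^ n) \<le> 32 * cmod a * (exp (- 2 * \<kappa>) * (1 / 2) ^ n)"
        using half by (intro mult_left_mono power_mono) auto
      finally show ?thesis .
    qed
    have s: "\<tau> * real (Suc n) = \<tau> * real n + \<tau>" by (simp add: algebra_simps)
    have "cmod (tail_term_deriv a \<tau> n w) \<le>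
        32 * cmod a * (exp (- 2 * \<kappa>) * (1 / 2) ^ n) + 32 * cmod a * (exp (- 2 * \<kappa>) * (1 / 2) ^ n)"
      unfolding tail_term_deriv_def
      by (rule order_trans[OF norm_triangle_ineq add_mono[OF one one]]) (use w(2) s in auto)
    thus ?thesis by (simp add: mult_ac)
  qed
  have sm: "summable (\<lambda>n. 64 * cmod a * exp (- 2 * \<kappa>) * (1 / 2) ^ n)"
    by (intro summable_mult summable_geometric) simp
  have "cmod (strip_tail_deriv a \<tau> w) \<le> (\<Sum>n. 64 * cmod a * exp (- 2 * \<kappa>) * (1 / 2) ^ n)"
    unfolding strip_tail_deriv_def by (rule norm_suminf_le[OF tm sm])
  also have "\<dots> = 128 * cmod a * exp (- 2 * \<kappa>)"
    by (subst suminf_mult) (auto simp: suminf_geometric intro!: summable_geometric)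
  also have "\<dots> \<le> 128 * cmod a * (1 / (2 * \<kappa>\<^sup>2))"
  proof (intro mult_left_mono)
    have "1 + 2 * \<kappa> + (2 * \<kappa>)\<^sup>2 / 2 \<le> exp (2 * \<kappa>)" using kappa by (intro exp_lower_Taylor_quadratic) auto
    hence "2 * \<kappa>\<^sup>2 \<le> exp (2 * \<kappa>)" using kappa by (simp add: power_mult_distrib)
    hence "inverse (exp (2 * \<kappa>)) \<le> inverse (2 * \<kappa>\<^sup>2)" using kappa by (intro le_imp_inverse_le) auto
    thus "exp (- 2 * \<kappa>) \<le> 1 / (2 * \<kappa>\<^sup>2)" by (simp add: exp_minus inverse_eq_divide)
  qed auto
  finally show ?thesis by simp
qed

lemma strip_dipole_deriv_le_exp:
  assumes "\<bar>Re w\<bar> \<le> pi / 4" "w \<noteq> 0"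
  shows "cmod (strip_dipole_deriv a w) \<le> 72 * cmod a * exp (- cmod w) / (cmod w)\<^sup>2"
proof -
  have "cmod (strip_dipole_deriv a w) \<le> cmod (a / (sin w)\<^sup>2) + cmod (cnj a / (cos w)\<^sup>2)"
    unfolding strip_dipole_deriv_def by (rule norm_triangle_ineq)
  also have "\<dots> \<le> 36 * cmod a * exp (- cmod w) / (cmod w)\<^sup>2 + 36 * cmod (cnj a) * exp (- cmod w) / (cmod w)\<^sup>2"
    by (intro add_mono inverse_bound_exp[OF assms(2)] cmod_sin_squared_ge_exp cmod_cos_squared_ge_exp assms(1))
  finally show ?thesis by simp
qed

text \<open>Close to the pole \<open>a / (sin w)^2\<close> is comparable with the inverse square of
  \<open>cmod w\<close>, while the cosine term stays below \<open>2\<close>.\<close>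

lemma strip_dipole_deriv_near:
  assumes "cmod w \<le> 1 / 2" "w \<noteq> 0" "cmod a = 1"
  shows "1 / (4 * (cmod w)\<^sup>2) - 2 \<le> cmod (strip_dipole_deriv a w)"
    and "cmod (strip_dipole_deriv a w) \<le> 2 / (cmod w)\<^sup>2 + 2"
proof -
  have re: "\<bar>Re w\<bar> \<le> pi / 4" "\<bar>Im w\<bar> \<le> 1"
    using abs_Re_le_cmod[of w] abs_Im_le_cmod[of w] assms pi_gt3 by linarith+
  have cw: "(cmod w)\<^sup>2 > 0" using assms by simp
  have sn: "(cmod (sin w))\<^sup>2 \<ge> (cmod w)\<^sup>2 / 2" by (rule cmod_sin_squared_ge[OF re(1)])
  hence s0: "(cmod (sin w))\<^sup>2 > 0" using cw by linarith
  have cs: "(cmod (cos w))\<^sup>2 \<ge> 1 / 2" using cos_squared_ge_half[OF re(1)] by (simp add: cmod_cos_squared add_increasing2)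
  have "1 / (cmod (cos w))\<^sup>2 \<le> 1 / (1 / 2)" using cs by (intro divide_left_mono) (auto intro: less_le_trans[of 0 "1/2"])
  hence c2: "cmod (cnj a / (cos w)\<^sup>2) \<le> 2" using assms by (simp add: norm_divide norm_power)
  have "(sin (Re w))\<^sup>2 \<le> (Re w)\<^sup>2" using abs_sin_x_le_abs_x[of "Re w"] by (simp add: abs_le_square_iff)
  hence "(cmod (sin w))\<^sup>2 \<le> 4 * (cmod w)\<^sup>2"
    using sinh_squared_le[OF re(2)] zero_le_power2[of "Re w"] cmod_power2[of w] unfolding cmod_sin_squared by argo
  hence "1 / (4 * (cmod w)\<^sup>2) \<le> 1 / (cmod (sin w))\<^sup>2" using s0 cw by (intro divide_left_mono) auto
  hence s1: "1 / (4 * (cmod w)\<^sup>2) \<le> cmod (a / (sin w)\<^sup>2)" using assms by (simp add: norm_divide norm_power)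
  have "1 / (cmod (sin w))\<^sup>2 \<le> 1 / ((cmod w)\<^sup>2 / 2)" using s0 cw sn by (intro divide_left_mono) auto
  hence s2: "cmod (a / (sin w)\<^sup>2) \<le> 2 / (cmod w)\<^sup>2" using assms by (simp add: norm_divide norm_power)
  show "1 / (4 * (cmod w)\<^sup>2) - 2 \<le> cmod (strip_dipole_deriv a w)"
    unfolding strip_dipole_deriv_def using norm_diff_ineq[of "a / (sin w)\<^sup>2" "cnj a / (cos w)\<^sup>2"] s1 c2 by linarith
  show "cmod (strip_dipole_deriv a w) \<le> 2 / (cmod w)\<^sup>2 + 2"
    unfolding strip_dipole_deriv_def using norm_triangle_ineq[of "a / (sin w)\<^sup>2" "cnj a / (cos w)\<^sup>2"] s2 c2 by linarith
qed


section \<open>Bipolar coordinates\<close>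

text \<open>The map \<open>bip\<close> sends the exterior of the two disks to the annulus
  \<open>exp (- hw) < |W| < exp hw\<close>, and \<open>pot\<close> is the strip potential in the coordinate \<open>Ln (bip z)\<close>,
  whose period \<open>2 \<pi> \<i>\<close> makes it single-valued. The points \<open>\<plusminus> foc\<close> are the common inverse
  points of the two circles.\<close>

locale two_disks =
  fixes \<epsilon> q :: real and a :: complex
  assumes eps: "0 < \<epsilon>" and norm_a: "cmod a = 1"
begin

definition "ctr = 1 + \<epsilon> / 2"
definition "foc = sqrt (\<epsilon> + \<epsilon>\<^sup>2 / 4)"
text \<open>The value of \<open>ln (cmod (bip z))\<close> on the right circle, equal to the inverse
  hyperbolic cosine of \<open>ctr\<close>.\<close>

definition "hw = ln (ctr + foc)"
text \<open>Rescales half width \<open>hw\<close> to half width \<open>pi / 4\<close>, at which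
  \<open>strip_dipole\<close> has vanishing real part on the boundary; \<open>per\<close> is then
  the image of one turn around the annulus.\<close>

definition "kap = pi / (4 * hw)"
definition "per = 2 * pi * kap"
text \<open>\<open>2 * pi * lam\<close> is the logarithmic derivative of \<open>bip\<close> at
  \<open>pc\<close>. Being real and positive, it does not rotate the dipole direction, and with this
  factor the polar part of \<open>pot\<close> becomes
  \<open>a / (2 * pi * (z - pc))\<close>.\<close>

definition "lam = foc / (pi * (foc\<^sup>2 + q\<^sup>2))"
definition "pc = Complex 0 q"
definition bip :: "complex \<Rightarrow> complex" where "bip z = (of_real foc + z) / (of_real foc - z)"
definition "tp = Im (Ln (bip pc))"
definition strip_coord :: "complex \<Rightarrow> complex" where "strip_coord W = of_real kap * (Ln W - \<i> * of_real tp)"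
definition ann_pot :: "complex \<Rightarrow> complex" where
  "ann_pot W = - of_real (lam * kap) * strip_potential a per (strip_coord W)"
definition pot :: "complex \<Rightarrow> complex" where "pot z = ann_pot (bip z)"
text \<open>The annulus is doubled in logarithmic width so that both circles lie in the interior and
  the potential can be differentiated on them.\<close>

definition "bip_dom = {z. z \<noteq> of_real foc \<and> z \<noteq> - of_real foc \<and> \<bar>ln (cmod (bip z))\<bar> < 2 * hw}"

lemma foc_pos: "foc > 0" and foc_sq: "foc\<^sup>2 = \<epsilon> + \<epsilon>\<^sup>2 / 4" and ctr_pos: "ctr > 1"
  using eps by (auto simp: foc_def ctr_def add_pos_nonneg)

lemma ctr_foc: "(ctr + foc) * (ctr - foc) = 1"
proof -
  have "(ctr + foc) * (ctr - foc) = ctr\<^sup>2 - foc\<^sup>2" by (simp add: power2_eq_square algebra_simps)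
  also have "\<dots> = 1" unfolding foc_sq ctr_def by (simp add: power2_eq_square field_simps)
  finally show ?thesis .
qed

lemma hw_pos: "hw > 0" unfolding hw_def using foc_pos ctr_pos by simp

lemma exp_hw: "exp hw = ctr + foc" unfolding hw_def using foc_pos ctr_pos by simp

lemma exp_minus_hw: "exp (- hw) = ctr - foc"
proof -
  have "ctr + foc \<noteq> 0" using foc_pos ctr_pos by simp
  thus ?thesis unfolding exp_minus exp_hw using ctr_foc by (simp add: field_simps)
qed

lemma sinh_hw: "sinh hw = foc"
proof -
  have "2 * sinh hw = exp hw - exp (- hw)" by (simp add: sinh_field_def)
  thus ?thesis unfolding exp_hw exp_minus_hw by simp
qed

lemma foc_less_ctr: "foc < ctr"
  using ctr_foc foc_pos ctr_pos by (smt (verit) mult_nonneg_nonpos)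

lemma kap_pos: "kap > 0" and per_pos: "per > 0" and lam_pos: "lam > 0"
  using hw_pos foc_pos by (auto simp: kap_def per_def lam_def intro!: divide_pos_pos mult_pos_pos add_pos_nonneg)

text \<open>The unit circle about \<open>ctr\<close> is the Apollonius circle of the two foci with
  ratio \<open>exp hw\<close>. In this product form one sign decides the other, which yields the
  inequality and its equality case at once.\<close>

lemma bip_circle: "(exp hw)\<^sup>2 * (cmod (of_real foc - z))\<^sup>2 - (cmod (of_real foc + z))\<^sup>2 =
    ((exp hw)\<^sup>2 - 1) * ((cmod (z - of_real ctr))\<^sup>2 - 1)"
proof -
  define E where "E = exp hw"
  have E: "E > 0" by (simp add: E_def)
  have c: "E * (2 * ctr) = E\<^sup>2 + 1" and f: "E * (2 * foc) = E\<^sup>2 - 1"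
    using ctr_foc unfolding E_def exp_hw by (simp_all add: power2_eq_square algebra_simps)
  have cf: "(E\<^sup>2 - 1) * ctr = (E\<^sup>2 + 1) * foc"
    using c f E by (metis mult.assoc mult.commute mult.left_commute mult_left_cancel less_irrefl zero_neq_numeral)
  have c1: "ctr\<^sup>2 - 1 = foc\<^sup>2" unfolding foc_sq ctr_def by (simp add: power2_eq_square field_simps)
  obtain x y where z: "z = Complex x y" by (cases z)
  have "E\<^sup>2 * ((foc - x)\<^sup>2 + y\<^sup>2) - ((foc + x)\<^sup>2 + y\<^sup>2) =
     (E\<^sup>2 - 1) * (foc\<^sup>2 + x\<^sup>2 + y\<^sup>2) - 2 * x * ((E\<^sup>2 + 1) * foc)" by (simp add: power2_eq_square algebra_simps)
  also have "\<dots> = (E\<^sup>2 - 1) * ((ctr\<^sup>2 - 1) + x\<^sup>2 + y\<^sup>2) - 2 * x * ((E\<^sup>2 - 1) * ctr)" unfolding cf c1 ..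
  also have "\<dots> = (E\<^sup>2 - 1) * ((x - ctr)\<^sup>2 + y\<^sup>2 - 1)" by (simp add: power2_eq_square algebra_simps)
  finally show ?thesis unfolding E_def[symmetric] z by (simp add: cmod_power2)
qed

text \<open>The reflection \<open>- z\<close> inverts the ratio and exchanges the two
  circles.\<close>

lemma bip_circle': "(exp hw)\<^sup>2 * (cmod (of_real foc + z))\<^sup>2 - (cmod (of_real foc - z))\<^sup>2 =
    ((exp hw)\<^sup>2 - 1) * ((cmod (z + of_real ctr))\<^sup>2 - 1)"
proof -
  have "cmod (- z - of_real ctr) = cmod (z + of_real ctr)"
    using norm_minus_cancel[of "z + of_real ctr"] by (simp del: norm_minus_cancel)
  thus ?thesis using bip_circle[of "- z"] by (simp add: norm_minus_commute add.commute)
qed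

lemma exterior_not_focus:
  "1 \<le> cmod (z - of_real ctr) \<Longrightarrow> z \<noteq> of_real foc"
  "1 \<le> cmod (z + of_real ctr) \<Longrightarrow> z \<noteq> - of_real foc"
proof -
  have *: "cmod (of_real foc - of_real ctr) < 1"
  proof -
    have "cmod (of_real (foc - ctr)) = ctr - foc" unfolding norm_of_real using foc_less_ctr by simp
    moreover have "exp (- hw) < 1" using hw_pos by simp
    ultimately show ?thesis unfolding exp_minus_hw by simp
  qed
  thus "1 \<le> cmod (z - of_real ctr) \<Longrightarrow> z \<noteq> of_real foc" by auto
  have "cmod (- of_real foc + of_real ctr) < 1" using * norm_minus_commute[of "of_real foc :: complex" "of_real ctr"] by simp
  thus "1 \<le> cmod (z + of_real ctr) \<Longrightarrow> z \<noteq> - of_real foc" by auto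
qed

lemma exp_hw_gt1: "(exp hw)\<^sup>2 - 1 > 0"
  using hw_pos one_less_power[of "exp hw" 2] by simp

lemma ln_bip_le:
  assumes "1 \<le> cmod (z - of_real ctr)" "1 \<le> cmod (z + of_real ctr)"
  shows "ln (cmod (bip z)) \<le> hw" "- hw \<le> ln (cmod (bip z))" "bip z \<noteq> 0"
    "ln (cmod (bip z)) = hw \<longleftrightarrow> cmod (z - of_real ctr) = 1"
    "ln (cmod (bip z)) = - hw \<longleftrightarrow> cmod (z + of_real ctr) = 1"
proof -
  note nf = exterior_not_focus(1)[OF assms(1)] exterior_not_focus(2)[OF assms(2)]
  have n: "cmod (of_real foc - z) > 0" "cmod (of_real foc + z) > 0"
    using nf by (auto simp: add_eq_0_iff)
  thus b0: "bip z \<noteq> 0" by (auto simp: bip_def)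
  have cb: "cmod (bip z) = cmod (of_real foc + z) / cmod (of_real foc - z)" by (simp add: bip_def norm_divide)
  have lt: "(ln (cmod (bip z)) \<le> hw \<longleftrightarrow> cmod (of_real foc + z) \<le> exp hw * cmod (of_real foc - z)) \<and>
      (ln (cmod (bip z)) = hw \<longleftrightarrow> cmod (of_real foc + z) = exp hw * cmod (of_real foc - z))"
  proof -
    have "cmod (bip z) > 0" using b0 by simp
    hence "ln (cmod (bip z)) \<le> hw \<longleftrightarrow> cmod (bip z) \<le> exp hw" "ln (cmod (bip z)) = hw \<longleftrightarrow> cmod (bip z) = exp hw"
      using ln_le_cancel_iff[of "cmod (bip z)" "exp hw"] ln_inj_iff[of "cmod (bip z)" "exp hw"] by auto
    thus ?thesis unfolding cb using n by (simp add: divide_le_eq divide_eq_eq)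
  qed
  have gt: "(- hw \<le> ln (cmod (bip z)) \<longleftrightarrow> cmod (of_real foc - z) \<le> exp hw * cmod (of_real foc + z)) \<and>
      (ln (cmod (bip z)) = - hw \<longleftrightarrow> cmod (of_real foc - z) = exp hw * cmod (of_real foc + z))"
  proof -
    have "cmod (bip z) > 0" using b0 by simp
    hence "- hw \<le> ln (cmod (bip z)) \<longleftrightarrow> exp (- hw) \<le> cmod (bip z)" "ln (cmod (bip z)) = - hw \<longleftrightarrow> cmod (bip z) = exp (- hw)"
      using ln_le_cancel_iff[of "exp (- hw)" "cmod (bip z)"] ln_inj_iff[of "cmod (bip z)" "exp (- hw)"] by auto
    thus ?thesis unfolding cb exp_minus using n by (auto simp: field_simps)
  qed
  have sq: "A \<le> B \<longleftrightarrow> A\<^sup>2 \<le> B\<^sup>2" "A = B \<longleftrightarrow> A\<^sup>2 = B\<^sup>2" if "A \<ge> 0" "B \<ge> 0" for A B :: real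
    using that by (auto simp: power2_eq_iff_nonneg intro: power_mono power2_le_imp_le)
  have m: "1 \<le> (cmod (z - of_real ctr))\<^sup>2" "1 \<le> (cmod (z + of_real ctr))\<^sup>2" using assms by (auto simp: one_le_power)
  have c1: "0 \<le> ((exp hw)\<^sup>2 - 1) * ((cmod (z - of_real ctr))\<^sup>2 - 1)" "0 \<le> ((exp hw)\<^sup>2 - 1) * ((cmod (z + of_real ctr))\<^sup>2 - 1)"
    using exp_hw_gt1 m by (auto intro!: mult_nonneg_nonneg)
  show "ln (cmod (bip z)) \<le> hw" using lt sq(1)[of "cmod (of_real foc + z)" "exp hw * cmod (of_real foc - z)"] c1(1) bip_circle[of z]
    by (simp add: power_mult_distrib)
  show "- hw \<le> ln (cmod (bip z))" using gt sq(1)[of "cmod (of_real foc - z)" "exp hw * cmod (of_real foc + z)"] c1(2) bip_circle'[of z]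
    by (simp add: power_mult_distrib)
  have one: "(cmod u)\<^sup>2 - 1 = 0 \<longleftrightarrow> cmod u = 1" for u :: complex by (simp add: power2_eq_1_iff) (smt (verit) norm_ge_zero)
  have "ln (cmod (bip z)) = hw \<longleftrightarrow> ((exp hw)\<^sup>2 - 1) * ((cmod (z - of_real ctr))\<^sup>2 - 1) = 0"
  proof -
    have "((exp hw)\<^sup>2 - 1) * ((cmod (z - of_real ctr))\<^sup>2 - 1) = 0 \<longleftrightarrow> (exp hw * cmod (of_real foc - z))\<^sup>2 = (cmod (of_real foc + z))\<^sup>2"
      unfolding bip_circle[symmetric] right_minus_eq power_mult_distrib ..
    thus ?thesis using lt sq(2)[of "cmod (of_real foc + z)" "exp hw * cmod (of_real foc - z)", OF norm_ge_zero mult_nonneg_nonneg[OF exp_ge_zero norm_ge_zero]]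
      by metis
  qed
  thus "ln (cmod (bip z)) = hw \<longleftrightarrow> cmod (z - of_real ctr) = 1" using exp_hw_gt1 one by simp
  have "ln (cmod (bip z)) = - hw \<longleftrightarrow> ((exp hw)\<^sup>2 - 1) * ((cmod (z + of_real ctr))\<^sup>2 - 1) = 0"
  proof -
    have "((exp hw)\<^sup>2 - 1) * ((cmod (z + of_real ctr))\<^sup>2 - 1) = 0 \<longleftrightarrow> (exp hw * cmod (of_real foc + z))\<^sup>2 = (cmod (of_real foc - z))\<^sup>2"
      unfolding bip_circle'[symmetric] right_minus_eq power_mult_distrib ..
    thus ?thesis using gt sq(2)[of "cmod (of_real foc - z)" "exp hw * cmod (of_real foc + z)", OF norm_ge_zero mult_nonneg_nonneg[OF exp_ge_zero norm_ge_zero]]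
      by metis
  qed
  thus "ln (cmod (bip z)) = - hw \<longleftrightarrow> cmod (z + of_real ctr) = 1" using exp_hw_gt1 one by simp
qed

lemma exterior_in_dom:
  assumes "1 \<le> cmod (z - of_real ctr)" "1 \<le> cmod (z + of_real ctr)"
  shows "z \<in> bip_dom"
  using ln_bip_le(1,2)[OF assms] exterior_not_focus(1)[OF assms(1)] exterior_not_focus(2)[OF assms(2)] hw_pos
  by (simp add: bip_dom_def)

lemma bip_nonzero: "z \<in> bip_dom \<Longrightarrow> bip z \<noteq> 0"
  by (auto simp: bip_dom_def bip_def add_eq_0_iff)

lemma bip_has_derivative:
  assumes "z \<noteq> of_real foc"
  shows "(bip has_field_derivative 2 * of_real foc / (of_real foc - z)\<^sup>2) (at z)"
  unfolding bip_def[abs_def] using assms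
  by (auto intro!: derivative_eq_intros simp: power2_eq_square field_simps)

lemma open_bip_dom: "open bip_dom"
proof -
  let ?S = "- {complex_of_real foc, - of_real foc}"
  have "continuous_on ?S (\<lambda>z. \<bar>ln (cmod (bip z))\<bar>)"
    unfolding bip_def by (intro continuous_intros) (auto simp: add_eq_0_iff)
  hence "open {z \<in> ?S. \<bar>ln (cmod (bip z))\<bar> \<in> {..<2 * hw}}"
    by (intro continuous_open_preimage[unfolded vimage_def Int_def, simplified]) auto
  thus ?thesis by (simp add: bip_dom_def Collect_conj_eq[symmetric])
qed

lemma cmod_bip_pc: "cmod (bip pc) = 1"
proof -
  have "cnj (of_real foc + pc) = of_real foc - pc" by (simp add: pc_def complex_eq_iff)
  hence "cmod (of_real foc + pc) = cmod (of_real foc - pc)" by (metis complex_mod_cnj)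
  moreover have "of_real foc - pc \<noteq> 0" using foc_pos by (auto simp: pc_def complex_eq_iff)
  ultimately show ?thesis by (simp add: bip_def norm_divide)
qed

lemma bip_pc: "bip pc = Complex ((foc\<^sup>2 - q\<^sup>2) / (foc\<^sup>2 + q\<^sup>2)) (2 * foc * q / (foc\<^sup>2 + q\<^sup>2))"
proof -
  have nz: "foc\<^sup>2 + q\<^sup>2 \<noteq> 0" using foc_pos by (auto simp: sum_power2_eq_zero_iff)
  have n2: "of_real foc - pc \<noteq> 0" using foc_pos by (auto simp: pc_def complex_eq_iff)
  have "Complex ((foc\<^sup>2 - q\<^sup>2) / (foc\<^sup>2 + q\<^sup>2)) (2 * foc * q / (foc\<^sup>2 + q\<^sup>2)) * (of_real foc - pc) = of_real foc + pc"
  proof -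
    define n where "n = foc\<^sup>2 + q\<^sup>2"
    have n: "n \<noteq> 0" using nz by (simp add: n_def)
    have "(foc\<^sup>2 - q\<^sup>2) / n * foc + 2 * foc * q / n * q = ((foc\<^sup>2 - q\<^sup>2) * foc + 2 * foc * q * q) / n"
      by (simp add: add_divide_distrib)
    also have "(foc\<^sup>2 - q\<^sup>2) * foc + 2 * foc * q * q = foc * n" by (simp add: n_def power2_eq_square algebra_simps)
    finally have 1: "(foc\<^sup>2 - q\<^sup>2) / n * foc + 2 * foc * q / n * q = foc" using n by simp
    have "2 * foc * q / n * foc - (foc\<^sup>2 - q\<^sup>2) / n * q = (2 * foc * q * foc - (foc\<^sup>2 - q\<^sup>2) * q) / n"
      by (simp add: diff_divide_distrib left_diff_distrib)
    also have "2 * foc * q * foc - (foc\<^sup>2 - q\<^sup>2) * q = q * n" by (simp add: n_def power2_eq_square algebra_simps)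
    finally have 2: "2 * foc * q / n * foc - (foc\<^sup>2 - q\<^sup>2) / n * q = q" using n by simp
    show ?thesis unfolding n_def[symmetric] using 1 2 by (simp add: pc_def complex_eq_iff)
  qed
  thus ?thesis unfolding bip_def using n2 by (simp add: field_simps)
qed

text \<open>A real value forces \<open>q = 0\<close>, where \<open>bip pc = 1\<close>; the emitter
  is never mapped to the branch cut of the logarithm.\<close>

lemma bip_pc_not_nonpos: "bip pc \<notin> \<real>\<^sub>\<le>\<^sub>0"
proof
  have pos: "foc\<^sup>2 + q\<^sup>2 > 0" using foc_pos by (simp add: add_pos_nonneg)
  assume "bip pc \<in> \<real>\<^sub>\<le>\<^sub>0"
  hence i: "2 * foc * q / (foc\<^sup>2 + q\<^sup>2) = 0" and r: "(foc\<^sup>2 - q\<^sup>2) / (foc\<^sup>2 + q\<^sup>2) \<le> 0"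
    by (auto simp: complex_nonpos_Reals_iff bip_pc)
  hence "q = 0" using pos foc_pos by auto
  thus False using r foc_pos by simp
qed

lemma bip_pc_nonzero: "bip pc \<noteq> 0" using cmod_bip_pc by auto

lemma Ln_bip_pc: "Ln (bip pc) = \<i> * of_real tp"
  using bip_pc_nonzero cmod_bip_pc by (simp add: complex_eq_iff tp_def)

lemma tp_less_pi: "\<bar>tp\<bar> < pi"
  unfolding tp_def using Im_Ln_less_pi[OF bip_pc_not_nonpos] mpi_less_Im_Ln[OF bip_pc_nonzero]
  by (simp add: abs_less_iff)

text \<open>\<open>Im (Ln W)\<close> has modulus at most \<open>pi\<close> and \<open>tp\<close>
  strictly less, so their difference stays below a full turn, which has height \<open>per\<close>
  after scaling.\<close>

lemma strip_coord_in_box: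
  assumes "W \<noteq> 0" "\<bar>ln (cmod W)\<bar> < 2 * hw"
  shows "strip_coord W \<in> period_box per"
proof -
  have "\<bar>kap * ln (cmod W)\<bar> < kap * (2 * hw)" unfolding abs_mult using assms kap_pos by simp
  also have "kap * (2 * hw) = pi / 2" using hw_pos by (simp add: kap_def)
  finally have 1: "\<bar>kap * ln (cmod W)\<bar> < pi / 2" .
  have "\<bar>Im (Ln W) - tp\<bar> < 2 * pi" using Im_Ln_le_pi[OF assms(1)] mpi_less_Im_Ln[OF assms(1)] tp_less_pi by linarith
  hence "\<bar>kap * (Im (Ln W) - tp)\<bar> < kap * (2 * pi)" unfolding abs_mult using kap_pos by simp
  also have "kap * (2 * pi) = per" by (simp add: per_def)
  finally have 2: "\<bar>kap * (Im (Ln W) - tp)\<bar> < per" .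
  show ?thesis using 1 2 assms(1) by (simp add: strip_coord_def period_box_def)
qed

lemma strip_coord_eq_0: "W \<noteq> 0 \<Longrightarrow> strip_coord W = 0 \<longleftrightarrow> W = bip pc"
  using kap_pos Ln_bip_pc bip_pc_nonzero by (auto simp: strip_coord_def) (metis exp_Ln)

section \<open>The potential on the annulus and in the plane\<close>

lemma ann_pot_has_derivative:
  assumes W: "W \<noteq> 0" "\<bar>ln (cmod W)\<bar> < 2 * hw" "W \<noteq> bip pc" "W \<notin> \<real>\<^sub>\<le>\<^sub>0"
  shows "(ann_pot has_field_derivative
     - of_real (lam * kap) * (strip_potential_deriv a per (strip_coord W) * (of_real kap / W))) (at W)"
proof -
  have c: "(strip_coord has_field_derivative of_real kap / W) (at W)"
    unfolding strip_coord_def[abs_def] using W by (auto intro!: derivative_eq_intros simp: divide_inverse)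
  have n0: "strip_coord W \<noteq> 0" using strip_coord_eq_0 W by simp
  show ?thesis unfolding ann_pot_def[abs_def]
    by (intro DERIV_cmult DERIV_chain2[where f = "strip_potential a per" and g = strip_coord,
        OF strip_potential_has_derivative[OF per_pos strip_coord_in_box[OF W(1,2)] n0] c])
qed

text \<open>\<open>Ln (- W) + \<i> * pi\<close> is a branch of the logarithm that is analytic across
  the negative axis. It equals \<open>Ln W\<close> above the axis and on its negative half, and
  exceeds \<open>Ln W\<close> by a full turn below; periodicity of \<open>strip_potential\<close>
  absorbs the turn.\<close>

lemma ann_pot_across_cut:
  assumes W: "W \<noteq> 0" "\<bar>ln (cmod W)\<bar> < 2 * hw" and I: "\<bar>Im (Ln (- W)) + pi - tp\<bar> < 2 * pi"
  shows "ann_pot W = - of_real (lam * kap) * strip_potential a per (of_real kap * (Ln (- W) + \<i> * (of_real pi - of_real tp)))"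
proof (cases "Im W \<le> 0 \<and> \<not> (Re W < 0 \<and> Im W = 0)")
  case False
  hence "Ln (- W) = Ln W - \<i> * of_real pi" using Ln_minus[OF W(1)] by auto
  thus ?thesis by (simp add: ann_pot_def strip_coord_def algebra_simps)
next
  case True
  hence L: "Ln (- W) = Ln W + \<i> * of_real pi" using Ln_minus[OF W(1)] by auto
  have e: "of_real kap * (Ln (- W) + \<i> * (of_real pi - of_real tp)) = strip_coord W + \<i> * of_real per"
    unfolding L by (simp add: strip_coord_def per_def algebra_simps)
  have "\<bar>kap * (Im (Ln (- W)) + pi - tp)\<bar> < kap * (2 * pi)" unfolding abs_mult using I kap_pos by simp
  hence "strip_coord W + \<i> * of_real per \<in> period_box per"
    using strip_coord_in_box[OF W] unfolding L
    by (simp add: period_box_def strip_coord_def per_def algebra_simps)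
  thus ?thesis unfolding e using strip_potential_periodic[OF per_pos strip_coord_in_box[OF W]]
    by (simp add: ann_pot_def)
qed

lemma ann_pot_differentiable:
  assumes W: "W \<noteq> 0" "\<bar>ln (cmod W)\<bar> < 2 * hw" "W \<noteq> bip pc"
  shows "ann_pot field_differentiable (at W)"
proof (cases "W \<in> \<real>\<^sub>\<le>\<^sub>0")
  case False
  thus ?thesis using ann_pot_has_derivative[OF W] field_differentiable_def by blast
next
  case True
  hence Wn: "Re W < 0" "Im W = 0" using W(1) by (auto simp: complex_nonpos_Reals_iff complex_eq_iff less_le)
  hence mW: "- W \<notin> \<real>\<^sub>\<le>\<^sub>0" by (simp add: complex_nonpos_Reals_iff)
  have Im0: "Im (Ln (- W)) = 0" using W(1) Wn by (simp add: Im_Ln_eq_0)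
  define g where "g W = of_real kap * (Ln (- W) + \<i> * (of_real pi - of_real tp))" for W
  have dg: "(g has_field_derivative of_real kap * (inverse (- W) * (- 1))) (at W)"
    unfolding g_def[abs_def] using mW by (auto intro!: derivative_eq_intros)
  have im: "Im (g W) = kap * (pi - tp)" using Im0 by (simp add: g_def)
  \<comment> \<open>The emitter sits at height \<open>0\<close> and the cut at height
    \<open>kap * (pi - tp)\<close>, strictly inside one period, so the new branch avoids the pole
    and its nearest image.\<close>
  have "0 < kap * (pi - tp)" "kap * (pi - tp) < kap * (2 * pi)" using kap_pos tp_less_pi by auto
  moreover have "\<bar>Re (g W)\<bar> < pi / 2"
    using strip_coord_in_box[OF W(1,2)] W(1) by (simp add: g_def period_box_def strip_coord_def)
  ultimately have gb: "g W \<in> period_box per" "g W \<noteq> 0"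
    using im by (auto simp: period_box_def per_def algebra_simps)
  have "((\<lambda>W. strip_potential a per (g W)) has_field_derivative
      strip_potential_deriv a per (g W) * (of_real kap * (inverse (- W) * (- 1)))) (at W)"
    by (rule DERIV_chain2[OF strip_potential_has_derivative[OF per_pos gb] dg])
  hence D: "((\<lambda>W. - of_real (lam * kap) * strip_potential a per (g W)) has_field_derivative
      - of_real (lam * kap) * (strip_potential_deriv a per (g W) * (of_real kap * (inverse (- W) * (- 1))))) (at W)"
    by (rule DERIV_cmult)
  have c1: "((\<lambda>W. Im (Ln (- W)) + pi - tp) \<longlongrightarrow> Im (Ln (- W)) + pi - tp) (nhds W)"
  proof -
    have "isCont (\<lambda>W. Im (Ln (- W)) + pi - tp) W" using mW by (intro continuous_intros) auto
    thus ?thesis using tendsto_at_iff_tendsto_nhds[of "\<lambda>W. Im (Ln (- W)) + pi - tp" W] unfolding isCont_def by (rule iffD1[rotated])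
  qed
  have c2: "((\<lambda>W. ln (cmod W)) \<longlongrightarrow> ln (cmod W)) (nhds W)"
  proof -
    have "isCont (\<lambda>W. ln (cmod W)) W" using W(1) by (intro continuous_intros) auto
    thus ?thesis using tendsto_at_iff_tendsto_nhds[of "\<lambda>W. ln (cmod W)" W] unfolding isCont_def by (rule iffD1[rotated])
  qed
  have "\<forall>\<^sub>F W' in nhds W. W' \<noteq> 0" using W(1) by (intro t1_space_nhds) auto
  moreover have "\<forall>\<^sub>F W' in nhds W. \<bar>ln (cmod W')\<bar> < 2 * hw"
    using order_tendstoD(2)[OF tendsto_rabs[OF c2] W(2)] .
  moreover have "\<forall>\<^sub>F W' in nhds W. \<bar>Im (Ln (- W')) + pi - tp\<bar> < 2 * pi"
    by (rule order_tendstoD(2)[OF tendsto_rabs[OF c1]]) (use Im0 tp_less_pi in auto)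
  ultimately have ev: "\<forall>\<^sub>F W' in nhds W. ann_pot W' = - of_real (lam * kap) * strip_potential a per (g W')"
    by eventually_elim (simp add: ann_pot_across_cut g_def)
  have "(ann_pot has_field_derivative - of_real (lam * kap) * (strip_potential_deriv a per (g W) * (of_real kap * (inverse (- W) * (- 1))))) (at W)"
    by (subst DERIV_cong_ev[OF refl ev refl]) (rule D)
  thus ?thesis using field_differentiable_def by blast
qed

lemma pc_not_focus: "pc \<noteq> of_real foc" "pc \<noteq> - of_real foc"
  using foc_pos by (auto simp: pc_def complex_eq_iff)

lemma bip_inj: "z \<noteq> of_real foc \<Longrightarrow> bip z = bip pc \<longleftrightarrow> z = pc"
proof
  assume z: "z \<noteq> of_real foc" "bip z = bip pc"
  hence "(of_real foc + z) * (of_real foc - pc) = (of_real foc + pc) * (of_real foc - z)"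
    unfolding bip_def using pc_not_focus by (simp add: field_simps)
  hence "2 * of_real foc * z = 2 * of_real foc * pc" by (simp add: algebra_simps)
  thus "z = pc" using foc_pos by simp
qed auto

lemma pc_in_dom: "pc \<in> bip_dom"
  using pc_not_focus cmod_bip_pc hw_pos by (simp add: bip_dom_def)

lemma pot_differentiable:
  assumes "z \<in> bip_dom" "z \<noteq> pc"
  shows "pot field_differentiable (at z)"
proof -
  have z: "z \<noteq> of_real foc" "\<bar>ln (cmod (bip z))\<bar> < 2 * hw" using assms by (auto simp: bip_dom_def)
  have "ann_pot field_differentiable (at (bip z))"
    using ann_pot_differentiable[OF bip_nonzero[OF assms(1)] z(2)] bip_inj[OF z(1)] assms(2) by simp
  moreover have "bip field_differentiable (at z)" using bip_has_derivative[OF z(1)] field_differentiable_def by blast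
  ultimately have "(ann_pot \<circ> bip) field_differentiable (at z)" by (rule field_differentiable_compose[rotated])
  thus ?thesis by (simp add: pot_def[abs_def] o_def)
qed

lemma pot_holomorphic: "pot holomorphic_on (bip_dom - {pc})"
  using pot_differentiable by (auto simp: holomorphic_on_def field_differentiable_at_within)

lemma bip_log_derivative:
  assumes "z \<noteq> of_real foc" "z \<noteq> - of_real foc"
  shows "2 * of_real foc / (of_real foc - z)\<^sup>2 / bip z = 2 * of_real foc / ((of_real foc)\<^sup>2 - z\<^sup>2)"
proof -
  have "of_real foc - z \<noteq> 0" "of_real foc + z \<noteq> 0" using assms by (auto simp: add_eq_0_iff)
  moreover have "(of_real foc)\<^sup>2 - z\<^sup>2 = (of_real foc - z) * (of_real foc + z)" by (simp add: power2_eq_square algebra_simps)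
  ultimately show ?thesis by (simp add: bip_def power2_eq_square)
qed

lemma pot_has_derivative:
  assumes z: "z \<in> bip_dom" "z \<noteq> pc" "bip z \<notin> \<real>\<^sub>\<le>\<^sub>0"
  shows "(pot has_field_derivative - of_real (lam * kap\<^sup>2) * strip_potential_deriv a per (strip_coord (bip z)) *
           (2 * of_real foc / ((of_real foc)\<^sup>2 - z\<^sup>2))) (at z)"
proof -
  have z': "z \<noteq> of_real foc" "z \<noteq> - of_real foc" "\<bar>ln (cmod (bip z))\<bar> < 2 * hw" using z by (auto simp: bip_dom_def)
  have "(pot has_field_derivative - of_real (lam * kap) * (strip_potential_deriv a per (strip_coord (bip z)) * (of_real kap / bip z))
      * (2 * of_real foc / (of_real foc - z)\<^sup>2)) (at z)"
    unfolding pot_def[abs_def]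
    by (rule DERIV_chain2[OF ann_pot_has_derivative bip_has_derivative[OF z'(1)]])
      (use z z' bip_nonzero bip_inj in auto)
  moreover have "- of_real (lam * kap) * (strip_potential_deriv a per (strip_coord (bip z)) * (of_real kap / bip z))
      * (2 * of_real foc / (of_real foc - z)\<^sup>2) =
      - of_real (lam * kap\<^sup>2) * strip_potential_deriv a per (strip_coord (bip z)) * (2 * of_real foc / (of_real foc - z)\<^sup>2 / bip z)"
    by (simp add: power2_eq_square mult_ac)
  ultimately show ?thesis unfolding bip_log_derivative[OF z'(1,2)] by simp
qed

text \<open>The polar part \<open>- a / w\<close> of the strip potential is divided by the
  derivative \<open>c\<close> of the strip coordinate at \<open>pc\<close>; the prefactor in
  \<open>ann_pot\<close> leaves exactly \<open>a / (2 * pi)\<close>.\<close>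

lemma pot_pole: "((\<lambda>z. (z - pc) * pot z) \<longlongrightarrow> a / (2 * of_real pi)) (at pc)"
proof -
  define w where "w z = strip_coord (bip z)" for z
  define c where "c = complex_of_real (kap * (2 * pi * lam))"
  have c0: "c \<noteq> 0" using kap_pos lam_pos by (simp add: c_def)
  have sq: "(of_real foc)\<^sup>2 - pc\<^sup>2 = complex_of_real (foc\<^sup>2 + q\<^sup>2)"
    by (simp add: pc_def complex_eq_iff power2_eq_square)
  have "(strip_coord has_field_derivative of_real kap / bip pc) (at (bip pc))"
    unfolding strip_coord_def[abs_def] using bip_pc_not_nonpos by (auto intro!: derivative_eq_intros simp: divide_inverse)
  hence "(w has_field_derivative of_real kap / bip pc * (2 * of_real foc / (of_real foc - pc)\<^sup>2)) (at pc)"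
    unfolding w_def[abs_def] by (rule DERIV_chain2[OF _ bip_has_derivative[OF pc_not_focus(1)]])
  moreover have "of_real kap / bip pc * (2 * of_real foc / (of_real foc - pc)\<^sup>2) = c"
  proof -
    have "of_real kap / bip pc * (2 * of_real foc / (of_real foc - pc)\<^sup>2) =
       of_real kap * (2 * of_real foc / (of_real foc - pc)\<^sup>2 / bip pc)" by simp
    also have "\<dots> = of_real kap * (2 * of_real foc / complex_of_real (foc\<^sup>2 + q\<^sup>2))"
      unfolding bip_log_derivative[OF pc_not_focus] sq ..
    also have "\<dots> = c" unfolding c_def lam_def by simp
    finally show ?thesis .
  qed
  ultimately have dw: "(w has_field_derivative c) (at pc)" by simp
  have w0: "w pc = 0" using strip_coord_eq_0[OF bip_pc_nonzero] by (simp add: w_def)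
  have quo: "((\<lambda>z. w z / (z - pc)) \<longlongrightarrow> c) (at pc)"
    using dw w0 by (simp add: has_field_derivative_iff)
  have nz: "\<forall>\<^sub>F z in at pc. w z \<noteq> 0"
    using tendsto_imp_eventually_ne[OF quo c0] by eventually_elim auto
  have "(w \<longlongrightarrow> 0) (at pc)" using DERIV_isCont[OF dw] w0 by (simp add: isCont_def)
  hence "filterlim w (at 0) (at pc)" using nz by (simp add: filterlim_at)
  hence "((\<lambda>z. w z * strip_potential a per (w z)) \<longlongrightarrow> - a) (at pc)"
    by (rule filterlim_compose[OF strip_potential_pole[OF per_pos]])
  hence "((\<lambda>z. - of_real (lam * kap) * (w z * strip_potential a per (w z)) / (w z / (z - pc))) \<longlongrightarrow>
      - of_real (lam * kap) * (- a) / c) (at pc)"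
    by (intro tendsto_divide tendsto_mult tendsto_const quo c0)
  moreover have "- of_real (lam * kap) * (- a) / c = a / (2 * of_real pi)"
    using kap_pos lam_pos by (simp add: c_def)
  moreover have "\<forall>\<^sub>F z in at pc. - of_real (lam * kap) * (w z * strip_potential a per (w z)) / (w z / (z - pc)) = (z - pc) * pot z"
    using nz by eventually_elim (simp add: pot_def ann_pot_def w_def)
  ultimately show ?thesis using Lim_transform_eventually by fastforce
qed

text \<open>A removable singularity. The splitting separates the explicit dipole field, whose
  distributional Laplacian is known, from a remainder whose real part is harmonic even at the
  emitter.\<close>

lemma pot_split:
  obtains H where "H holomorphic_on bip_dom"
    "\<And>z. z \<in> bip_dom \<Longrightarrow> z \<noteq> pc \<Longrightarrow> pot z = a / (2 * of_real pi * (z - pc)) + H z"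
proof -
  define g where "g z = pot z - a / (2 * of_real pi * (z - pc))" for z
  have hol: "g holomorphic_on (bip_dom - {pc})"
    unfolding g_def[abs_def] by (intro holomorphic_intros pot_holomorphic) auto
  have int: "pc \<in> interior bip_dom" using pc_in_dom open_bip_dom by (simp add: interior_open)
  have "((\<lambda>z. (z - pc) * pot z - a / (2 * of_real pi)) \<longlongrightarrow> a / (2 * of_real pi) - a / (2 * of_real pi)) (at pc)"
    by (intro tendsto_diff pot_pole tendsto_const)
  moreover have "\<forall>\<^sub>F z in at pc. (z - pc) * pot z - a / (2 * of_real pi) = (z - pc) * g z"
  proof -
    have "\<forall>\<^sub>F z in at pc. z \<noteq> pc" by (simp add: eventually_at_filter)
    thus ?thesis
    proof eventually_elim
      case (elim z)
      have "(z - pc) * g z = (z - pc) * pot z - (z - pc) * (a / (2 * of_real pi * (z - pc)))"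
        unfolding g_def by (rule right_diff_distrib)
      moreover have "(z - pc) * (a / (2 * of_real pi * (z - pc))) = a / (2 * of_real pi)"
        using elim nonzero_mult_divide_mult_cancel_right[of "z - pc" a "2 * of_real pi"] by (simp add: mult.commute)
      ultimately show ?case by simp
    qed
  qed
  ultimately have "((\<lambda>z. (z - pc) * g z) \<longlongrightarrow> 0) (at pc)" using Lim_transform_eventually by fastforce
  then obtain H where "H holomorphic_on bip_dom" "\<forall>z\<in>bip_dom - {pc}. H z = g z"
    using holomorphic_on_extend_lim[OF hol int] by blast
  thus ?thesis using that[of H] by (auto simp: g_def)
qed

lemma Re_pot_boundary:
  assumes "1 \<le> cmod (z - of_real ctr)" "1 \<le> cmod (z + of_real ctr)"
  shows "cmod (z - of_real ctr) = 1 \<Longrightarrow> Re (pot z) = lam * kap * (4 * Re a / per) * (pi / 4)"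
    and "cmod (z + of_real ctr) = 1 \<Longrightarrow> Re (pot z) = - (lam * kap * (4 * Re a / per) * (pi / 4))"
proof -
  note b = ln_bip_le[OF assms]
  have box: "strip_coord (bip z) \<in> period_box per"
    using b(1-3) hw_pos by (intro strip_coord_in_box) auto
  have re: "Re (strip_coord (bip z)) = kap * ln (cmod (bip z))" using b(3) by (simp add: strip_coord_def)
  have kh: "kap * hw = pi / 4" using hw_pos by (simp add: kap_def)
  have *: "Re (pot z) = lam * kap * (4 * Re a / per) * Re (strip_coord (bip z))" if "\<bar>Re (strip_coord (bip z))\<bar> = pi / 4"
    using Re_strip_potential_boundary[OF per_pos box that, of a]
    by (simp add: pot_def ann_pot_def del: of_real_mult)
  show "Re (pot z) = lam * kap * (4 * Re a / per) * (pi / 4)" if "cmod (z - of_real ctr) = 1"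
  proof -
    have r: "Re (strip_coord (bip z)) = pi / 4" using b(4) that re kh by simp
    show ?thesis using * unfolding r by simp
  qed
  show "Re (pot z) = - (lam * kap * (4 * Re a / per) * (pi / 4))" if "cmod (z + of_real ctr) = 1"
  proof -
    have r: "Re (strip_coord (bip z)) = - (pi / 4)" using b(5) that re kh by simp
    show ?thesis using * unfolding r by simp
  qed
qed

text \<open>Infinity is mapped to \<open>- 1\<close>, an interior point of the annulus that lies on
  the branch cut; \<open>ann_pot\<close> is continuous there because of its periodicity.\<close>

lemma pot_bounded_at_infinity: "\<exists>R B. \<forall>z. R \<le> cmod z \<longrightarrow> cmod (pot z) \<le> B"
proof -
  have "bip pc \<noteq> - 1" using bip_pc_not_nonpos by (auto simp: complex_nonpos_Reals_iff)
  hence "isCont ann_pot (- 1)"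
    using hw_pos by (intro field_differentiable_imp_continuous_at ann_pot_differentiable) auto
  hence "(ann_pot \<longlongrightarrow> ann_pot (- 1)) (nhds (- 1))" unfolding isCont_def tendsto_at_iff_tendsto_nhds .
  hence "\<forall>\<^sub>F W in nhds (- 1). dist (ann_pot W) (ann_pot (- 1)) < 1" by (rule tendstoD) simp
  then obtain d where d: "d > 0" "\<And>W. dist W (- 1) < d \<Longrightarrow> dist (ann_pot W) (ann_pot (- 1)) < 1"
    by (auto simp: eventually_nhds_metric)
  have "cmod (pot z) \<le> cmod (ann_pot (- 1)) + 1" if "foc + 2 * foc / d + 1 \<le> cmod z" for z
  proof -
    have "cmod z - foc \<le> cmod (of_real foc - z)" using norm_triangle_ineq2[of z "of_real foc"] foc_pos by (simp add: norm_minus_commute)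
    hence l: "2 * foc / d < cmod (of_real foc - z)" using that by linarith
    have p: "0 < 2 * foc / d" using foc_pos d by simp
    hence n: "of_real foc - z \<noteq> 0" using l by auto
    have "bip z - (- 1) = 2 * of_real foc / (of_real foc - z)" unfolding bip_def using n by (simp add: field_simps)
    hence "dist (bip z) (- 1) = 2 * foc / cmod (of_real foc - z)" using foc_pos by (simp add: dist_norm norm_divide norm_mult)
    also have "\<dots> < d" using l d(1) p by (simp add: divide_less_eq mult.commute)
    finally have "dist (pot z) (ann_pot (- 1)) < 1" using d(2) by (simp add: pot_def)
    thus ?thesis using norm_triangle_sub[of "pot z" "ann_pot (- 1)"] by (simp add: dist_norm)
  qed
  thus ?thesis by blast
qed

end


section \<open>Identification of the solution\<close>

text \<open>Keeps the disk index \<open>1\<close> from being rewritten to \<open>Suc 0\<close>, so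
  that facts about \<open>disk_center \<epsilon> 1\<close> keep matching.\<close>

declare One_nat_def [simp del]

lemma weakly_harmonic_linear:
  assumes "weakly_harmonic S u" "weakly_harmonic S v"
  shows "weakly_harmonic S (\<lambda>x. c * u x + d * v x)"
  using assms regular_laplacian_linear[of u S v _ c d] locally_integrable_on_add[of u S v c d]
  unfolding weakly_harmonic_def by auto

lemma weakly_harmonicI:
  fixes v :: "real^2 \<Rightarrow> real"
  assumes U: "open U" "G holomorphic_on U" and S: "S = cx -` U"
    and v: "\<And>x. x \<in> S \<Longrightarrow> (v has_derivative (\<lambda>h. Re (G (cx x) * cx h))) (at x)"
  shows "weakly_harmonic S v"
  unfolding weakly_harmonic_def
proof
  have "continuous_on S v" using v has_derivative_continuous continuous_at_imp_continuous_on by blast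
  thus "locally_integrable_on v S" by (rule locally_integrable_on_continuous)
  show "\<forall>\<phi>\<in>test_functions S \<inter> bumps. distr_laplacian (regular_distr S v) \<phi> = 0"
    using weakly_harmonic_of_holomorphic_gradient[OF U S v] by auto
qed

text \<open>\<open>ln (cmod w)\<close> is the real part of \<open>Ln w\<close> off the branch cut
  and of \<open>Ln (- w)\<close> near the cut, so two branches of the logarithm cover all
  points.\<close>

lemma ln_cmod_has_derivative:
  assumes "w \<noteq> 0"
  shows "((\<lambda>w. ln (cmod w)) has_derivative (\<lambda>h. Re (h / w))) (at w)"
proof -
  have *: "((\<lambda>w. Re (Ln w)) has_derivative (\<lambda>h. Re (h / w))) (at w)" if "w \<notin> \<real>\<^sub>\<le>\<^sub>0" for w
  proof -
    have "(Ln has_field_derivative inverse w) (at w)" using that by (rule has_field_derivative_Ln)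
    hence "(Ln has_derivative (\<lambda>h. inverse w * h)) (at w)" by (simp add: has_field_derivative_def)
    from has_derivative_Re[OF this] show ?thesis by (simp add: divide_inverse mult.commute)
  qed
  have o: "open (- {0::complex})" by (simp add: open_Compl)
  show ?thesis
  proof (cases "w \<in> \<real>\<^sub>\<le>\<^sub>0")
    case False
    show ?thesis
      by (rule has_derivative_transform_within_open[OF *[OF False] o]) (use assms in auto)
  next
    case True
    hence "- w \<notin> \<real>\<^sub>\<le>\<^sub>0" using assms by (auto simp: complex_nonpos_Reals_iff complex_eq_iff)
    from has_derivative_compose[OF has_derivative_minus[OF has_derivative_ident] *[OF this]]
    have "((\<lambda>w. Re (Ln (- w))) has_derivative (\<lambda>h. Re (h / w))) (at w)" by simp
    thus ?thesis
      by (rule has_derivative_transform_within_open[OF _ o]) (use assms in auto)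
  qed
qed

lemma Re_cx_has_derivative:
  assumes "(f has_field_derivative D) (at (cx x))"
  shows "((\<lambda>x. Re (f (cx x))) has_derivative (\<lambda>h. Re (D * cx h))) (at x)"
proof -
  have "(f has_derivative (*) D) (at (cx x))" using assms by (simp add: has_field_derivative_def)
  from has_derivative_Re[OF has_derivative_compose[OF cx_has_derivative this]] show ?thesis .
qed

lemma ln_cmod_cx_has_derivative:
  assumes "(f has_field_derivative D) (at (cx x))" "f (cx x) \<noteq> 0"
  shows "((\<lambda>x. ln (cmod (f (cx x)))) has_derivative (\<lambda>h. Re (D / f (cx x) * cx h))) (at x)"
proof -
  have "(f has_derivative (*) D) (at (cx x))" using assms(1) by (simp add: has_field_derivative_def)
  from has_derivative_compose[OF has_derivative_compose[OF cx_has_derivative this] ln_cmod_has_derivative[OF assms(2)]]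
  show ?thesis by simp
qed

section \<open>Geometry of the exterior domain and its maximum principle\<close>

lemma dist_cx: "dist x y = cmod (cx x - cx y)"
  by (simp add: dist_norm norm_cx flip: cx_diff)

text \<open>A boundary point of one ball is pushed radially outward by less than the gap
  \<open>\<epsilon>\<close>, so it cannot enter the other ball.\<close>

lemma closure_outside_two_balls:
  fixes c c' :: "'a::real_normed_vector"
  assumes cc: "dist c c' \<ge> 2 + \<epsilon>" "\<epsilon> > 0" and x: "1 \<le> dist x c" "1 \<le> dist x c'"
  shows "x \<in> closure {x. 1 < dist x c \<and> 1 < dist x c'}"
proof -
  have one: "\<exists>y. 1 < dist y d \<and> 1 < dist y d' \<and> dist y x < e"
    if "dist d d' \<ge> 2 + \<epsilon>" "dist x d = 1" "e > 0" for d d' e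
  proof -
    define t where "t = min \<epsilon> e / 2"
    have t: "0 < t" "t < \<epsilon>" "t < e" using that assms(2) by (auto simp: t_def)
    define y where "y = x + t *\<^sub>R (x - d)"
    have "y - d = (1 + t) *\<^sub>R (x - d)" by (simp add: y_def algebra_simps)
    hence 1: "dist y d = 1 + t" using that t by (simp add: dist_norm)
    have 2: "dist y x = t" using that t by (simp add: y_def dist_norm)
    have "dist d d' \<le> dist x d + dist y x + dist y d'"
      by (smt (verit) dist_commute dist_triangle)
    hence "dist y d' > 1" using that 2 t by linarith
    thus ?thesis using 1 2 t by (intro exI[of _ y]) auto
  qed
  show ?thesis unfolding closure_approachable
  proof (intro allI impI)
    fix e :: real assume e: "e > 0"
    consider "dist x c = 1" | "dist x c' = 1" | "dist x c > 1" "dist x c' > 1" using x by linarith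
    thus "\<exists>y\<in>{x. 1 < dist x c \<and> 1 < dist x c'}. dist y x < e"
    proof cases
      case 1 thus ?thesis using one[OF cc(1) 1 e] by auto
    next
      case 2 thus ?thesis using one[of c' c e] cc e by (auto simp: dist_commute)
    next
      case 3 thus ?thesis using e by (intro bexI[of _ x]) auto
    qed
  qed
qed

lemma cx_disk_center: "cx (disk_center \<epsilon> 1) = - of_real (1 + \<epsilon> / 2)" "cx (disk_center \<epsilon> 2) = of_real (1 + \<epsilon> / 2)"
  by (simp_all add: cx_def disk_center_def complex_eq_iff)

lemma dist_disk_centers: "\<epsilon> > 0 \<Longrightarrow> dist (disk_center \<epsilon> 1) (disk_center \<epsilon> 2) = 2 + \<epsilon>"
proof -
  assume "\<epsilon> > 0"
  have "cx (disk_center \<epsilon> 1) - cx (disk_center \<epsilon> 2) = - of_real (2 + \<epsilon>)" unfolding cx_disk_center by simp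
  hence "dist (disk_center \<epsilon> 1) (disk_center \<epsilon> 2) = cmod (of_real (2 + \<epsilon>))" unfolding dist_cx by (simp only: norm_minus_cancel)
  thus ?thesis using \<open>\<epsilon> > 0\<close> unfolding norm_of_real by simp
qed

lemma exterior_domain_eq: "exterior_domain \<epsilon> = {x. 1 < dist x (disk_center \<epsilon> 1) \<and> 1 < dist x (disk_center \<epsilon> 2)}"
  by (auto simp: exterior_domain_def disk_def closure_Un dist_commute)

lemma closure_exterior_domain:
  assumes "\<epsilon> > 0"
  shows "closure (exterior_domain \<epsilon>) = {x. 1 \<le> dist x (disk_center \<epsilon> 1) \<and> 1 \<le> dist x (disk_center \<epsilon> 2)}"
proof
  show "closure (exterior_domain \<epsilon>) \<subseteq> {x. 1 \<le> dist x (disk_center \<epsilon> 1) \<and> 1 \<le> dist x (disk_center \<epsilon> 2)}"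
    by (rule closure_minimal)
      (auto simp: exterior_domain_eq intro!: closed_Collect_conj closed_Collect_le continuous_intros)
  show "{x. 1 \<le> dist x (disk_center \<epsilon> 1) \<and> 1 \<le> dist x (disk_center \<epsilon> 2)} \<subseteq> closure (exterior_domain \<epsilon>)"
    unfolding exterior_domain_eq
    by (intro subsetI, clarify, rule closure_outside_two_balls[where \<epsilon> = \<epsilon>]) (use dist_disk_centers[OF assms] assms in auto)
qed

lemma open_exterior_domain: "open (exterior_domain \<epsilon>)"
  unfolding exterior_domain_def by (intro open_Diff open_UNIV closed_closure)

lemma frontier_disk: "frontier (disk \<epsilon> j) = {x. dist x (disk_center \<epsilon> j) = 1}"
  by (auto simp: disk_def frontier_ball dist_commute)

text \<open>Two defects keep \<open>weak_maximum_principle\<close> from applying directly: the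
  domain is unbounded, and its closure leaves the open set in which \<open>h\<close> is harmonic.
  The first is met by subtracting \<open>\<delta>\<close> times a logarithm that is nonnegative
  outside the left disk and eventually outweighs the bound \<open>B\<close>; the second by
  retreating from the circles to level curves on which \<open>h < \<delta>\<close>. Then
  \<open>\<delta>\<close> is made small.\<close>

lemma exterior_maximum_principle:
  fixes h :: "real^2 \<Rightarrow> real"
  assumes eps: "\<epsilon> > 0" and wh: "weakly_harmonic (exterior_domain \<epsilon>) h" and p: "p \<in> exterior_domain \<epsilon>"
    and cont: "continuous_on (closure (exterior_domain \<epsilon>) - {p}) h"
    and bd: "\<And>j x. j \<in> {1, 2} \<Longrightarrow> dist x (disk_center \<epsilon> j) = 1 \<Longrightarrow> h x \<le> 0"
    and inf: "\<And>x. x \<in> exterior_domain \<epsilon> \<Longrightarrow> R0 \<le> norm x \<Longrightarrow> h x \<le> B"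
    and x0: "x0 \<in> exterior_domain \<epsilon>" "x0 \<noteq> p"
  shows "h x0 \<le> 0"
proof -
  define S where "S = exterior_domain \<epsilon>"
  define c where "c j = disk_center \<epsilon> j" for j
  have S: "x \<in> S \<longleftrightarrow> 1 < dist x (c 1) \<and> 1 < dist x (c 2)" for x by (simp add: S_def exterior_domain_eq c_def)
  have cS: "x \<in> closure S \<longleftrightarrow> 1 \<le> dist x (c 1) \<and> 1 \<le> dist x (c 2)" for x
    by (simp add: S_def closure_exterior_domain[OF eps] c_def)
  define l where "l x = ln (cmod (cx x - cx (c 1)))" for x
  have l_eq: "l x = ln (dist x (c 1))" for x by (simp add: l_def dist_cx)
  have wl: "weakly_harmonic S l"
  proof (rule weakly_harmonicI)
    show "open {z. 1 < cmod (z - cx (c 1)) \<and> 1 < cmod (z - cx (c 2))}"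
      by (intro open_Collect_conj open_Collect_less continuous_intros)
    show "(\<lambda>z. 1 / (z - cx (c 1))) holomorphic_on {z. 1 < cmod (z - cx (c 1)) \<and> 1 < cmod (z - cx (c 2))}"
      by (intro holomorphic_intros) auto
    show "S = cx -` {z. 1 < cmod (z - cx (c 1)) \<and> 1 < cmod (z - cx (c 2))}" by (auto simp: S dist_cx)
    show "(l has_derivative (\<lambda>h. Re (1 / (cx x - cx (c 1)) * cx h))) (at x)" if "x \<in> S" for x
      unfolding l_def[abs_def]
      by (rule ln_cmod_cx_has_derivative[where f = "\<lambda>z. z - cx (c 1)"])
        (use that in \<open>auto simp: S dist_cx intro!: derivative_eq_intros\<close>)
  qed
  have "h x0 \<le> \<delta> * (1 + l x0)" if "\<delta> > 0" for \<delta>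
  proof -
    define hd where "hd x = 1 * h x + (- \<delta>) * l x" for x
    have whd: "weakly_harmonic S hd"
      unfolding hd_def[abs_def] by (rule weakly_harmonic_linear[OF wh[folded S_def] wl])
    have l0: "l x \<ge> 0" if "1 \<le> dist x (c 1)" for x using that by (simp add: l_eq)
    have contl: "continuous_on (closure S) l"
      unfolding l_eq[abs_def] by (intro continuous_intros) (auto simp: cS)
    have conth: "continuous_on (closure S - {p}) h" using cont by (simp add: S_def)
    have conthd: "continuous_on (S - {p}) hd"
      unfolding hd_def[abs_def]
      by (intro continuous_intros continuous_on_subset[OF conth] continuous_on_subset[OF contl]) (use closure_subset in auto)
    \<comment> \<open>At distance \<open>exp (\<bar>B\<bar> / \<delta>)\<close> from the centre of
      the left disk the logarithmic barrier compensates \<open>B\<close>; the other entries keep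
      \<open>p\<close> and \<open>x0\<close> inside.\<close>
    define R where "R = Max {R0, norm p + 1, norm x0 + 1, norm (c 1) + exp (\<bar>B\<bar> / \<delta>) + 1}"
    have R: "R0 \<le> R" "norm p < R" "norm x0 < R" "norm (c 1) + exp (\<bar>B\<bar> / \<delta>) \<le> R"
    proof -
      have m: "t \<le> R" if "t \<in> {R0, norm p + 1, norm x0 + 1, norm (c 1) + exp (\<bar>B\<bar> / \<delta>) + 1}" for t
        unfolding R_def using that by (intro Max_ge) auto
      show "R0 \<le> R" "norm p < R" "norm x0 < R" "norm (c 1) + exp (\<bar>B\<bar> / \<delta>) \<le> R"
        using m[of R0] m[of "norm p + 1"] m[of "norm x0 + 1"] m[of "norm (c 1) + exp (\<bar>B\<bar> / \<delta>) + 1"] by auto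
    qed
    have far: "hd x \<le> \<delta>" if "x \<in> S" "norm x = R" for x
    proof -
      have "exp (\<bar>B\<bar> / \<delta>) \<le> dist x (c 1)" using R(4) that(2) norm_triangle_ineq2[of x "c 1"] by (simp add: dist_norm)
      hence "\<bar>B\<bar> / \<delta> \<le> l x" unfolding l_eq by (metis exp_gt_zero ln_exp ln_le_cancel_iff less_le_trans)
      hence "\<bar>B\<bar> \<le> \<delta> * l x" using \<open>\<delta> > 0\<close> by (simp add: divide_le_eq mult.commute)
      moreover have "h x \<le> B" using inf[of x] that R(1) by (simp add: S_def)
      ultimately show ?thesis using \<open>\<delta> > 0\<close> by (simp add: hd_def)
    qed
    define \<rho> where "\<rho> = min (dist p (c 1) - 1) (dist p (c 2) - 1) / 2"
    have rho: "\<rho> > 0" "dist p (c j) \<ge> 1 + 2 * \<rho>" if "j \<in> {1, 2}" for j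
      using p that by (auto simp: \<rho>_def S_def[symmetric] S)
    have rho0: "\<rho> > 0" using rho(1)[of 1] by simp
    \<comment> \<open>The points where \<open>h\<close> is not yet small. This set is compact and
      misses the circles, where \<open>h \<le> 0 < \<delta>\<close>, so it keeps a positive distance
      \<open>t\<close> from them. The ball around \<open>p\<close> is removed because
      \<open>h\<close> is continuous only away from \<open>p\<close>.\<close>
    define K where "K = {x \<in> closure S - ball p \<rho>. norm x \<le> R \<and> \<delta> \<le> h x}"
    have cK: "compact K"
    proof -
      have "closed (closure S - ball p \<rho>)" by (intro closed_Diff) auto
      hence "closed {x \<in> closure S - ball p \<rho>. h x \<in> {\<delta>..}}"
        by (intro continuous_closed_preimage[unfolded vimage_def Int_def, simplified] continuous_on_subset[OF conth])
          (use rho0 in \<open>auto simp: continuous_on_subset[OF conth]\<close>)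
      hence "closed (cball 0 R \<inter> {x \<in> closure S - ball p \<rho>. h x \<in> {\<delta>..}})" by (intro closed_Int) auto
      hence "compact (cball 0 R \<inter> {x \<in> closure S - ball p \<rho>. h x \<in> {\<delta>..}})"
        using compact_Int_closed[OF compact_cball, of "cball 0 R \<inter> {x \<in> closure S - ball p \<rho>. h x \<in> {\<delta>..}}" 0 R] by (simp add: Int_assoc[symmetric])
      moreover have "cball 0 R \<inter> {x \<in> closure S - ball p \<rho>. h x \<in> {\<delta>..}} = K" by (auto simp: K_def)
      ultimately show ?thesis by simp
    qed
    have KS: "K \<subseteq> S"
    proof
      fix x assume x: "x \<in> K"
      have "dist x (c j) \<noteq> 1" if "j \<in> {1, 2}" for j using bd[OF that, of x] x \<open>\<delta> > 0\<close> by (auto simp: K_def c_def)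
      from this[of 1] this[of 2] show "x \<in> S" using x by (auto simp: K_def S cS)
    qed
    obtain t where t: "t > 0" "\<And>x j. x \<in> K \<Longrightarrow> j \<in> {1, 2} \<Longrightarrow> dist x (c j) > 1 + t"
    proof (cases "K = {}")
      case True thus ?thesis using that[of 1] by auto
    next
      case False
      define m where "m x = min (dist x (c 1)) (dist x (c 2))" for x
      have "continuous_on K m" unfolding m_def[abs_def] by (intro continuous_intros)
      then obtain y where y: "y \<in> K" "\<And>x. x \<in> K \<Longrightarrow> m y \<le> m x" using continuous_attains_inf[OF cK False] by blast
      have "m y > 1" using y(1) KS S by (auto simp: m_def)
      have mm: "m x \<le> dist x (c j)" if "j \<in> {1, 2}" for x j using that by (auto simp: m_def)
      show ?thesis
      proof (rule that[of "(m y - 1) / 2"])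
        show "(m y - 1) / 2 > 0" using \<open>m y > 1\<close> by simp
        fix x j assume "x \<in> K" "j \<in> {1, 2::nat}"
        hence "m y \<le> dist x (c j)" using y(2)[of x] mm[of j x] by auto
        thus "dist x (c j) > 1 + (m y - 1) / 2" using \<open>m y > 1\<close> by argo
      qed
    qed
    \<comment> \<open>The collar is thinner than the distance from \<open>K\<close> to the circles,
      than the clearance \<open>\<rho>\<close> of the emitter, and than the distance from
      \<open>x0\<close> to the circles.\<close>
    define t' where "t' = min (min t \<rho>) (min (dist x0 (c 1) - 1) (dist x0 (c 2) - 1)) / 2"
    have "dist x0 (c 1) > 1" "dist x0 (c 2) > 1" using x0 by (auto simp: S_def[symmetric] S)
    hence t': "t' > 0" "t' < t" "t' < \<rho>" "1 + t' < dist x0 (c 1)" "1 + t' < dist x0 (c 2)"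
    proof -
      define m where "m = min (min t \<rho>) (min (dist x0 (c 1) - 1) (dist x0 (c 2) - 1))"
      have "m > 0" "m \<le> t" "m \<le> \<rho>" "m \<le> dist x0 (c 1) - 1" "m \<le> dist x0 (c 2) - 1"
        using t(1) rho0 \<open>dist x0 (c 1) > 1\<close> \<open>dist x0 (c 2) > 1\<close> by (auto simp: m_def)
      moreover have "t' = m / 2" by (simp add: t'_def m_def)
      ultimately show "t' > 0" "t' < t" "t' < \<rho>" "1 + t' < dist x0 (c 1)" "1 + t' < dist x0 (c 2)" by linarith+
    qed
    define V where "V = {x. norm x < R \<and> 1 + t' < dist x (c 1) \<and> 1 + t' < dist x (c 2)}"
    have oV: "open V" unfolding V_def by (intro open_Collect_conj open_Collect_less continuous_intros)
    have clV: "closure V \<subseteq> {x. norm x \<le> R \<and> 1 + t' \<le> dist x (c 1) \<and> 1 + t' \<le> dist x (c 2)}"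
      by (rule closure_minimal) (auto simp: V_def intro!: closed_Collect_conj closed_Collect_le continuous_intros)
    have "bounded V" by (rule bounded_subset[OF bounded_ball[of 0 R]]) (auto simp: V_def)
    moreover have "closure V \<subseteq> S" using clV t'(1) by (auto simp: S)
    moreover have "p \<in> V" unfolding V_def using R(2) rho(2)[of 1] rho(2)[of 2] t' rho0 by auto
    hence "p \<notin> frontier V" using oV by (simp add: frontier_def interior_open)
    moreover have "hd x \<le> \<delta>" if "x \<in> frontier V" for x
    proof -
      have xc: "x \<in> closure V" "x \<notin> V" using that oV by (auto simp: frontier_def interior_open)
      hence xS: "x \<in> S" using \<open>closure V \<subseteq> S\<close> by auto
      have "norm x = R \<or> (\<exists>j\<in>{1, 2}. dist x (c j) = 1 + t')" using xc clV by (auto simp: V_def)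
      thus ?thesis
      proof
        assume "norm x = R" thus ?thesis using far xS by simp
      next
        assume "\<exists>j\<in>{1, 2}. dist x (c j) = 1 + t'"
        then obtain j where j: "j \<in> {1, 2}" "dist x (c j) = 1 + t'" by auto
        have "x \<notin> K" using t(2)[of x j] j t' by auto
        moreover have "dist p x \<ge> \<rho>"
        proof -
          have "dist p (c j) \<le> dist p x + dist x (c j)" by (rule dist_triangle)
          thus ?thesis using rho(2)[OF j(1)] j(2) t' by linarith
        qed
        moreover have "norm x \<le> R" "x \<in> closure S" using xc clV xS closure_subset by auto
        ultimately have "h x < \<delta>" by (auto simp: K_def)
        moreover have "\<delta> * l x \<ge> 0" using l0[of x] xS \<open>\<delta> > 0\<close> by (simp add: S)
        ultimately show ?thesis by (simp add: hd_def)
      qed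
    qed
    moreover have "x0 \<in> V" using t' R(3) by (simp add: V_def)
    ultimately have "hd x0 \<le> \<delta>"
      using weak_maximum_principle[OF open_exterior_domain[of \<epsilon>, folded S_def] whd conthd oV] x0(2) by blast
    thus ?thesis by (simp add: hd_def algebra_simps)
  qed
  note main = this
  have l0: "1 + l x0 > 0" using x0 by (simp add: l_eq S_def[symmetric] S add_pos_nonneg)
  show ?thesis
  proof (rule ccontr)
    assume "\<not> h x0 \<le> 0"
    \<comment> \<open>This value of \<open>\<delta>\<close> turns the estimate into
      \<open>h x0 \<le> h x0 / 2\<close>.\<close>
    hence "h x0 / (2 * (1 + l x0)) > 0" using l0 by simp
    from main[OF this] have "h x0 \<le> h x0 / (2 * (1 + l x0)) * (1 + l x0)" .
    also have "\<dots> = h x0 / 2 * ((1 + l x0) / (1 + l x0))" by (simp only: times_divide_times_eq) (simp add: mult.commute)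
    also have "\<dots> = h x0 / 2" using l0 by simp
    finally have "h x0 \<le> h x0 / 2" .
    thus False using \<open>\<not> h x0 \<le> 0\<close> by simp
  qed
qed

section \<open>Uniqueness from boundary values and flux\<close>

context two_disks
begin

lemma dist_centers_cx: "dist x (disk_center \<epsilon> 1) = cmod (cx x + of_real ctr)" "dist x (disk_center \<epsilon> 2) = cmod (cx x - of_real ctr)"
  unfolding dist_cx cx_disk_center ctr_def by (simp_all add: algebra_simps)

lemma closure_exterior_in_dom: "x \<in> closure (exterior_domain \<epsilon>) \<Longrightarrow> cx x \<in> bip_dom"
  using exterior_in_dom[of "cx x"] by (simp add: closure_exterior_domain[OF eps] dist_centers_cx)

lemma cx_p: "cx (vector [0, q]) = pc" by (simp add: cx_def pc_def)

lemma p_in_exterior: "vector [0, q] \<in> exterior_domain \<epsilon>"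
proof -
  have "1 < (cmod (pc + of_real ctr))\<^sup>2" "1 < (cmod (pc - of_real ctr))\<^sup>2"
  proof -
    have "1 < ctr\<^sup>2 + q\<^sup>2" using one_less_power[OF ctr_pos, of 2] zero_le_power2[of q] by linarith
    thus "1 < (cmod (pc + of_real ctr))\<^sup>2" "1 < (cmod (pc - of_real ctr))\<^sup>2" by (simp_all add: cmod_power2 pc_def)
  qed
  hence "1 < cmod (pc + of_real ctr)" "1 < cmod (pc - of_real ctr)"
    using power_le_one[of "cmod (pc + of_real ctr)" 2] power_le_one[of "cmod (pc - of_real ctr)" 2] by (force simp: not_le[symmetric])+
  thus ?thesis by (simp add: exterior_domain_eq dist_centers_cx cx_p)
qed

lemma log_bip_derivative:
  assumes "cx x \<in> bip_dom"
  shows "((\<lambda>x. ln (cmod (bip (cx x)))) has_derivative (\<lambda>h. Re (2 * of_real foc / ((of_real foc)\<^sup>2 - (cx x)\<^sup>2) * cx h))) (at x)"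
proof -
  have "cx x \<noteq> of_real foc" "cx x \<noteq> - of_real foc" using assms by (auto simp: bip_dom_def)
  from ln_cmod_cx_has_derivative[OF bip_has_derivative[OF this(1)] bip_nonzero[OF assms], unfolded bip_log_derivative[OF this]]
  show ?thesis .
qed

lemma foc_sq_minus_nonzero: "z \<in> bip_dom \<Longrightarrow> (of_real foc)\<^sup>2 - z\<^sup>2 \<noteq> 0"
  by (auto simp: bip_dom_def power2_eq_iff)

text \<open>The fraction is the complex derivative whose real part gives the gradient of
  \<open>ln (cmod (bip z))\<close>, and multiplication by \<open>cis \<theta>\<close> selects the
  radial derivative on the right circle. The value has one sign, so this harmonic function carries a
  nonzero flux.\<close>

lemma flux_kernel: "2 * of_real foc / ((of_real foc)\<^sup>2 - (of_real ctr + cis \<theta>)\<^sup>2) * cis \<theta> = - of_real (foc / (ctr + cos \<theta>))"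
proof -
  have c1: "ctr\<^sup>2 = 1 + foc\<^sup>2" using ctr_foc by (simp add: power2_eq_square algebra_simps)
  have pos: "ctr + cos \<theta> > 0" using ctr_pos cos_ge_minus_one[of \<theta>] by linarith
  have ce: "cis \<theta> * cis (- \<theta>) = 1" by (simp add: cis_mult)
  have s: "cis \<theta> + cis (- \<theta>) = 2 * of_real (cos \<theta>)" by (simp add: complex_eq_iff)
  have "(of_real foc)\<^sup>2 - (of_real ctr + cis \<theta>)\<^sup>2 = (of_real (foc\<^sup>2) - of_real (ctr\<^sup>2)) - 2 * of_real ctr * cis \<theta> - cis \<theta> * cis \<theta>"
    by (simp add: power2_eq_square algebra_simps)
  also have "\<dots> = - (cis \<theta> * cis (- \<theta>)) - 2 * of_real ctr * cis \<theta> - cis \<theta> * cis \<theta>" unfolding c1 ce by simp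
  also have "\<dots> = - cis \<theta> * ((cis \<theta> + cis (- \<theta>)) + 2 * of_real ctr)" by (simp add: algebra_simps)
  also have "\<dots> = - cis \<theta> * of_real (2 * (ctr + cos \<theta>))" unfolding s by simp
  finally have e: "(of_real foc)\<^sup>2 - (of_real ctr + cis \<theta>)\<^sup>2 = - cis \<theta> * of_real (2 * (ctr + cos \<theta>))" .
  have aux: "2 * F / (- e * (2 * R)) * e = - (F / R)" if "e \<noteq> 0" "R \<noteq> 0" for F e R :: complex
    using that by (simp add: field_simps)
  have r0: "complex_of_real (ctr + cos \<theta>) \<noteq> 0" unfolding of_real_eq_0_iff using pos by simp
  show ?thesis unfolding e of_real_mult of_real_divide of_real_numeral by (rule aux[OF cis_neq_zero r0])
qed

lemma cx_eq_pc: "cx x = pc \<longleftrightarrow> x = vector [0, q]"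
  using dist_cx[of x "vector [0, q]"] by (auto simp: cx_p)

lemma dipole_field_eq_Re:
  assumes "cx av = a" "x \<noteq> vector [0, q]"
  shows "dipole_field av (vector [0, q]) x = Re (a / (2 * of_real pi * (cx x - pc)))"
proof -
  define d where "d = x - vector [0, q]"
  have w: "cx x - pc = cx d" by (simp add: d_def cx_diff cx_p)
  have "a / (2 * of_real pi * cx d) = (a / cx d) / of_real (2 * pi)" by simp
  hence "Re (a / (2 * of_real pi * (cx x - pc))) = Re (a / cx d) / (2 * pi)" unfolding w by (simp only: Re_divide_of_real)
  also have "Re (a / cx d) = (av \<bullet> d) / (d \<bullet> d)"
    by (simp add: Re_divide inner_vec_def sum_2 cx_def power2_eq_square flip: assms(1))
  finally show ?thesis by (simp add: dipole_field_def d_def)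
qed

text \<open>By the Cauchy-Riemann equations the radial derivative of \<open>Re pot\<close> is the
  derivative of \<open>Im pot\<close> along the circle; \<open>pot\<close> is single-valued, so the
  integral over the closed curve is zero.\<close>

lemma has_disk_boundary_integral_pot:
  "((\<lambda>\<theta>. Re (deriv pot (of_real ctr + cis \<theta>) * cis \<theta>)) has_integral 0) {0..2 * pi}"
proof -
  have dom: "of_real ctr + cis \<theta> \<in> bip_dom" "of_real ctr + cis \<theta> \<noteq> pc" for \<theta>
  proof -
    have "2 * ctr - 1 \<le> cmod (of_real ctr + cis \<theta> + of_real ctr)"
    proof -
      have "cmod (of_real (2 * ctr)) - cmod (cis \<theta>) \<le> cmod (of_real (2 * ctr) + cis \<theta>)" by (rule norm_diff_ineq)
      moreover have "of_real (2 * ctr) + cis \<theta> = of_real ctr + cis \<theta> + of_real ctr" by simp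
      moreover have "cmod (of_real (2 * ctr)) = 2 * ctr" unfolding norm_of_real using ctr_pos by simp
      ultimately show ?thesis by simp
    qed
    thus "of_real ctr + cis \<theta> \<in> bip_dom" using ctr_pos by (intro exterior_in_dom) auto
    show "of_real ctr + cis \<theta> \<noteq> pc"
      using p_in_exterior by (auto simp: exterior_domain_eq dist_centers_cx cx_p dest!: arg_cong[of _ _ "\<lambda>z. cmod (z - of_real ctr)"])
  qed
  have "((\<lambda>\<theta>. Re (deriv pot (of_real ctr + cis \<theta>) * cis \<theta>)) has_integral
      Im (pot (of_real ctr + cis (2 * pi))) - Im (pot (of_real ctr + cis 0))) {0..2 * pi}"
  proof (rule fundamental_theorem_of_calculus)
    fix \<theta> :: real
    have "(pot has_field_derivative deriv pot (of_real ctr + cis \<theta>)) (at (of_real ctr + cis \<theta>))"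
      by (intro DERIV_deriv_iff_field_differentiable[THEN iffD2] pot_differentiable dom)
    moreover have "((\<lambda>\<theta>. of_real ctr + cis \<theta>) has_vector_derivative \<i> * cis \<theta>) (at \<theta> within {0..2 * pi})"
    proof -
      have "((\<lambda>z. of_real ctr + exp (\<i> * z)) has_field_derivative \<i> * exp (\<i> * of_real \<theta>)) (at (of_real \<theta>))"
        by (auto intro!: derivative_eq_intros)
      from has_vector_derivative_real_field[OF this] show ?thesis by (simp add: cis_conv_exp)
    qed
    ultimately have "(pot \<circ> (\<lambda>\<theta>. of_real ctr + cis \<theta>) has_vector_derivative \<i> * cis \<theta> * deriv pot (of_real ctr + cis \<theta>)) (at \<theta> within {0..2 * pi})"
      by (intro field_vector_diff_chain_within) (auto intro: has_field_derivative_at_within)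
    from bounded_linear.has_vector_derivative[OF bounded_linear_Im this]
    have "((\<lambda>\<theta>. Im (pot (of_real ctr + cis \<theta>))) has_vector_derivative Im (\<i> * cis \<theta> * deriv pot (of_real ctr + cis \<theta>))) (at \<theta> within {0..2 * pi})"
      by (simp add: o_def)
    moreover have "Im (\<i> * cis \<theta> * deriv pot (of_real ctr + cis \<theta>)) = Re (deriv pot (of_real ctr + cis \<theta>) * cis \<theta>)"
      by (simp add: mult.commute)
    ultimately show "((\<lambda>\<theta>. Im (pot (of_real ctr + cis \<theta>))) has_vector_derivative Re (deriv pot (of_real ctr + cis \<theta>) * cis \<theta>)) (at \<theta> within {0..2 * pi})"
      by (simp only:)
  qed simp
  thus ?thesis by simp
qed

text \<open>Two free parameters, a multiple \<open>\<kappa>\<close> of \<open>\<xi>\<close> and a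
  constant \<open>b\<close>, fit the two unknown boundary constants, and the maximum principle for
  the difference and its negative gives equality. The flux condition on the right circle then forces
  \<open>\<kappa> = 0\<close>, because \<open>\<xi>\<close> carries flux and \<open>pot\<close>
  carries none.\<close>

lemma solution_eq_pot:
  assumes sol: "dipole_solution \<epsilon> av (vector [0, q]) u" and av: "cx av = a"
  shows "\<exists>b. \<forall>x\<in>exterior_domain \<epsilon> - {vector [0, q]}. u x = Re (pot (cx x)) + b"
proof -
  define p :: "real^2" where "p = vector [0, q]"
  define S where "S = exterior_domain \<epsilon>"
  define U where "U = {z. 1 < cmod (z + of_real ctr) \<and> 1 < cmod (z - of_real ctr)}"
  define K where "K = lam * kap * (4 * Re a / per) * (pi / 4)"
  have oU: "open U" unfolding U_def by (intro open_Collect_conj open_Collect_less continuous_intros)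
  have SU: "S = cx -` U" by (auto simp: S_def U_def exterior_domain_eq dist_centers_cx)
  have Ud: "U \<subseteq> bip_dom" unfolding U_def by (auto intro: exterior_in_dom)
  have cd: "cx x \<in> bip_dom" if "x \<in> closure S" for x using closure_exterior_in_dom that by (simp add: S_def)
  have pS: "p \<in> S" using p_in_exterior by (simp add: p_def S_def)
  have u: "continuous_on (closure S - {p}) u" "locally_integrable_on u S"
    "\<And>\<phi>. \<phi> \<in> test_functions S \<Longrightarrow> distr_laplacian (regular_distr S u) \<phi> = distr_dir_deriv av (dirac p) \<phi>"
    "u \<in> O[at_infinity](\<lambda>x. 1 / norm x)"
    using sol unfolding dipole_solution_def S_def p_def by blast+
  obtain c1 where c1: "\<And>x. x \<in> frontier (disk \<epsilon> 1) \<Longrightarrow> u x = c1"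
    using sol unfolding dipole_solution_def by blast
  obtain c2 where c2: "\<And>x. x \<in> frontier (disk \<epsilon> 2) \<Longrightarrow> u x = c2"
    using sol unfolding dipole_solution_def by blast
  obtain g where g: "\<And>x. x \<in> frontier (disk \<epsilon> 2) \<Longrightarrow> has_normal_derivative u (g x) x (inward_normal \<epsilon> 2 x)"
      "has_disk_boundary_integral g 0 \<epsilon> 2"
    using sol unfolding dipole_solution_def by blast
  obtain H where H: "H holomorphic_on bip_dom"
      "\<And>z. z \<in> bip_dom \<Longrightarrow> z \<noteq> pc \<Longrightarrow> pot z = a / (2 * of_real pi * (z - pc)) + H z"
    using pot_split by blast
  define G :: "complex \<Rightarrow> complex" where "G z = 2 * of_real foc / ((of_real foc)\<^sup>2 - z\<^sup>2)" for z
  define \<xi> where "\<xi> x = ln (cmod (bip (cx x)))" for x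
  \<comment> \<open>On the circles \<open>\<xi>\<close> takes the values \<open>hw\<close> and
    \<open>- hw\<close>, and \<open>Re pot\<close> the values \<open>K\<close> and
    \<open>- K\<close>, so half the difference and half the sum of the boundary constants determine
    \<open>\<kappa>\<close> and \<open>b\<close>.\<close>
  define \<kappa> where "\<kappa> = ((c2 - c1) / 2 - K) / hw"
  define b where "b = (c1 + c2) / 2"
  \<comment> \<open>\<open>d\<close> agrees with \<open>Re (pot (cx x))\<close> away from
    \<open>p\<close>, and its splitting gives access to local integrability at \<open>p\<close> and
    to the distributional Laplacian.\<close>
  define d where "d x = 1 * dipole_field av p x + 1 * Re (H (cx x))" for x
  define w where "w x = 1 * u x + (- 1) * d x" for x
  define h where "h x = 1 * w x + (- 1) * (\<kappa> * \<xi> x + b * 1)" for x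
  have d_eq: "d x = Re (pot (cx x))" if "x \<in> closure S" "x \<noteq> p" for x
    using that dipole_field_eq_Re[OF av, of x] H(2)[OF cd[OF that(1)]] cx_eq_pc[of x] by (simp add: d_def p_def)
  have h_eq: "h x = u x - Re (pot (cx x)) - \<kappa> * \<xi> x - b" if "x \<in> closure S" "x \<noteq> p" for x
    using d_eq[OF that] by (simp add: h_def w_def)
  have whH: "weakly_harmonic S (\<lambda>x. Re (H (cx x)))"
  proof (rule weakly_harmonicI[OF oU _ SU])
    show "deriv H holomorphic_on U" using H(1) Ud open_bip_dom by (meson holomorphic_deriv holomorphic_on_subset)
    show "((\<lambda>x. Re (H (cx x))) has_derivative (\<lambda>h. Re (deriv H (cx x) * cx h))) (at x)" if "x \<in> S" for x
      using that SU Ud by (intro Re_cx_has_derivative holomorphic_derivI[OF H(1) open_bip_dom]) auto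
  qed
  have whw: "weakly_harmonic S w"
    unfolding weakly_harmonic_def
  proof (intro conjI ballI)
    have ld: "locally_integrable_on (dipole_field av p) S" by (rule dipole_field_locally_integrable)
    have lH: "locally_integrable_on (\<lambda>x. Re (H (cx x))) S" using whH by (simp add: weakly_harmonic_def)
    have ldd: "locally_integrable_on d S" unfolding d_def[abs_def] by (rule locally_integrable_on_add[OF ld lH])
    show "locally_integrable_on w S" unfolding w_def[abs_def] by (rule locally_integrable_on_add[OF u(2) ldd])
    fix \<phi> assume phi: "\<phi> \<in> test_functions S \<inter> bumps"
    have "distr_laplacian (regular_distr S w) \<phi> =
        1 * distr_laplacian (regular_distr S u) \<phi> + (- 1) * distr_laplacian (regular_distr S d) \<phi>"
      unfolding w_def[abs_def] using phi by (intro regular_laplacian_linear u(2) ldd) auto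
    also have "distr_laplacian (regular_distr S d) \<phi> =
        1 * distr_laplacian (regular_distr S (dipole_field av p)) \<phi> + 1 * distr_laplacian (regular_distr S (\<lambda>x. Re (H (cx x)))) \<phi>"
      unfolding d_def[abs_def] using phi by (intro regular_laplacian_linear ld lH) auto
    also have "distr_laplacian (regular_distr S (\<lambda>x. Re (H (cx x)))) \<phi> = 0"
      using whH phi unfolding weakly_harmonic_def by blast
    also have "distr_laplacian (regular_distr S (dipole_field av p)) \<phi> = distr_dir_deriv av (dirac p) \<phi>"
      using phi by (intro dipole_field_laplacian) auto
    also have "distr_laplacian (regular_distr S u) \<phi> = distr_dir_deriv av (dirac p) \<phi>" using phi u(3) by auto
    finally show "distr_laplacian (regular_distr S w) \<phi> = 0" by simp
  qed
  have wh\<xi>: "weakly_harmonic S \<xi>"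
  proof (rule weakly_harmonicI[OF oU _ SU])
    show "G holomorphic_on U" unfolding G_def[abs_def] using foc_sq_minus_nonzero Ud by (intro holomorphic_intros) auto
    show "(\<xi> has_derivative (\<lambda>h. Re (G (cx x) * cx h))) (at x)" if "x \<in> S" for x
      unfolding \<xi>_def[abs_def] G_def using that SU Ud by (intro log_bip_derivative) auto
  qed
  have wh1: "weakly_harmonic S (\<lambda>_. 1)"
    by (rule weakly_harmonicI[OF oU _ SU, of "\<lambda>_. 0"]) auto
  have whh: "weakly_harmonic S h"
    unfolding h_def[abs_def] by (intro weakly_harmonic_linear whw wh\<xi> wh1)
  have contpot: "continuous_on (closure S - {p}) (\<lambda>x. Re (pot (cx x)))"
    by (intro continuous_intros continuous_on_compose2[OF holomorphic_on_imp_continuous_on[OF pot_holomorphic]])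
      (use cd cx_eq_pc in \<open>auto simp: p_def\<close>)
  have cont\<xi>: "continuous_on (closure S) \<xi>"
    using log_bip_derivative[OF cd] has_derivative_continuous unfolding \<xi>_def[abs_def]
    by (intro continuous_at_imp_continuous_on) blast
  have conth: "continuous_on (closure S - {p}) h"
  proof (rule continuous_on_eq)
    show "continuous_on (closure S - {p}) (\<lambda>x. u x - Re (pot (cx x)) - \<kappa> * \<xi> x - b)"
      by (intro continuous_intros u(1) contpot continuous_on_subset[OF cont\<xi>]) auto
  qed (simp add: h_eq)
  have circ: "h x = 0" if xj: "j \<in> {1, 2}" "dist x (disk_center \<epsilon> j) = 1" for x j
  proof -
    have dc: "dist (disk_center \<epsilon> 1) (disk_center \<epsilon> 2) \<le> dist x (disk_center \<epsilon> 1) + dist x (disk_center \<epsilon> 2)"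
      by (rule dist_triangle3)
    have cl: "x \<in> closure S"
      using that dc dist_disk_centers[OF eps] eps by (auto simp: S_def closure_exterior_domain[OF eps])
    have "x \<noteq> p" using that pS by (auto simp: S_def exterior_domain_eq)
    have bd: "1 \<le> cmod (cx x - of_real ctr)" "1 \<le> cmod (cx x + of_real ctr)"
      using cl by (auto simp: S_def closure_exterior_domain[OF eps] dist_centers_cx)
    have kh: "\<kappa> * hw = (c2 - c1) / 2 - K" using hw_pos by (simp add: \<kappa>_def)
    consider "dist x (disk_center \<epsilon> 1) = 1" | "dist x (disk_center \<epsilon> 2) = 1" using xj by auto
    thus ?thesis
    proof cases
      case 1
      hence "\<xi> x = - hw" "Re (pot (cx x)) = - K"
        using ln_bip_le(5)[OF bd] Re_pot_boundary(2)[OF bd] by (auto simp: \<xi>_def K_def dist_centers_cx)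
      moreover have "u x = c1" using 1 by (intro c1) (simp add: frontier_disk)
      ultimately show ?thesis using h_eq[OF cl \<open>x \<noteq> p\<close>] kh by (simp add: b_def) argo
    next
      case 2
      hence "\<xi> x = hw" "Re (pot (cx x)) = K"
        using ln_bip_le(4)[OF bd] Re_pot_boundary(1)[OF bd] by (auto simp: \<xi>_def K_def dist_centers_cx)
      moreover have "u x = c2" using 2 by (intro c2) (simp add: frontier_disk)
      ultimately show ?thesis using h_eq[OF cl \<open>x \<noteq> p\<close>] kh by (simp add: b_def) argo
    qed
  qed
  obtain R0 B where R0: "\<And>x. x \<in> S \<Longrightarrow> R0 \<le> norm x \<Longrightarrow> \<bar>h x\<bar> \<le> B"
  proof -
    obtain R1 B1 where B1: "\<And>z. R1 \<le> cmod z \<Longrightarrow> cmod (pot z) \<le> B1" using pot_bounded_at_infinity by blast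
    obtain cu where cu: "cu > 0" "\<forall>\<^sub>F x in at_infinity. norm (u x) \<le> cu * norm (1 / norm x)" using landau_o.bigE[OF u(4)] by blast
    then obtain R2 where R2: "\<And>x. R2 \<le> norm x \<Longrightarrow> norm (u x) \<le> cu * norm (1 / norm x)" by (auto simp: eventually_at_infinity)
    define R0 where "R0 = Max {R1, R2, 1, norm p + 1}"
    have m: "t \<le> R0" if "t \<in> {R1, R2, 1, norm p + 1}" for t unfolding R0_def using that by (intro Max_ge) auto
    show ?thesis
    proof (rule that[of R0 "cu + B1 + \<bar>\<kappa>\<bar> * hw + \<bar>b\<bar>"])
      fix x assume x: "x \<in> S" "R0 \<le> norm x"
      have xb: "R1 \<le> norm x" "R2 \<le> norm x" "1 \<le> norm x" "norm p < norm x"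
        using m[of R1] m[of R2] m[of 1] m[of "norm p + 1"] x(2) by auto
      have "1 / norm x \<le> 1 / 1" using xb(3) by (intro divide_left_mono) auto
      hence "cu * norm (1 / norm x) \<le> cu * 1" using cu(1) by (intro mult_left_mono) auto
      hence "\<bar>u x\<bar> \<le> cu" using R2[OF xb(2)] by simp
      moreover have "\<bar>Re (pot (cx x))\<bar> \<le> B1" using B1[of "cx x"] xb(1) abs_Re_le_cmod[of "pot (cx x)"] by (simp add: norm_cx)
      moreover have "\<bar>\<kappa> * \<xi> x\<bar> \<le> \<bar>\<kappa>\<bar> * hw"
      proof -
        have "1 \<le> cmod (cx x - of_real ctr)" "1 \<le> cmod (cx x + of_real ctr)"
          using x(1) by (auto simp: S_def exterior_domain_eq dist_centers_cx)
        hence "\<bar>\<xi> x\<bar> \<le> hw" using ln_bip_le(1,2)[of "cx x"] by (simp add: \<xi>_def abs_le_iff)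
        thus ?thesis unfolding abs_mult by (intro mult_left_mono) auto
      qed
      moreover have "h x = u x - Re (pot (cx x)) - \<kappa> * \<xi> x - b"
        by (rule h_eq) (use x(1) xb(4) closure_subset in auto)
      moreover have "\<bar>u x - Re (pot (cx x)) - \<kappa> * \<xi> x - b\<bar> \<le> \<bar>u x\<bar> + \<bar>Re (pot (cx x))\<bar> + \<bar>\<kappa> * \<xi> x\<bar> + \<bar>b\<bar>"
        by linarith
      ultimately show "\<bar>h x\<bar> \<le> cu + B1 + \<bar>\<kappa>\<bar> * hw + \<bar>b\<bar>" by linarith
    qed
  qed
  have h0: "h x = 0" if x: "x \<in> S" "x \<noteq> p" for x
  proof -
    have "h x \<le> 0"
      by (rule exterior_maximum_principle[OF eps whh[unfolded S_def] pS[unfolded S_def] conth[unfolded S_def], of R0 B])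
        (use circ R0 x in \<open>auto simp: S_def abs_le_iff\<close>)
    moreover have "- h x \<le> 0"
    proof (rule exterior_maximum_principle[OF eps _ pS[unfolded S_def], of "\<lambda>x. - h x" R0 B])
      show "weakly_harmonic (exterior_domain \<epsilon>) (\<lambda>x. - h x)"
        using weakly_harmonic_linear[OF whh whh, of "-1" 0] by (simp add: S_def)
      show "continuous_on (closure (exterior_domain \<epsilon>) - {p}) (\<lambda>x. - h x)"
        using conth by (auto simp: S_def intro: continuous_on_minus)
    qed (use circ R0 x in \<open>auto simp: S_def abs_le_iff\<close>)
    ultimately show ?thesis by linarith
  qed
  have u_eq: "u x = Re (pot (cx x)) + \<kappa> * \<xi> x + b" if "x \<in> closure S" "x \<noteq> p" for x
  proof -
    have "h x = 0"
    proof (cases "x \<in> S")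
      case False
      hence "dist x (disk_center \<epsilon> 1) = 1 \<or> dist x (disk_center \<epsilon> 2) = 1"
        using that(1)[unfolded S_def closure_exterior_domain[OF eps]] False[unfolded S_def exterior_domain_eq]
        by (auto simp: not_less)
      thus ?thesis using circ by blast
    qed (use h0 that in auto)
    thus ?thesis using h_eq[OF that] by linarith
  qed
  have g_eq: "g (disk_center \<epsilon> 2 + vector [cos \<theta>, sin \<theta>]) =
      - Re (deriv pot (of_real ctr + cis \<theta>) * cis \<theta>) + \<kappa> * (foc / (ctr + cos \<theta>))" for \<theta>
  proof -
    define x where "x = disk_center \<epsilon> 2 + (vector [cos \<theta>, sin \<theta>] :: real^2)"
    define \<nu> where "\<nu> = inward_normal \<epsilon> 2 x"
    have cv: "cx (vector [cos \<theta>, sin \<theta>]) = cis \<theta>" by (simp add: cx_def cis.ctr)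
    have cxx: "cx x = of_real ctr + cis \<theta>" unfolding x_def cx_add cx_disk_center cv ctr_def ..
    have nu: "\<nu> = - vector [cos \<theta>, sin \<theta>]" by (simp add: \<nu>_def inward_normal_def x_def)
    have cnu: "cx \<nu> = - cis \<theta>" using cx_scaleR[of "-1" "vector [cos \<theta>, sin \<theta>]"] unfolding nu by (simp add: cv)
    have dx: "dist x (disk_center \<epsilon> 2) = 1" unfolding dist_centers_cx cxx by simp
    have fr: "x \<in> frontier (disk \<epsilon> 2)" using dx by (simp add: frontier_disk)
    \<comment> \<open>For so short a step backwards along \<open>\<nu>\<close> the point stays
      outside the left disk, thanks to the gap \<open>\<epsilon>\<close>, and does not reach the
      emitter.\<close>
    define d0 where "d0 = min \<epsilon> (dist p (disk_center \<epsilon> 2) - 1)"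
    have d0: "d0 > 0" using eps pS by (auto simp: d0_def S_def exterior_domain_eq)
    have ray: "x + t *\<^sub>R \<nu> \<in> closure S \<and> x + t *\<^sub>R \<nu> \<noteq> p" if "t \<le> 0" "dist t 0 < d0" for t
    proof -
      have t: "- t < d0" using that by (simp add: dist_norm)
      have "x + t *\<^sub>R \<nu> - disk_center \<epsilon> 2 = (1 - t) *\<^sub>R vector [cos \<theta>, sin \<theta>]" by (simp add: x_def nu algebra_simps)
      moreover have "norm (vector [cos \<theta>, sin \<theta>] :: real^2) = 1" using norm_cx[of "vector [cos \<theta>, sin \<theta>]"] by (simp add: cv)
      ultimately have d2: "dist (x + t *\<^sub>R \<nu>) (disk_center \<epsilon> 2) = 1 - t" using that(1) by (simp add: dist_norm)
      have "dist (disk_center \<epsilon> 1) (disk_center \<epsilon> 2) \<le> dist (x + t *\<^sub>R \<nu>) (disk_center \<epsilon> 1) + dist (x + t *\<^sub>R \<nu>) (disk_center \<epsilon> 2)"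
        by (rule dist_triangle3)
      hence "dist (x + t *\<^sub>R \<nu>) (disk_center \<epsilon> 1) \<ge> 1" using d2 t dist_disk_centers[OF eps] by (simp add: d0_def)
      thus ?thesis using d2 that(1) t by (auto simp: S_def closure_exterior_domain[OF eps] d0_def)
    qed
    have xcl: "x \<in> closure S" "x \<noteq> p" using ray[of 0] d0 by auto
    define D where "D h = Re (deriv pot (cx x) * cx h) + \<kappa> * Re (G (cx x) * cx h)" for h
    have "((\<lambda>x. Re (pot (cx x)) + \<kappa> * \<xi> x + b) has_derivative (\<lambda>h. D h + 0)) (at x)"
      unfolding D_def \<xi>_def[abs_def] G_def
      using cd[OF xcl(1)] xcl(2) cx_eq_pc[of x]
      by (intro has_derivative_add has_derivative_mult_right has_derivative_const Re_cx_has_derivative log_bip_derivative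
          DERIV_deriv_iff_field_differentiable[THEN iffD2] pot_differentiable) (auto simp: p_def)
    from has_derivative_imp_line_derivative[OF this, of \<nu>]
    have "((\<lambda>t. Re (pot (cx (x + t *\<^sub>R \<nu>))) + \<kappa> * \<xi> (x + t *\<^sub>R \<nu>) + b) has_real_derivative D \<nu>) (at 0 within {..0})"
      by (simp add: has_field_derivative_at_within)
    hence "((\<lambda>t. u (x + t *\<^sub>R \<nu>)) has_real_derivative D \<nu>) (at 0 within {..0})"
      by (rule has_field_derivative_transform_within[OF _ d0]) (use ray u_eq in auto)
    \<comment> \<open>The normal derivative is one-sided; dropping the point \<open>0\<close> itself
      leaves a limit from the left, whose uniqueness identifies \<open>g x\<close> with the
      derivative of the explicit function.\<close>
    hence "((\<lambda>t. u (x + t *\<^sub>R \<nu>)) has_real_derivative D \<nu>) (at 0 within {..<0})"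
      by (rule has_field_derivative_subset) auto
    moreover have "((\<lambda>t. u (x + t *\<^sub>R \<nu>)) has_real_derivative g x) (at 0 within {..<0})"
      using g(1)[OF fr] unfolding has_normal_derivative_def \<nu>_def[symmetric] by (rule has_field_derivative_subset) auto
    ultimately have "g x = D \<nu>"
      unfolding has_field_derivative_iff using tendsto_unique[OF trivial_limit_at_left_real] by blast
    also have "\<dots> = - Re (deriv pot (of_real ctr + cis \<theta>) * cis \<theta>) + \<kappa> * (foc / (ctr + cos \<theta>))"
      using flux_kernel[of \<theta>] unfolding D_def cnu cxx G_def by simp
    finally show ?thesis by (simp add: x_def)
  qed
  have I: "((\<lambda>\<theta>. \<kappa> * (foc / (ctr + cos \<theta>))) has_integral 0) {0..2 * pi}"
    using has_integral_add[OF g(2)[unfolded has_disk_boundary_integral_def g_eq] has_disk_boundary_integral_pot] by simp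
  have "\<kappa> = 0"
  proof (rule ccontr)
    assume k0: "\<kappa> \<noteq> 0"
    have "((\<lambda>\<theta>. inverse \<kappa> * (\<kappa> * (foc / (ctr + cos \<theta>)))) has_integral inverse \<kappa> * 0) {0..2 * pi}"
      by (rule has_integral_mult_right[OF I])
    hence J: "((\<lambda>\<theta>. foc / (ctr + cos \<theta>)) has_integral 0) {0..2 * pi}" using k0 by (simp add: mult.assoc[symmetric])
    have C: "((\<lambda>_. foc / (ctr + 1)) has_integral (foc / (ctr + 1)) * (2 * pi - 0)) {0..2 * pi}"
      using has_integral_const_real[of "foc / (ctr + 1)" 0 "2 * pi"] by (simp add: mult.commute)
    \<comment> \<open>The integrand is bounded below by the positive constant
      \<open>foc / (ctr + 1)\<close>, so its integral cannot vanish.\<close>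
    have "(foc / (ctr + 1)) * (2 * pi - 0) \<le> 0"
    proof (rule has_integral_le[OF C J])
      fix \<theta> :: real
      have "ctr + cos \<theta> > 0" using ctr_pos cos_ge_minus_one[of \<theta>] by linarith
      thus "foc / (ctr + 1) \<le> foc / (ctr + cos \<theta>)" using foc_pos ctr_pos cos_le_one[of \<theta>] by (intro divide_left_mono mult_pos_pos) auto
    qed
    moreover have "(foc / (ctr + 1)) * (2 * pi - 0) > 0" using foc_pos ctr_pos by simp
    ultimately show False by linarith
  qed
  hence "\<forall>x\<in>exterior_domain \<epsilon> - {vector [0, q]}. u x = Re (pot (cx x)) + b"
    using u_eq closure_subset[of S] by (auto simp: S_def p_def)
  thus ?thesis by blast
qed

text \<open>Differentiability of \<open>u\<close> is a conclusion here, drawn from the explicit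
  formula. The gradient has the real and the negated imaginary part of \<open>D\<close> as
  components, hence the same modulus.\<close>

lemma solution_gradient:
  assumes sol: "dipole_solution \<epsilon> av (vector [0, q]) u" and av: "cx av = a"
    and x: "x \<in> exterior_domain \<epsilon>" "x \<noteq> vector [0, q]"
    and D: "(pot has_field_derivative D) (at (cx x))"
  shows "\<exists>grad. GDERIV u x :> grad \<and> norm grad = cmod D"
proof -
  obtain b where b: "\<And>x. x \<in> exterior_domain \<epsilon> - {vector [0, q]} \<Longrightarrow> u x = Re (pot (cx x)) + b"
    using solution_eq_pot[OF sol av] by blast
  define grad :: "real^2" where "grad = vector [Re D, - Im D]"
  have o: "open (exterior_domain \<epsilon> - {vector [0, q]})" using open_exterior_domain by (simp add: open_delete)
  have "((\<lambda>x. Re (pot (cx x)) + b) has_derivative (\<lambda>h. Re (D * cx h) + 0)) (at x)"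
    by (intro has_derivative_add has_derivative_const Re_cx_has_derivative D)
  hence "(u has_derivative (\<lambda>h. Re (D * cx h) + 0)) (at x)"
    by (rule has_derivative_transform_within_open[OF _ o]) (use x b in auto)
  moreover have "(\<lambda>h. Re (D * cx h) + 0) = (\<lambda>h. h \<bullet> grad)"
    by (rule ext) (simp add: grad_def cx_def inner_vec_def sum_2 algebra_simps)
  ultimately have "GDERIV u x :> grad" by (simp add: gderiv_def)
  moreover have "norm grad = cmod D" by (simp add: grad_def norm_vec_def L2_set_def sum_2 cmod_def)
  ultimately show ?thesis by blast
qed

end


section \<open>Pointwise estimates\<close>

text \<open>The angular distance kept between the emitter and the branch cut: the fraction is the
  value of \<open>Re (bip pc)\<close> at \<open>q = M * foc\<close>, the extreme position
  allowed.\<close>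

definition gap_angle :: "real \<Rightarrow> real" where
  "gap_angle M = pi - arccos ((1 - M\<^sup>2) / (1 + M\<^sup>2))"

text \<open>The constant of the lower bound in \<open>displacement\<close>: \<open>1 + M\<close>
  bounds the distance of the emitter from a focus, and \<open>2 + M\<close> appears once the other
  distance is compared with \<open>min t foc\<close>.\<close>

definition gap_const :: "real \<Rightarrow> real" where
  "gap_const M = 2 / ((1 + M) * (2 + M))"

lemma gap_angle_pos:
  assumes "M > 0"
  shows "gap_angle M > 0"
proof -
  have p: "1 + M\<^sup>2 > 0" by (simp add: add_pos_nonneg)
  have "- 1 < (1 - M\<^sup>2) / (1 + M\<^sup>2)" "(1 - M\<^sup>2) / (1 + M\<^sup>2) < 1"
    using p assms by (simp_all add: pos_less_divide_eq pos_divide_less_eq)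
  thus ?thesis using arccos_lt_bounded unfolding gap_angle_def by simp
qed

lemma gap_const_pos: "M > 0 \<Longrightarrow> gap_const M > 0"
  by (simp add: gap_const_def)

context two_disks
begin

lemma foc_bounds:
  assumes "\<epsilon> \<le> 1 / 4"
  shows "sqrt \<epsilon> \<le> foc" "foc \<le> 2 * sqrt \<epsilon>" "\<epsilon> \<le> foc\<^sup>2" "foc\<^sup>2 \<le> 2 * \<epsilon>" "foc \<le> 1" "\<epsilon> \<le> foc"
proof -
  have e2: "\<epsilon>\<^sup>2 \<le> \<epsilon>" using eps assms by (simp add: power2_eq_square mult_left_le)
  show 1: "\<epsilon> \<le> foc\<^sup>2" unfolding foc_sq by simp
  show 2: "foc\<^sup>2 \<le> 2 * \<epsilon>" unfolding foc_sq using e2 eps by argo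
  show 3: "sqrt \<epsilon> \<le> foc" using 1 foc_pos real_le_lsqrt by (simp add: real_sqrt_le_iff real_le_lsqrt)
  have "foc \<le> sqrt (4 * \<epsilon>)" using 2 eps by (intro real_le_rsqrt) simp
  thus "foc \<le> 2 * sqrt \<epsilon>" by (simp add: real_sqrt_mult)
  show "foc \<le> 1" using 2 assms foc_pos power2_le_imp_le[of foc 1] by simp
  have "sqrt \<epsilon> * sqrt \<epsilon> \<le> sqrt \<epsilon> * 1" using eps assms by (intro mult_left_mono) auto
  thus "\<epsilon> \<le> foc" using 3 eps by simp
qed

text \<open>Since \<open>sinh hw = foc\<close>, the inequalities
  \<open>hw \<le> sinh hw \<le> 2 * hw\<close> make \<open>kap\<close> comparable with
  \<open>1 / foc\<close>, hence of order \<open>1 / sqrt \<epsilon>\<close>.\<close>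

lemma kap_bounds:
  assumes "\<epsilon> \<le> 1 / 4"
  shows "pi / (4 * foc) \<le> kap" "kap \<le> pi / (2 * foc)"
proof -
  have 1: "hw \<le> foc" using sinh_real_ge_arg[of hw] hw_pos sinh_hw by simp
  have "foc\<^sup>2 \<le> (2 * hw)\<^sup>2"
  proof -
    have "\<bar>hw\<bar> \<le> 1" using hw_pos 1 foc_bounds(5)[OF assms] by linarith
    from sinh_squared_le[OF this] show ?thesis unfolding sinh_hw by (simp only: power_mult_distrib) simp
  qed
  hence 2: "foc \<le> 2 * hw" by (rule power2_le_imp_le) (use hw_pos in auto)
  show "pi / (4 * foc) \<le> kap" unfolding kap_def using 1 hw_pos foc_pos by (intro divide_left_mono) auto
  show "kap \<le> pi / (2 * foc)" unfolding kap_def using 2 hw_pos foc_pos by (intro divide_left_mono) auto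
qed

lemma lam_bounds:
  assumes "\<bar>q\<bar> \<le> M * foc"
  shows "1 / (pi * (1 + M\<^sup>2) * foc) \<le> lam" "lam \<le> 1 / (pi * foc)"
proof -
  have "q\<^sup>2 \<le> (M * foc)\<^sup>2" using assms by (metis abs_ge_zero power2_abs power_mono)
  hence q: "foc\<^sup>2 + q\<^sup>2 \<le> (1 + M\<^sup>2) * foc\<^sup>2" by (simp add: power_mult_distrib algebra_simps)
  have f2: "foc\<^sup>2 > 0" "1 + M\<^sup>2 > 0" using foc_pos by (auto simp: add_pos_nonneg)
  have p: "foc\<^sup>2 + q\<^sup>2 > 0" using f2 by (simp add: add_pos_nonneg)
  have "1 / (pi * (1 + M\<^sup>2) * foc) = foc / (pi * ((1 + M\<^sup>2) * foc\<^sup>2))" using foc_pos by (simp add: power2_eq_square)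
  also have "\<dots> \<le> lam" unfolding lam_def using q p foc_pos f2 by (intro divide_left_mono mult_left_mono mult_pos_pos) auto
  finally show "1 / (pi * (1 + M\<^sup>2) * foc) \<le> lam" .
  have "lam \<le> foc / (pi * foc\<^sup>2)" unfolding lam_def using foc_pos p by (intro divide_left_mono mult_left_mono mult_pos_pos) auto
  also have "\<dots> = 1 / (pi * foc)" using foc_pos by (simp add: power2_eq_square)
  finally show "lam \<le> 1 / (pi * foc)" .
qed

lemma tp_bound:
  assumes "\<bar>q\<bar> \<le> M * foc"
  shows "\<bar>tp\<bar> \<le> pi - gap_angle M"
proof -
  have f2: "foc\<^sup>2 > 0" "1 + M\<^sup>2 > 0" using foc_pos by (auto simp: add_pos_nonneg)
  have p: "foc\<^sup>2 + q\<^sup>2 > 0" using f2 by (simp add: add_pos_nonneg)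
  have "q\<^sup>2 \<le> (M * foc)\<^sup>2" using assms by (metis abs_ge_zero power2_abs power_mono)
  hence q: "q\<^sup>2 \<le> M\<^sup>2 * foc\<^sup>2" by (simp add: power_mult_distrib)
  have "bip pc = exp (\<i> * of_real tp)" using Ln_bip_pc exp_Ln[OF bip_pc_nonzero] by simp
  hence "cos tp = (foc\<^sup>2 - q\<^sup>2) / (foc\<^sup>2 + q\<^sup>2)" using bip_pc by (simp add: Re_exp complex_eq_iff)
  moreover have "(1 - M\<^sup>2) / (1 + M\<^sup>2) \<le> (foc\<^sup>2 - q\<^sup>2) / (foc\<^sup>2 + q\<^sup>2)"
  proof -
    have "(1 - M\<^sup>2) * (foc\<^sup>2 + q\<^sup>2) \<le> (foc\<^sup>2 - q\<^sup>2) * (1 + M\<^sup>2)" using q by (simp add: algebra_simps)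
    thus ?thesis using f2 p by (simp add: divide_le_eq le_divide_eq field_simps)
  qed
  ultimately have c: "(1 - M\<^sup>2) / (1 + M\<^sup>2) \<le> cos \<bar>tp\<bar>" by simp
  have lo: "- 1 \<le> (1 - M\<^sup>2) / (1 + M\<^sup>2)" using f2 by (simp add: le_divide_eq)
  have "arccos (cos \<bar>tp\<bar>) \<le> arccos ((1 - M\<^sup>2) / (1 + M\<^sup>2))"
    by (rule arccos_le_arccos[OF lo c]) simp
  moreover have "arccos (cos \<bar>tp\<bar>) = \<bar>tp\<bar>" using tp_less_pi by (intro arccos_cos) auto
  ultimately show ?thesis unfolding gap_angle_def by simp
qed

text \<open>Inside the disk of radius \<open>1 / 2\<close> only the neck between the circles is
  left, whose width is of order \<open>\<epsilon>\<close> plus the square of the height. The bound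
  makes the horizontal coordinate a minor part of \<open>foc^2 - z^2\<close>.\<close>

lemma gap_width:
  assumes e: "\<epsilon> \<le> 1 / 4" and z: "1 \<le> cmod (z - of_real ctr)" "1 \<le> cmod (z + of_real ctr)" "cmod z < 1 / 2"
  shows "(Re z)\<^sup>2 \<le> (foc\<^sup>2 + (Im z)\<^sup>2) / 4"
proof -
  define x y where "x = \<bar>Re z\<bar>" and "y = (Im z)\<^sup>2"
  have x: "0 \<le> x" "x \<le> 1 / 2" using abs_Re_le_cmod[of z] z by (auto simp: x_def)
  have "\<bar>Im z\<bar> \<le> 1 / 2" using abs_Im_le_cmod[of z] z by auto
  hence "(\<bar>Im z\<bar>)\<^sup>2 \<le> (1 / 2)\<^sup>2" by (intro power_mono) auto
  hence y: "0 \<le> y" "y \<le> 1 / 4" by (auto simp: y_def power_divide)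
  have "1 \<le> (cmod (z - of_real ctr))\<^sup>2" "1 \<le> (cmod (z + of_real ctr))\<^sup>2" using z by (auto simp: one_le_power)
  hence "1 \<le> (Re z - ctr)\<^sup>2 + y" "1 \<le> (Re z + ctr)\<^sup>2 + y" by (simp_all add: cmod_power2 y_def)
  hence c: "1 \<le> (ctr - x)\<^sup>2 + y" by (cases "Re z \<ge> 0") (simp_all add: x_def power2_eq_square algebra_simps)
  \<comment> \<open>The slope \<open>3 / 5\<close> instead of \<open>1 / 2\<close>, the slope of the
    circle at height zero in terms of \<open>y\<close>, absorbs the quadratic term for
    \<open>y \<le> 1 / 4\<close>, since \<open>6 / 5 - 9 / 100 > 1\<close>.\<close>
  have xb: "x \<le> \<epsilon> / 2 + 3 / 5 * y"
  proof (rule ccontr)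
    assume "\<not> x \<le> \<epsilon> / 2 + 3 / 5 * y"
    hence l: "ctr - x < 1 - 3 / 5 * y" by (simp add: ctr_def)
    have "0 \<le> ctr - x" using x ctr_pos by simp
    hence "(ctr - x)\<^sup>2 < (1 - 3 / 5 * y)\<^sup>2" using l by (intro power_strict_mono) auto
    also have "\<dots> = 1 - 6 / 5 * y + 9 / 25 * (y * y)" by (simp add: power2_eq_square algebra_simps)
    also have "9 / 25 * (y * y) \<le> 9 / 25 * (y * (1 / 4))" using y by (intro mult_left_mono) auto
    finally show False using c y by simp
  qed
  have "x\<^sup>2 \<le> (\<epsilon> / 2 + 3 / 5 * y)\<^sup>2" using xb x by (intro power_mono) auto
  also have "\<dots> \<le> 2 * (\<epsilon> / 2)\<^sup>2 + 2 * (3 / 5 * y)\<^sup>2"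
    using zero_le_power2[of "\<epsilon> / 2 - 3 / 5 * y"] by (simp add: power2_eq_square algebra_simps)
  also have "\<dots> = \<epsilon>\<^sup>2 / 2 + 18 / 25 * (y * y)" by (simp add: power2_eq_square)
  also have "\<dots> \<le> \<epsilon> / 8 + 18 / 25 * (y * (1 / 4))"
  proof -
    have "\<epsilon> * \<epsilon> \<le> \<epsilon> * (1 / 4)" using e eps by (intro mult_left_mono) auto
    moreover have "y * y \<le> y * (1 / 4)" using y by (intro mult_left_mono) auto
    ultimately show ?thesis unfolding power2_eq_square by simp
  qed
  also have "\<dots> \<le> (foc\<^sup>2 + y) / 4"
  proof -
    have "18 / 25 * (y * (1 / 4)) \<le> y / 4" using y by simp
    moreover have "\<epsilon> / 8 \<le> foc\<^sup>2 / 4" using foc_bounds(3)[OF e] eps by simp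
    moreover have "(foc\<^sup>2 + y) / 4 = foc\<^sup>2 / 4 + y / 4" by (rule add_divide_distrib)
    ultimately show ?thesis by linarith
  qed
  finally show ?thesis by (simp add: x_def y_def)
qed

text \<open>By \<open>gap_width\<close> the modulus of \<open>foc^2 - z^2\<close> is comparable with
  \<open>foc^2 + (Im z)^2\<close>. This is the origin of the weight
  \<open>1 / (\<epsilon> + (x $ 2)^2)\<close> in the far field.\<close>

lemma coord_speed_bounds:
  assumes e: "\<epsilon> \<le> 1 / 4" and z: "1 \<le> cmod (z - of_real ctr)" "1 \<le> cmod (z + of_real ctr)" "cmod z < 1 / 2"
  defines "Z \<equiv> cmod (2 * of_real foc / ((of_real foc)\<^sup>2 - z\<^sup>2))"
  shows "foc / (foc\<^sup>2 + (Im z)\<^sup>2) \<le> Z" "Z \<le> 4 * foc / (foc\<^sup>2 + (Im z)\<^sup>2)"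
proof -
  define N where "N = cmod ((of_real foc)\<^sup>2 - z\<^sup>2)"
  have ZN: "Z = 2 * foc / N" unfolding Z_def N_def using foc_pos by (simp add: norm_divide norm_mult)
  define s where "s = foc\<^sup>2 + (Im z)\<^sup>2"
  have s: "s > 0" using foc_pos by (simp add: s_def add_pos_nonneg)
  note g = gap_width[OF e z, folded s_def]
  have "Re ((of_real foc)\<^sup>2 - z\<^sup>2) = s - (Re z)\<^sup>2" by (simp add: s_def power2_eq_square)
  hence "s - (Re z)\<^sup>2 \<le> N" unfolding N_def by (metis complex_Re_le_cmod)
  hence lo: "s / 2 \<le> N" using g s by simp
  have "N \<le> cmod ((of_real foc)\<^sup>2) + cmod (z\<^sup>2)" unfolding N_def by (rule norm_triangle_ineq4)
  also have "\<dots> = s + (Re z)\<^sup>2" by (simp add: s_def norm_power cmod_power2)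
  finally have hi: "N \<le> 2 * s" using g s by simp
  have N0: "N > 0" using lo s by linarith
  have "foc / s = 2 * foc / (2 * s)" by simp
  also have "\<dots> \<le> Z" unfolding ZN using hi N0 foc_pos s by (intro divide_left_mono) auto
  finally show "foc / (foc\<^sup>2 + (Im z)\<^sup>2) \<le> Z" by (simp add: s_def)
  have "Z \<le> 2 * foc / (s / 2)" unfolding ZN using lo N0 foc_pos s by (intro divide_left_mono) auto
  thus "Z \<le> 4 * foc / (foc\<^sup>2 + (Im z)\<^sup>2)" by (simp add: s_def)
qed

text \<open>\<open>bip\<close> takes nonpositive real values only at real points of modulus at least
  \<open>foc\<close>, whereas on the real axis \<open>gap_width\<close> confines the neck to modulus
  at most \<open>foc / 2\<close>. The derivative formula off the cut is thus available wherever
  estimates are made.\<close>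

lemma bip_not_nonpos:
  assumes e: "\<epsilon> \<le> 1 / 4" and z: "1 \<le> cmod (z - of_real ctr)" "1 \<le> cmod (z + of_real ctr)" "cmod z < 1 / 2"
  shows "bip z \<notin> \<real>\<^sub>\<le>\<^sub>0"
proof
  assume b: "bip z \<in> \<real>\<^sub>\<le>\<^sub>0"
  define n where "n = (cmod (of_real foc - z))\<^sup>2"
  have n: "n > 0" using exterior_not_focus(1)[OF z(1)] by (simp add: n_def)
  have "bip z = (of_real foc + z) * cnj (of_real foc - z) / of_real n"
    unfolding bip_def n_def by (subst complex_div_cnj) simp
  hence "Im (bip z) = Im ((of_real foc + z) * cnj (of_real foc - z)) / n" "Re (bip z) = Re ((of_real foc + z) * cnj (of_real foc - z)) / n"
    by (simp_all only: Im_divide_of_real Re_divide_of_real)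
  hence "Im ((of_real foc + z) * cnj (of_real foc - z)) = 0" "Re ((of_real foc + z) * cnj (of_real foc - z)) \<le> 0"
    using b n by (auto simp: complex_nonpos_Reals_iff divide_le_0_iff)
  hence i: "2 * foc * Im z = 0" and r: "foc * foc \<le> Re z * Re z + Im z * Im z" by (auto simp: algebra_simps)
  have "Im z = 0" using i foc_pos by simp
  hence "foc\<^sup>2 \<le> foc\<^sup>2 / 4" using r gap_width[OF e z] by (simp add: power2_eq_square)
  thus False using foc_pos by simp
qed

text \<open>For this Moebius map the relative displacement is exactly \<open>2 foc (z - pc)\<close>
  over the product of \<open>foc - z\<close> and \<open>foc + pc\<close>. The denominator has order
  \<open>foc^2\<close> while \<open>t \<le> foc\<close>; for larger \<open>t\<close> its first
  factor may grow like \<open>t\<close> and the displacement saturates, hence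
  \<open>min t foc\<close>.\<close>

lemma displacement:
  assumes e: "\<epsilon> \<le> 1 / 4" and M: "M > 0" and qM: "\<bar>q\<bar> \<le> M * foc"
    and z: "1 \<le> cmod (z - of_real ctr)" "1 \<le> cmod (z + of_real ctr)"
  defines "v \<equiv> cmod (bip z / bip pc - 1)" and "t \<equiv> cmod (z - pc)"
  shows "v \<le> 4 * t / foc" "gap_const M * min t foc / foc \<le> v"
proof -
  have nf: "of_real foc - z \<noteq> 0" using exterior_not_focus(1)[OF z(1)] by simp
  have np: "of_real foc + pc \<noteq> 0" "of_real foc - pc \<noteq> 0" using pc_not_focus by (auto simp: add_eq_0_iff)
  define A where "A = cmod (of_real foc - z)"
  define P where "P = cmod (of_real foc + pc)"
  have "bip z / bip pc - 1 = 2 * of_real foc * (z - pc) / ((of_real foc - z) * (of_real foc + pc))"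
  proof -
    define X Y where "X = (of_real foc + z) * (of_real foc - pc)" and "Y = (of_real foc - z) * (of_real foc + pc)"
    have "Y \<noteq> 0" using nf np by (simp add: Y_def)
    have "bip z / bip pc = X / Y" by (simp add: bip_def X_def Y_def)
    hence "bip z / bip pc - 1 = (X - Y) / Y" using \<open>Y \<noteq> 0\<close> by (simp add: diff_divide_distrib)
    also have "X - Y = 2 * of_real foc * (z - pc)" by (simp add: X_def Y_def algebra_simps)
    finally show ?thesis by (simp add: Y_def)
  qed
  hence v: "v = 2 * foc * t / (A * P)" unfolding v_def t_def A_def P_def using foc_pos by (simp add: norm_divide norm_mult)
  have t0: "t \<ge> 0" by (simp add: t_def)
  have "cmod (z - of_real ctr) \<le> cmod (z - of_real foc) + cmod (of_real foc - of_real ctr)" using norm_triangle_ineq[of "z - of_real foc" "of_real foc - of_real ctr"] by simp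
  moreover have "cmod (of_real foc - of_real ctr) = ctr - foc"
    unfolding of_real_diff[symmetric] norm_of_real using foc_less_ctr by simp
  \<comment> \<open>The focus lies at distance \<open>ctr - foc\<close> from the centre of the unit
    disk, so an exterior point is at least \<open>foc - \<epsilon> / 2\<close> away from it.\<close>
  ultimately have "1 - ctr + foc \<le> A" using z(1) by (simp add: A_def norm_minus_commute)
  hence A1: "foc / 2 \<le> A" using foc_bounds(6)[OF e] by (simp add: ctr_def)
  have P1: "foc \<le> P" using complex_Re_le_cmod[of "of_real foc + pc"] by (simp add: P_def pc_def)
  have cp: "cmod pc \<le> M * foc" using qM by (simp add: pc_def complex_norm)
  have P2: "P \<le> (1 + M) * foc"
    using norm_triangle_ineq[of "of_real foc" pc] cp foc_pos by (simp add: P_def algebra_simps)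
  have A2: "A \<le> (1 + M) * foc + t"
  proof -
    have "A = cmod ((of_real foc - pc) - (z - pc))" by (simp add: A_def)
    also have "\<dots> \<le> cmod (of_real foc - pc) + t" unfolding t_def by (rule norm_triangle_ineq4)
    also have "cmod (of_real foc - pc) \<le> foc + cmod pc" using norm_triangle_ineq4[of "of_real foc" pc] foc_pos by simp
    finally show ?thesis using cp by (simp add: algebra_simps)
  qed
  have "foc / 2 * foc \<le> A * P" using A1 P1 foc_pos by (intro mult_mono) auto
  hence "2 * foc * t / (A * P) \<le> 2 * foc * t / (foc / 2 * foc)"
    using t0 foc_pos A1 P1 by (intro divide_left_mono mult_pos_pos) auto
  also have "\<dots> = 4 * t / foc" using foc_pos by simp
  finally show "v \<le> 4 * t / foc" unfolding v .
  define m where "m = min t foc"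
  have m: "0 \<le> m" "m \<le> t" "m \<le> foc" using t0 foc_pos by (auto simp: m_def)
  have AP: "A * P > 0" using A1 P1 foc_pos by (intro mult_pos_pos) auto
  have key: "m * ((1 + M) * foc + t) \<le> t * ((2 + M) * foc)"
  proof -
    have "m * ((1 + M) * foc) \<le> t * ((1 + M) * foc)" using m foc_pos M by (intro mult_right_mono) auto
    moreover have "m * t \<le> foc * t" using m t0 by (intro mult_right_mono) auto
    ultimately show ?thesis by (simp add: algebra_simps)
  qed
  have "A * P \<le> ((1 + M) * foc + t) * ((1 + M) * foc)"
    using A2 P2 foc_pos t0 M P1 by (intro mult_mono add_nonneg_nonneg mult_nonneg_nonneg) auto
  moreover have "gap_const M * m / foc \<ge> 0" using gap_const_pos[OF M] m(1) foc_pos by simp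
  ultimately have "gap_const M * m / foc * (A * P) \<le> gap_const M * m / foc * (((1 + M) * foc + t) * ((1 + M) * foc))"
    by (rule mult_left_mono)
  also have "\<dots> = gap_const M * (1 + M) * (m * ((1 + M) * foc + t))" using foc_pos by simp
  also have "\<dots> \<le> gap_const M * (1 + M) * (t * ((2 + M) * foc))"
    using key M gap_const_pos[OF M] by (intro mult_left_mono) auto
  also have "\<dots> = gap_const M * (1 + M) * (2 + M) * (foc * t)" by (simp only: ac_simps)
  also have "gap_const M * (1 + M) * (2 + M) = 2"
  proof -
    have "(1 + M) * (2 + M) \<noteq> 0" using M by simp
    thus ?thesis unfolding gap_const_def mult.assoc by (rule nonzero_eq_divide_eq[THEN iffD1, OF _ refl])
  qed
  also have "2 * (foc * t) = 2 * foc * t" by simp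
  finally have "gap_const M * m / foc \<le> 2 * foc * t / (A * P)" using AP by (simp add: pos_le_divide_eq)
  thus "gap_const M * min t foc / foc \<le> v" unfolding v m_def .
qed

text \<open>Here \<open>v = exp \<delta> - 1\<close>, bounded by the mean value inequality in a half
  plane where the exponential has modulus at most \<open>exp hw \<le> 2\<close>. The converse has to
  exclude a jump of the logarithm by a full turn; the angular gap between emitter and cut does so
  for small \<open>v\<close>.\<close>

lemma log_displacement:
  assumes e: "\<epsilon> \<le> 1 / 4" and qM: "\<bar>q\<bar> \<le> M * foc"
    and z: "1 \<le> cmod (z - of_real ctr)" "1 \<le> cmod (z + of_real ctr)"
  defines "v \<equiv> bip z / bip pc - 1" and "\<delta> \<equiv> Ln (bip z) - \<i> * of_real tp"
  shows "cmod v \<le> 2 * cmod \<delta>" "\<bar>Re \<delta>\<bar> \<le> hw" "\<bar>Im \<delta>\<bar> \<le> 2 * pi - gap_angle M"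
    "cmod v < 1 / 2 \<Longrightarrow> 2 * cmod v < gap_angle M \<Longrightarrow> cmod \<delta> \<le> 2 * cmod v"
proof -
  note b = ln_bip_le(1-3)[OF z]
  have ed: "exp \<delta> = 1 + v"
    unfolding \<delta>_def v_def exp_diff Ln_bip_pc[symmetric] using b(3) bip_pc_nonzero by simp
  show re: "\<bar>Re \<delta>\<bar> \<le> hw" using b by (simp add: \<delta>_def abs_le_iff)
  show im: "\<bar>Im \<delta>\<bar> \<le> 2 * pi - gap_angle M"
    using tp_bound[OF qM] Im_Ln_le_pi[OF b(3)] mpi_less_Im_Ln[OF b(3)] by (simp add: \<delta>_def abs_le_iff)
  have "exp hw \<le> 2"
    unfolding exp_hw
  proof -
    have "foc\<^sup>2 \<le> (3 / 4)\<^sup>2"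
    proof -
      have "\<epsilon> * \<epsilon> \<le> \<epsilon> * (1 / 4)" using e eps by (intro mult_left_mono) auto
      moreover have "foc\<^sup>2 = \<epsilon> + \<epsilon> * \<epsilon> / 4" using foc_sq by (simp add: power2_eq_square)
      moreover have "(3 / 4)\<^sup>2 = (9 / 16 :: real)" by (simp add: power2_eq_square)
      ultimately show ?thesis using e by linarith
    qed
    hence "foc \<le> 3 / 4" by (rule power2_le_imp_le) simp
    thus "ctr + foc \<le> 2" using e by (simp add: ctr_def)
  qed
  moreover have "cmod (exp \<delta> - exp 0) \<le> exp hw * cmod (\<delta> - 0)"
  proof (rule field_differentiable_bound[of "{u. Re u \<le> hw}"])
    show "convex {u. Re u \<le> hw}" by (rule convex_halfspace_Re_le)
    show "(exp has_field_derivative exp u) (at u within {u. Re u \<le> hw})" for u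
      by (rule has_field_derivative_at_within[OF DERIV_exp])
  qed (use re hw_pos in auto)
  ultimately show "cmod v \<le> 2 * cmod \<delta>" using ed mult_right_mono[of "exp hw" 2 "cmod \<delta>"] by simp
  assume v: "cmod v < 1 / 2" "2 * cmod v < gap_angle M"
  have nL: "cmod (Ln (1 + v)) \<le> 2 * cmod v" using norm_Ln_le[OF v(1)] .
  have v1: "1 + v \<noteq> 0"
  proof
    assume "1 + v = 0"
    hence "v = - 1" by (simp add: add_eq_0_iff)
    thus False using v(1) by simp
  qed
  have "exp \<delta> = exp (Ln (1 + v))" using ed v1 by simp
  then obtain n :: int where n: "\<delta> = Ln (1 + v) + (of_int (2 * n) * pi) * \<i>" unfolding exp_eq by auto
  have "\<bar>Im (Ln (1 + v))\<bar> \<le> 2 * cmod v" using abs_Im_le_cmod[of "Ln (1 + v)"] nL by linarith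
  moreover have "Im \<delta> = Im (Ln (1 + v)) + 2 * real_of_int n * pi" using n by simp
  ultimately have "\<bar>2 * real_of_int n * pi\<bar> < 2 * pi" using im v(2) by linarith
  hence "\<bar>real_of_int n\<bar> < 1" by (simp add: abs_mult)
  hence "n = 0" by linarith
  thus "cmod \<delta> \<le> 2 * cmod v" using n nL by simp
qed

end


section \<open>The three regimes\<close>

context two_disks
begin

text \<open>The derivative of \<open>pot\<close> has modulus
  \<open>lam * kap^2 * cmod Q * Z\<close>, where \<open>Q\<close> consists of the dipole
  \<open>S\<close>, the images \<open>T\<close> and the constant from the linear term. Near the
  emitter \<open>S\<close> dominates; far away \<open>S\<close> is exponentially small and the
  constant wins over \<open>T\<close>; in between the upper bounds are added. The hypotheses
  \<open>s1\<close> to \<open>s4\<close> are the smallness that these comparisons consume: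
  \<open>s1\<close> gives the image poles a clearance of at least one, \<open>s2\<close> bounds
  \<open>T\<close> and \<open>s3\<close> the distant \<open>S\<close> against the constant, and
  \<open>s4\<close> places the outer threshold below \<open>foc\<close>.\<close>

lemma gradient_estimates:
  fixes M :: real and z :: complex
  defines "g \<equiv> gap_const M" and "th \<equiv> gap_angle M" and "t \<equiv> cmod (z - pc)"
  assumes M: "M > 0" and qM: "\<bar>q\<bar> \<le> M * foc" and a1: "Re a \<noteq> 0"
    and e: "\<epsilon> \<le> 1 / 256" and s1: "4 * foc \<le> th" and s2: "1000 * foc \<le> \<bar>Re a\<bar> * th\<^sup>2"
    and s3: "1200 * sqrt \<epsilon> \<le> \<bar>Re a\<bar>" and s4: "6 / g * (sqrt \<epsilon> * \<bar>ln \<epsilon>\<bar>) \<le> 1"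
    and z: "1 \<le> cmod (z - of_real ctr)" "1 \<le> cmod (z + of_real ctr)" "cmod z < 1 / 2" and zp: "z \<noteq> pc"
  shows "\<exists>D. (pot has_field_derivative D) (at z) \<and>
    (t \<le> \<epsilon> / 130 \<longrightarrow> cmod D \<le> 24 / g\<^sup>2 * (1 / t\<^sup>2) \<and>
       1 / t\<^sup>2 \<le> 2048 * (1 + M\<^sup>2) * (1 + (M + 1)\<^sup>2) * cmod D) \<and>
    (6 / g * \<epsilon> * \<bar>ln \<epsilon>\<bar> \<le> t \<longrightarrow> cmod D \<le> 2 * (1 / (sqrt \<epsilon> * (\<epsilon> + (Im z)\<^sup>2))) \<and>
       1 / (sqrt \<epsilon> * (\<epsilon> + (Im z)\<^sup>2)) \<le> 64 * (1 + M\<^sup>2) / \<bar>Re a\<bar> * cmod D) \<and>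
    (t < 6 / g * \<epsilon> * \<bar>ln \<epsilon>\<bar> \<longrightarrow>
       cmod D \<le> 576 / g\<^sup>2 * (1 / t\<^sup>2 * exp (- (g / 6) * (t / \<epsilon>))) + 2 * \<epsilon> powr (- 3 / 2))"
proof -
  have e4: "\<epsilon> \<le> 1 / 4" using e by simp
  note fb = foc_bounds[OF e4] and kb = kap_bounds[OF e4] and lb = lam_bounds[OF qM]
  have g0: "g > 0" unfolding g_def by (rule gap_const_pos[OF M])
  have th0: "th > 0" unfolding th_def by (rule gap_angle_pos[OF M])
  have t0: "t > 0" using zp by (simp add: t_def)
  have ra: "0 < \<bar>Re a\<bar>" "\<bar>Re a\<bar> \<le> 1" using a1 abs_Re_le_cmod[of a] norm_a by auto
  have pi3: "pi > 3" "pi < 4" using pi_gt3 pi_less_4 by auto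
  have sq: "sqrt \<epsilon> > 0" using eps by simp
  have "sqrt \<epsilon> \<le> sqrt ((1 / 16)\<^sup>2)" using e by (intro real_sqrt_le_mono) (simp add: power2_eq_square)
  hence "sqrt \<epsilon> \<le> 1 / 16" by simp
  hence foc8: "foc \<le> 1 / 8" using fb(2) by linarith
  have f2: "foc\<^sup>2 > 0" using foc_pos by simp
  have kf: "3 / 4 \<le> kap * foc" "kap * foc \<le> 2" "kap * foc * 2 \<le> pi"
  proof -
    have "pi / (4 * foc) * foc \<le> kap * foc" by (rule mult_right_mono) (use kb foc_pos in auto)
    moreover have "kap * foc \<le> pi / (2 * foc) * foc" by (rule mult_right_mono) (use kb foc_pos in auto)
    ultimately have "pi / 4 \<le> kap * foc" "kap * foc \<le> pi / 2" using foc_pos by simp_all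
    thus "3 / 4 \<le> kap * foc" "kap * foc \<le> 2" "kap * foc * 2 \<le> pi" using pi3 by linarith+
  qed
  have kap6: "kap \<ge> 6"
  proof -
    have "kap * foc \<le> kap * (1 / 8)" using foc8 kap_pos by (intro mult_left_mono) auto
    thus ?thesis using kf(1) by linarith
  qed
  define \<delta> where "\<delta> = Ln (bip z) - \<i> * of_real tp"
  define w where "w = strip_coord (bip z)"
  define v where "v = cmod (bip z / bip pc - 1)"
  define y where "y = (Im z)\<^sup>2"
  define Z where "Z = cmod (2 * of_real foc / ((of_real foc)\<^sup>2 - z\<^sup>2))"
  have y0: "y \<ge> 0" by (simp add: y_def)
  have dom: "z \<in> bip_dom" by (rule exterior_in_dom[OF z(1,2)])
  have w\<delta>: "w = of_real kap * \<delta>" by (simp add: w_def strip_coord_def \<delta>_def)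
  have cw: "cmod w = kap * cmod \<delta>" unfolding w\<delta> norm_mult using kap_pos by simp
  note Zb = coord_speed_bounds[OF e4 z, folded Z_def y_def]
  note vb = displacement[OF e4 M qM z(1,2), folded v_def t_def g_def]
  note lb' = log_displacement[OF e4 qM z(1,2), folded v_def \<delta>_def th_def]
  have rew: "\<bar>Re w\<bar> \<le> pi / 4"
  proof -
    have "\<bar>Re w\<bar> = kap * \<bar>Re \<delta>\<bar>" unfolding w\<delta> using kap_pos by (simp add: abs_mult)
    also have "\<dots> \<le> kap * hw" using lb'(2) kap_pos by (intro mult_left_mono) auto
    also have "\<dots> = pi / 4" using hw_pos by (simp add: kap_def)
    finally show ?thesis .
  qed
  have imw: "\<bar>Im w\<bar> \<le> per - kap * th"
  proof -
    have "\<bar>Im w\<bar> = kap * \<bar>Im \<delta>\<bar>" unfolding w\<delta> using kap_pos by (simp add: abs_mult)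
    also have "\<dots> \<le> kap * (2 * pi - th)" using lb'(3) kap_pos by (intro mult_left_mono) auto
    finally show ?thesis by (simp add: per_def algebra_simps)
  qed
  have w0: "w \<noteq> 0" unfolding w_def using strip_coord_eq_0[OF bip_nonzero[OF dom]] bip_inj dom zp by (auto simp: bip_dom_def)
  hence cw0: "cmod w > 0" and c\<delta>0: "cmod \<delta> > 0" using w\<delta> by (simp, auto)
  define S where "S = strip_dipole_deriv a w"
  define T where "T = strip_tail_deriv a per w"
  define Q where "Q = strip_potential_deriv a per w"
  have QST: "Q = S + T - of_real (4 * Re a / per)" by (simp add: Q_def S_def T_def strip_potential_deriv_def)
  define D where "D = - of_real (lam * kap\<^sup>2) * Q * (2 * of_real foc / ((of_real foc)\<^sup>2 - z\<^sup>2))"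
  have hasD: "(pot has_field_derivative D) (at z)"
    unfolding D_def Q_def w_def by (rule pot_has_derivative[OF dom zp bip_not_nonpos[OF e4 z]])
  have nD: "cmod D = lam * kap\<^sup>2 * cmod Q * Z"
    unfolding D_def Z_def norm_mult norm_minus_cancel norm_of_real using lam_pos by (simp add: abs_mult)
  have kth: "kap * th \<ge> 1"
  proof -
    have "kap * (4 * foc) \<le> kap * th" using s1 kap_pos by (intro mult_left_mono) auto
    thus ?thesis using kf(1) by linarith
  qed
  \<comment> \<open>Multiplied by \<open>kap\<close>, the images stay below a tenth of
    \<open>\<bar>Re a\<bar>\<close>, while \<open>kc2\<close> puts the constant of the linear term
    between one half and two thirds of \<open>\<bar>Re a\<bar>\<close>.\<close>
  have kT: "kap * cmod T \<le> \<bar>Re a\<bar> / 10"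
  proof -
    have "cmod T \<le> 64 / (kap * th)\<^sup>2"
      unfolding T_def using strip_tail_deriv_bound[OF per_pos _ imw kth, of a] rew norm_a pi_gt_zero by simp
    hence "kap * cmod T \<le> kap * (64 / (kap * th)\<^sup>2)" using kap_pos by (intro mult_left_mono) auto
    also have "\<dots> = 64 / (kap * th\<^sup>2)" using kap_pos by (simp add: power2_eq_square)
    also have "\<dots> \<le> \<bar>Re a\<bar> / 10"
    proof -
      have "kap * (1000 * foc) \<le> kap * (\<bar>Re a\<bar> * th\<^sup>2)" using s2 kap_pos by (intro mult_left_mono) auto
      hence "640 \<le> \<bar>Re a\<bar> * (kap * th\<^sup>2)" using kf(1) by (simp add: mult_ac)
      thus ?thesis using kap_pos th0 by (simp add: divide_le_eq)
    qed
    finally show ?thesis .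
  qed
  have T1: "cmod T \<le> 1"
  proof -
    have "1 * cmod T \<le> kap * cmod T" using kap6 by (intro mult_right_mono) auto
    thus ?thesis using kT ra by linarith
  qed
  define c0 where "c0 = cmod (of_real (4 * Re a / per) :: complex)"
  have kc: "kap * c0 = 2 * \<bar>Re a\<bar> / pi"
    unfolding c0_def norm_of_real abs_divide using per_pos kap_pos by (simp add: per_def abs_mult)
  have kc2: "\<bar>Re a\<bar> / 2 \<le> kap * c0" "kap * c0 \<le> 2 * \<bar>Re a\<bar> / 3"
    unfolding kc using pi3 ra by (auto simp: field_simps)
  have c1: "c0 \<le> 1"
  proof -
    have "c0 \<ge> 0" by (simp add: c0_def)
    hence "1 * c0 \<le> kap * c0" using kap6 by (intro mult_right_mono) auto
    thus ?thesis using kc2 ra by linarith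
  qed
  define m where "m = min t foc"
  have m0: "m > 0" using t0 foc_pos by (simp add: m_def)
  have \<delta>low: "g * m / (2 * foc) \<le> cmod \<delta>"
  proof -
    have "g * m / foc \<le> 2 * cmod \<delta>" using vb(2) lb'(1) unfolding m_def by linarith
    thus ?thesis by simp
  qed
  \<comment> \<open>Distance turns into strip distance: \<open>kap\<close> and the bound for
    \<open>\<delta>\<close> each contribute a factor \<open>1 / foc\<close>. The constant
    \<open>1 / 3\<close> is \<open>3 / 4\<close> from \<open>kf\<close> times \<open>1 / 2\<close>,
    rounded down.\<close>
  have wlow: "g / 3 * (m / foc\<^sup>2) \<le> cmod w"
  proof -
    have "g / 3 * (m / foc\<^sup>2) \<le> (kap * foc) * (g * m / (2 * foc\<^sup>2))"
    proof -
      have p: "g * m / (2 * foc\<^sup>2) \<ge> 0" using g0 m0 by simp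
      have "g / 3 * (m / foc\<^sup>2) = 2 / 3 * (g * m / (2 * foc\<^sup>2))" by simp
      also have "\<dots> \<le> (kap * foc) * (g * m / (2 * foc\<^sup>2))" using kf(1) p by (intro mult_right_mono) auto
      finally show ?thesis .
    qed
    also have "\<dots> = kap * (g * m / (2 * foc))" using foc_pos by (simp add: power2_eq_square)
    also have "\<dots> \<le> cmod w" unfolding cw using \<delta>low kap_pos by (intro mult_left_mono) auto
    finally show ?thesis .
  qed
  have lam3: "lam * foc \<le> 1 / 3"
  proof -
    have "lam * foc \<le> 1 / (pi * foc) * foc" using lb(2) foc_pos by (intro mult_right_mono) auto
    also have "\<dots> = 1 / pi" using foc_pos by simp
    also have "\<dots> \<le> 1 / 3" using pi3 by (intro divide_left_mono) auto
    finally show ?thesis .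
  qed
  have fy: "foc\<^sup>2 + y > 0" using f2 y0 by linarith
  have Z0: "Z \<ge> 0" by (simp add: Z_def)
  have Zf: "Z * foc \<le> 4"
  proof -
    have "Z * foc \<le> 4 * foc / (foc\<^sup>2 + y) * foc" using Zb(2) foc_pos by (intro mult_right_mono) auto
    also have "\<dots> \<le> 4 * foc / foc\<^sup>2 * foc" using y0 f2 foc_pos fy by (intro mult_right_mono divide_left_mono mult_pos_pos) auto
    also have "\<dots> = 4" using foc_pos by (simp add: power2_eq_square)
    finally show ?thesis .
  qed
  have lamZ: "lam * Z * foc\<^sup>2 \<le> 2"
  proof -
    have "(lam * foc) * (Z * foc) \<le> 1 / 3 * 4" using lam3 Zf lam_pos foc_pos Z0 by (intro mult_mono) auto
    thus ?thesis by (simp add: power2_eq_square mult_ac)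
  qed
  \<comment> \<open>\<open>kap\<close> drops out because
    \<open>cmod w = kap * cmod \<delta>\<close>; the size of the near field is governed by
    \<open>\<delta>\<close> alone.\<close>
  have kk: "kap\<^sup>2 * (X / (cmod w)\<^sup>2) = X / (cmod \<delta>)\<^sup>2" for X
    unfolding cw power_mult_distrib using kap_pos by simp
  have lamZ\<delta>: "lam * Z / (cmod \<delta>)\<^sup>2 \<le> 8 / (g\<^sup>2 * m\<^sup>2)"
  proof -
    have p: "0 < g * m / (2 * foc)" using g0 m0 foc_pos by simp
    have "(g * m / (2 * foc))\<^sup>2 \<le> (cmod \<delta>)\<^sup>2" using \<delta>low p by (intro power_mono) auto
    hence "lam * Z / (cmod \<delta>)\<^sup>2 \<le> lam * Z / (g * m / (2 * foc))\<^sup>2"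
      using lam_pos Z0 p c\<delta>0 by (intro divide_left_mono mult_pos_pos) (auto simp: zero_less_power)
    also have "\<dots> = 4 * (lam * Z * foc\<^sup>2) / (g\<^sup>2 * m\<^sup>2)" by (simp add: power_divide power_mult_distrib)
    also have "\<dots> \<le> 4 * 2 / (g\<^sup>2 * m\<^sup>2)" using lamZ by (intro divide_right_mono mult_left_mono) simp_all
    finally show ?thesis by simp
  qed
  have lkZ: "lam * kap * Z \<le> 2 / (foc * (foc\<^sup>2 + y))"
  proof -
    have "(lam * foc) * (kap * foc) \<le> 1 / pi * (pi / 2)"
    proof (rule mult_mono)
      have "lam * foc \<le> 1 / (pi * foc) * foc" using lb(2) foc_pos by (intro mult_right_mono) auto
      thus "lam * foc \<le> 1 / pi" using foc_pos by simp
    qed (use kf lam_pos kap_pos foc_pos in auto)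
    hence lk: "lam * kap * foc\<^sup>2 \<le> 1 / 2" by (simp add: power2_eq_square mult_ac)
    have "lam * kap * Z \<le> lam * kap * (4 * foc / (foc\<^sup>2 + y))" using Zb(2) lam_pos kap_pos by (intro mult_left_mono) auto
    also have "\<dots> = (lam * kap * foc\<^sup>2) * (4 / (foc * (foc\<^sup>2 + y)))" using foc_pos by (simp add: power2_eq_square)
    also have "\<dots> \<le> 1 / 2 * (4 / (foc * (foc\<^sup>2 + y)))" using lk foc_pos fy by (intro mult_right_mono) auto
    finally show ?thesis by simp
  qed
  \<comment> \<open>Below the outer threshold this gives \<open>t \<le> foc\<close>, so
    \<open>min t foc\<close> is \<open>t\<close>; beyond it, \<open>min t foc\<close> is at least
    the threshold.\<close>
  have C2: "6 / g * \<epsilon> * \<bar>ln \<epsilon>\<bar> \<le> foc"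
  proof -
    have "6 / g * \<epsilon> * \<bar>ln \<epsilon>\<bar> = 6 / g * (sqrt \<epsilon> * \<bar>ln \<epsilon>\<bar>) * sqrt \<epsilon>" using eps by simp
    also have "\<dots> \<le> 1 * sqrt \<epsilon>" using s4 sq by (intro mult_right_mono) auto
    finally show ?thesis using fb(1) by linarith
  qed
  have cD: "cmod D = lam * kap * Z * (kap * cmod Q)" unfolding nD by (simp add: power2_eq_square mult_ac)
  have Qle: "cmod Q \<le> cmod S + cmod T + c0" unfolding QST c0_def
    using norm_triangle_ineq4[of "S + T" "of_real (4 * Re a / per)"] norm_triangle_ineq[of S T] by linarith
  have i: "cmod D \<le> 24 / g\<^sup>2 * (1 / t\<^sup>2) \<and> 1 / t\<^sup>2 \<le> 2048 * (1 + M\<^sup>2) * (1 + (M + 1)\<^sup>2) * cmod D"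
    if t: "t \<le> \<epsilon> / 130"
  proof -
    have tf: "t \<le> foc\<^sup>2 / 130" "t \<le> foc" using t fb by auto
    hence mt: "m = t" by (simp add: m_def)
    have "4 * t / foc \<le> 4 * (foc\<^sup>2 / 130) / foc" using tf foc_pos by (intro divide_right_mono mult_left_mono) auto
    also have "\<dots> = 4 / 130 * foc" using foc_pos by (simp add: power2_eq_square)
    finally have vs: "v \<le> 4 / 130 * foc" using vb(1) by linarith
    have "cmod \<delta> \<le> 2 * v" by (rule lb'(4)) (use vs foc8 s1 foc_pos in linarith)+
    hence \<delta>up: "cmod \<delta> \<le> 8 * t / foc" using vb(1) by simp
    \<comment> \<open>The radius \<open>\<epsilon> / 130\<close> is small enough for
      \<open>16 / 130 < 1 / 8\<close>; then \<open>1 / (cmod w)^2 \<ge> 64\<close> outweighs the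
      bounded contributions of the cosine, the images and the linear term.\<close>
    have wup: "cmod w \<le> 1 / 8"
    proof -
      have "cmod w \<le> kap * (8 * t / foc)" unfolding cw using \<delta>up kap_pos by (intro mult_left_mono) auto
      also have "\<dots> = (kap * foc) * (8 * t / foc\<^sup>2)" using foc_pos by (simp add: power2_eq_square)
      also have "\<dots> \<le> 2 * (8 * (foc\<^sup>2 / 130) / foc\<^sup>2)"
        using kf(2) tf t0 f2 kap_pos foc_pos by (intro mult_mono divide_right_mono mult_left_mono) auto
      also have "\<dots> = 16 / 130" using f2 by simp
      finally show ?thesis by simp
    qed
    have "(cmod w)\<^sup>2 \<le> (1 / 8)\<^sup>2" using wup by (intro power_mono) auto
    hence "1 / (1 / 8)\<^sup>2 \<le> 1 / (cmod w)\<^sup>2" using cw0 by (intro divide_left_mono) auto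
    hence w64: "64 \<le> 1 / (cmod w)\<^sup>2" by (simp add: power_divide)
    have Sn: "1 / (4 * (cmod w)\<^sup>2) - 2 \<le> cmod S" "cmod S \<le> 2 / (cmod w)\<^sup>2 + 2"
      unfolding S_def by (rule strip_dipole_deriv_near; use wup w0 norm_a in simp)+
    have h1: "1 / (4 * (cmod w)\<^sup>2) = 1 / 4 * (1 / (cmod w)\<^sup>2)" "2 / (cmod w)\<^sup>2 = 2 * (1 / (cmod w)\<^sup>2)"
      "3 / (cmod w)\<^sup>2 = 3 * (1 / (cmod w)\<^sup>2)" "(1 / 8) / (cmod w)\<^sup>2 = 1 / 8 * (1 / (cmod w)\<^sup>2)" by simp_all
    have Qup: "cmod Q \<le> 3 / (cmod w)\<^sup>2" using Qle Sn(2) T1 c1 w64 unfolding h1 by linarith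
    have Qlo: "(1 / 8) / (cmod w)\<^sup>2 \<le> cmod Q"
    proof -
      have "cmod S \<le> cmod Q + cmod T + c0"
        using norm_triangle_ineq4[of "Q + of_real (4 * Re a / per)" T] norm_triangle_ineq[of Q "of_real (4 * Re a / per)"]
        unfolding QST c0_def by simp
      thus ?thesis using Sn(1) T1 c1 w64 unfolding h1 by linarith
    qed
    have up: "cmod D \<le> 24 / g\<^sup>2 * (1 / t\<^sup>2)"
    proof -
      have "cmod D = lam * Z * (kap\<^sup>2 * cmod Q)" unfolding nD by (simp add: mult_ac)
      also have "\<dots> \<le> lam * Z * (kap\<^sup>2 * (3 / (cmod w)\<^sup>2))" using Qup lam_pos Z0 by (intro mult_left_mono mult_nonneg_nonneg) auto
      also have "\<dots> = 3 * (lam * Z / (cmod \<delta>)\<^sup>2)" unfolding kk by simp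
      also have "\<dots> \<le> 3 * (8 / (g\<^sup>2 * m\<^sup>2))" using lamZ\<delta> by (intro mult_left_mono) auto
      finally show ?thesis unfolding mt by simp
    qed
    \<comment> \<open>The constant is \<open>4 * 8 * 64\<close>: \<open>4\<close> from the bound of
      \<open>lam * Z\<close>, \<open>8\<close> from \<open>Qlo\<close>, and \<open>64\<close> as the
      square of the factor \<open>8\<close> in the upper bound for \<open>\<delta>\<close>.\<close>
    have lo: "1 / t\<^sup>2 \<le> 2048 * (1 + M\<^sup>2) * (1 + (M + 1)\<^sup>2) * cmod D"
    proof -
      define P where "P = (1 + M\<^sup>2) * (1 + (M + 1)\<^sup>2)"
      have Mp: "1 + M\<^sup>2 > 0" "1 + (M + 1)\<^sup>2 > 0" by (auto simp: add_pos_nonneg)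
      hence P0: "P > 0" by (simp add: P_def)
      have "\<bar>Im z\<bar> \<le> (M + 1) * foc"
      proof -
        have "\<bar>Im z - q\<bar> \<le> t" using abs_Im_le_cmod[of "z - pc"] by (simp add: t_def pc_def)
        thus ?thesis using qM tf(2) by (simp add: algebra_simps)
      qed
      hence "\<bar>Im z\<bar>\<^sup>2 \<le> ((M + 1) * foc)\<^sup>2" by (intro power_mono) auto
      hence "y \<le> (M + 1)\<^sup>2 * foc\<^sup>2" by (simp only: y_def power_mult_distrib power2_abs)
      hence ys: "foc\<^sup>2 + y \<le> (1 + (M + 1)\<^sup>2) * foc\<^sup>2" unfolding distrib_right by linarith
      have "1 / ((1 + (M + 1)\<^sup>2) * foc) = foc / ((1 + (M + 1)\<^sup>2) * foc\<^sup>2)" using foc_pos by (simp add: power2_eq_square)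
      also have "\<dots> \<le> foc / (foc\<^sup>2 + y)" using ys fy foc_pos Mp f2 by (intro divide_left_mono mult_pos_pos) auto
      finally have Zl: "1 / ((1 + (M + 1)\<^sup>2) * foc) \<le> Z" using Zb(1) by linarith
      have "1 / (4 * (1 + M\<^sup>2) * foc) \<le> 1 / (pi * (1 + M\<^sup>2) * foc)" using pi3 Mp foc_pos by (intro divide_left_mono mult_right_mono mult_pos_pos) auto
      hence ll: "1 / (4 * (1 + M\<^sup>2) * foc) \<le> lam" using lb(1) by linarith
      have "1 / (4 * (1 + M\<^sup>2) * foc) * (1 / ((1 + (M + 1)\<^sup>2) * foc)) \<le> lam * Z"
        using ll Zl Mp foc_pos lam_pos by (intro mult_mono) auto
      moreover have "1 / (4 * A * f) * (1 / (B * f)) = 1 / (4 * (A * B) * f\<^sup>2)" for A B f :: real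
        by (simp add: power2_eq_square)
      ultimately have lZ: "1 / (4 * P * foc\<^sup>2) \<le> lam * Z" unfolding P_def by (simp only:)
      have "(cmod \<delta>)\<^sup>2 \<le> (8 * t / foc)\<^sup>2" using \<delta>up by (intro power_mono) auto
      hence "(cmod \<delta>)\<^sup>2 * foc\<^sup>2 \<le> (8 * t / foc)\<^sup>2 * foc\<^sup>2" by (intro mult_right_mono) auto
      moreover have "(8 * t / foc)\<^sup>2 * foc\<^sup>2 = 64 * t\<^sup>2" using foc_pos by (simp add: power_divide power_mult_distrib)
      ultimately have d2: "(cmod \<delta>)\<^sup>2 * foc\<^sup>2 \<le> 64 * t\<^sup>2" by simp
      have "cmod D = lam * Z * (kap\<^sup>2 * cmod Q)" unfolding nD by (simp add: mult_ac)
      moreover have "lam * Z * (kap\<^sup>2 * ((1 / 8) / (cmod w)\<^sup>2)) \<le> lam * Z * (kap\<^sup>2 * cmod Q)"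
        using Qlo lam_pos Z0 by (intro mult_left_mono mult_nonneg_nonneg) auto
      ultimately have "lam * Z * ((1 / 8) / (cmod \<delta>)\<^sup>2) \<le> cmod D" unfolding kk by simp
      moreover have "1 / (4 * P * foc\<^sup>2) * ((1 / 8) / (cmod \<delta>)\<^sup>2) \<le> lam * Z * ((1 / 8) / (cmod \<delta>)\<^sup>2)"
        using lZ by (intro mult_right_mono) auto
      moreover have "1 / (4 * P * foc\<^sup>2) * ((1 / 8) / (cmod \<delta>)\<^sup>2) = 1 / (32 * P * ((cmod \<delta>)\<^sup>2 * foc\<^sup>2))" by simp
      ultimately have l1: "1 / (32 * P * ((cmod \<delta>)\<^sup>2 * foc\<^sup>2)) \<le> cmod D" by linarith
      have "1 / (2048 * P * t\<^sup>2) = 1 / (32 * P * (64 * t\<^sup>2))" by simp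
      also have "\<dots> \<le> 1 / (32 * P * ((cmod \<delta>)\<^sup>2 * foc\<^sup>2))"
        using d2 P0 t0 f2 c\<delta>0 by (intro divide_left_mono mult_left_mono mult_pos_pos) (auto simp: zero_less_power)
      finally have "1 / (2048 * P * t\<^sup>2) \<le> cmod D" using l1 by linarith
      hence "2048 * P * (1 / (2048 * P * t\<^sup>2)) \<le> 2048 * P * cmod D" using P0 by (intro mult_left_mono) auto
      moreover have "2048 * P * (1 / (2048 * P * t\<^sup>2)) = 1 / t\<^sup>2" using P0 by simp
      moreover have "2048 * P * cmod D = 2048 * (1 + M\<^sup>2) * (1 + (M + 1)\<^sup>2) * cmod D" by (simp only: P_def mult.assoc)
      ultimately show ?thesis by simp
    qed
    show ?thesis using up lo by blast
  qed
  have ii: "cmod D \<le> 2 * (1 / (sqrt \<epsilon> * (\<epsilon> + y))) \<and> 1 / (sqrt \<epsilon> * (\<epsilon> + y)) \<le> 64 * (1 + M\<^sup>2) / \<bar>Re a\<bar> * cmod D"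
    if t: "6 / g * \<epsilon> * \<bar>ln \<epsilon>\<bar> \<le> t"
  proof -
    have ln1: "ln \<epsilon> \<le> - 1"
    proof -
      have "1 / 3 \<le> 1 / exp (1::real)" using exp_le by (intro divide_left_mono) auto
      moreover define b where "b = exp (- 1 :: real)"
      ultimately have "1 / 3 \<le> b" by (simp only: exp_minus inverse_eq_divide)
      hence "\<epsilon> \<le> b" "b > 0" using e by linarith+
      hence "ln \<epsilon> \<le> ln b" using eps by (subst ln_le_cancel_iff) auto
      thus ?thesis by (simp add: b_def)
    qed
    \<comment> \<open>The factor \<open>6 / g\<close> yields
      \<open>cmod w \<ge> \<bar>ln \<epsilon>\<bar>\<close>, since \<open>wlow\<close> turns it into
      \<open>2 * \<epsilon> / foc^2\<close>, which is at least one. The exponential is then at most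
      \<open>\<epsilon>\<close>, and \<open>kap * cmod S\<close> is of order
      \<open>sqrt \<epsilon>\<close>.\<close>
    have "6 / g * \<epsilon> * \<bar>ln \<epsilon>\<bar> \<le> m" using t C2 by (simp add: m_def)
    hence "g / 3 * ((6 / g * \<epsilon> * \<bar>ln \<epsilon>\<bar>) / foc\<^sup>2) \<le> g / 3 * (m / foc\<^sup>2)"
      using g0 f2 by (intro mult_left_mono divide_right_mono) auto
    moreover have "g / 3 * ((6 / g * \<epsilon> * \<bar>ln \<epsilon>\<bar>) / foc\<^sup>2) = \<bar>ln \<epsilon>\<bar> * (2 * \<epsilon> / foc\<^sup>2)" using g0 by simp
    moreover have "\<bar>ln \<epsilon>\<bar> * 1 \<le> \<bar>ln \<epsilon>\<bar> * (2 * \<epsilon> / foc\<^sup>2)" using fb(4) f2 by (intro mult_left_mono) auto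
    ultimately have wl: "\<bar>ln \<epsilon>\<bar> \<le> cmod w" using wlow by linarith
    hence w1: "1 \<le> cmod w" using ln1 by linarith
    have "exp (- cmod w) \<le> exp (ln \<epsilon>)" using wl ln1 by simp
    hence ex: "exp (- cmod w) \<le> \<epsilon>" using eps by simp
    have "cmod S \<le> 72 * exp (- cmod w) / (cmod w)\<^sup>2" unfolding S_def using strip_dipole_deriv_le_exp[OF rew w0, of a] norm_a by simp
    also have "\<dots> \<le> 72 * \<epsilon> / 1" using ex w1 one_le_power[OF w1, of 2] eps by (intro frac_le) auto
    finally have "kap * cmod S \<le> kap * (72 * \<epsilon>)" using kap_pos by (intro mult_left_mono) auto
    also have "\<dots> = (kap * sqrt \<epsilon>) * (72 * sqrt \<epsilon>)" using eps by (simp add: mult.assoc mult.left_commute)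
    also have "\<dots> \<le> 2 * (72 * sqrt \<epsilon>)"
    proof -
      have "kap * sqrt \<epsilon> \<le> kap * foc" using fb(1) kap_pos by (intro mult_left_mono) auto
      thus ?thesis using kf(2) sq by (intro mult_right_mono) auto
    qed
    finally have kS: "kap * cmod S \<le> 12 / 100 * \<bar>Re a\<bar>" using s3 by simp
    have kQ1: "kap * cmod Q \<le> 1"
    proof -
      have "kap * cmod Q \<le> kap * (cmod S + cmod T + c0)" using Qle kap_pos by (intro mult_left_mono) auto
      thus ?thesis using kS kT kc2 ra by (simp add: distrib_left)
    qed
    \<comment> \<open>In units of \<open>\<bar>Re a\<bar>\<close>: at least \<open>1 / 2\<close>
      from the linear term, less \<open>12 / 100\<close> for the dipole and \<open>1 / 10\<close>
      for the images, leaves more than \<open>1 / 4\<close>.\<close>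
    have kQ2: "\<bar>Re a\<bar> / 4 \<le> kap * cmod Q"
    proof -
      have "c0 \<le> cmod S + cmod T + cmod Q"
        using norm_triangle_ineq4[of "S + T" Q] norm_triangle_ineq[of S T] unfolding QST c0_def by simp
      hence "kap * c0 \<le> kap * (cmod S + cmod T + cmod Q)" using kap_pos by (intro mult_left_mono) auto
      thus ?thesis using kS kT kc2 ra by (simp add: distrib_left)
    qed
    have lkZ0: "lam * kap * Z \<ge> 0" using lam_pos kap_pos Z0 by simp
    have up: "cmod D \<le> 2 * (1 / (sqrt \<epsilon> * (\<epsilon> + y)))"
    proof -
      have "cmod D \<le> lam * kap * Z * 1" unfolding cD using kQ1 lkZ0 by (intro mult_left_mono) auto
      also have "\<dots> \<le> 2 / (foc * (foc\<^sup>2 + y))" using lkZ by simp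
      also have "\<dots> \<le> 2 / (sqrt \<epsilon> * (\<epsilon> + y))"
        using fb(1,3) sq y0 eps foc_pos fy by (intro divide_left_mono mult_mono mult_pos_pos) auto
      finally show ?thesis by simp
    qed
    have lo: "1 / (sqrt \<epsilon> * (\<epsilon> + y)) \<le> 64 * (1 + M\<^sup>2) / \<bar>Re a\<bar> * cmod D"
    proof -
      define N where "N = 1 + M\<^sup>2"
      have Mp: "N > 0" by (auto simp: N_def add_pos_nonneg)
      have "1 / (pi * N * foc) * (pi / (4 * foc)) * (foc / (foc\<^sup>2 + y)) \<le> lam * kap * Z"
        using lb(1)[folded N_def] kb(1) Zb(1) lam_pos kap_pos foc_pos Mp fy by (intro mult_mono) auto
      moreover have "1 / (pi * N * foc) * (pi / (4 * foc)) * (foc / (foc\<^sup>2 + y)) = 1 / (4 * N * (foc * (foc\<^sup>2 + y)))"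
        using foc_pos by simp
      moreover have "1 / (4 * N * ((2 * sqrt \<epsilon>) * (2 * (\<epsilon> + y)))) \<le> 1 / (4 * N * (foc * (foc\<^sup>2 + y)))"
        using fb(2,4) foc_pos fy y0 Mp sq eps by (intro divide_left_mono mult_left_mono mult_mono mult_pos_pos) auto
      ultimately have "1 / (16 * N * (sqrt \<epsilon> * (\<epsilon> + y))) \<le> lam * kap * Z" by (simp add: mult_ac)
      hence "1 / (16 * N * (sqrt \<epsilon> * (\<epsilon> + y))) * (\<bar>Re a\<bar> / 4) \<le> cmod D"
        unfolding cD using kQ2 lkZ0 by (intro mult_mono) auto
      hence "64 * N / \<bar>Re a\<bar> * (1 / (16 * N * (sqrt \<epsilon> * (\<epsilon> + y))) * (\<bar>Re a\<bar> / 4)) \<le> 64 * N / \<bar>Re a\<bar> * cmod D"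
        using Mp ra by (intro mult_left_mono) auto
      moreover have "64 * N / \<bar>Re a\<bar> * (1 / (16 * N * (sqrt \<epsilon> * (\<epsilon> + y))) * (\<bar>Re a\<bar> / 4)) = 1 / (sqrt \<epsilon> * (\<epsilon> + y))"
      proof -
        have "64 * A / R * (1 / (16 * A * X) * (R / 4)) = 1 / X" if "A \<noteq> 0" "R \<noteq> 0" for A R X :: real
          using that by simp
        thus ?thesis using Mp ra by (metis less_irrefl)
      qed
      ultimately show ?thesis unfolding N_def[symmetric] by (simp only:)
    qed
    show ?thesis using up lo by blast
  qed
  have iii: "cmod D \<le> 576 / g\<^sup>2 * (1 / t\<^sup>2 * exp (- (g / 6) * (t / \<epsilon>))) + 2 * \<epsilon> powr (- 3 / 2)"
    if t: "t < 6 / g * \<epsilon> * \<bar>ln \<epsilon>\<bar>"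
  proof -
    have mt: "m = t" using t C2 by (simp add: m_def)
    have pw: "\<epsilon> powr (- 3 / 2) = 1 / (sqrt \<epsilon> * \<epsilon>)"
    proof -
      have "\<epsilon> powr (3 / 2) = \<epsilon> powr (1 / 2 + 1)" by simp
      also have "\<dots> = sqrt \<epsilon> * \<epsilon>" unfolding powr_add using eps by (simp add: powr_half_sqrt)
      finally have "\<epsilon> powr (3 / 2) = sqrt \<epsilon> * \<epsilon>" .
      thus ?thesis using powr_minus_divide[of \<epsilon> "3 / 2"] by simp
    qed
    \<comment> \<open>The decay rate is \<open>g / 3\<close> from \<open>wlow\<close>, halved by
      \<open>foc^2 \<le> 2 * \<epsilon>\<close>.\<close>
    have "g / 6 * (t / \<epsilon>) = g / 3 * (t / (2 * \<epsilon>))" by simp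
    also have "\<dots> \<le> g / 3 * (t / foc\<^sup>2)" using fb(4) g0 t0 f2 eps by (intro mult_left_mono divide_left_mono) auto
    finally have "g / 6 * (t / \<epsilon>) \<le> cmod w" using wlow unfolding mt by linarith
    hence ex: "exp (- cmod w) \<le> exp (- (g / 6) * (t / \<epsilon>))" by simp
    have "cmod S \<le> 72 * exp (- cmod w) / (cmod w)\<^sup>2" unfolding S_def using strip_dipole_deriv_le_exp[OF rew w0, of a] norm_a by simp
    hence "lam * Z * (kap\<^sup>2 * cmod S) \<le> lam * Z * (kap\<^sup>2 * (72 * exp (- cmod w) / (cmod w)\<^sup>2))"
      using lam_pos Z0 by (intro mult_left_mono mult_nonneg_nonneg) auto
    also have "\<dots> = 72 * exp (- cmod w) * (lam * Z / (cmod \<delta>)\<^sup>2)" unfolding kk by simp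
    also have "\<dots> \<le> 72 * exp (- (g / 6) * (t / \<epsilon>)) * (8 / (g\<^sup>2 * m\<^sup>2))"
      using ex lamZ\<delta> lam_pos Z0 by (intro mult_mono) auto
    also have "72 * E * (8 / (g\<^sup>2 * m\<^sup>2)) = 576 / g\<^sup>2 * (1 / t\<^sup>2 * E)" for E unfolding mt by simp
    finally have p1: "lam * Z * (kap\<^sup>2 * cmod S) \<le> 576 / g\<^sup>2 * (1 / t\<^sup>2 * exp (- (g / 6) * (t / \<epsilon>)))" .
    \<comment> \<open>Images and linear term together are at most \<open>1\<close> after
      multiplication by \<open>kap\<close>; dropping the height \<open>y\<close> from the weight
      leaves the uniform term of order \<open>\<epsilon>\<close> to the power
      \<open>- 3 / 2\<close>.\<close>
    have "lam * kap * Z * (kap * cmod T + kap * c0) \<le> 2 / (foc * (foc\<^sup>2 + y)) * 1"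
      using lkZ kT kc2 ra lam_pos kap_pos Z0 foc_pos fy by (intro mult_mono) (auto simp: c0_def)
    also have "\<dots> \<le> 2 / (sqrt \<epsilon> * \<epsilon>)"
    proof -
      have "sqrt \<epsilon> * \<epsilon> \<le> foc * (foc\<^sup>2 + y)" using fb(1,3) sq y0 eps foc_pos by (intro mult_mono) auto
      thus ?thesis using sq eps foc_pos fy by (simp add: frac_le)
    qed
    finally have p2: "lam * kap * Z * (kap * cmod T + kap * c0) \<le> 2 * \<epsilon> powr (- 3 / 2)" unfolding pw by simp
    have "cmod D \<le> lam * kap\<^sup>2 * (cmod S + cmod T + c0) * Z"
      unfolding nD using Qle lam_pos Z0 by (intro mult_right_mono mult_left_mono) auto
    also have "\<dots> = lam * Z * (kap\<^sup>2 * cmod S) + lam * kap * Z * (kap * cmod T + kap * c0)"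
      by (simp add: power2_eq_square algebra_simps)
    finally show ?thesis using p1 p2 by linarith
  qed
  show ?thesis
    using hasD i ii iii unfolding y_def by blast
qed

end

section \<open>Choice of the constants\<close>

text \<open>With \<open>y\<close> the fourth root of \<open>\<epsilon>\<close>,
  \<open>ln \<epsilon> = 4 * ln y\<close> and \<open>- ln y \<le> 1 / y\<close>; one factor
  \<open>y\<close> survives, which gives an explicit rate of decay.\<close>

lemma sqrt_times_ln_bound:
  fixes \<epsilon> :: real
  assumes "0 < \<epsilon>" "\<epsilon> \<le> 1"
  shows "sqrt \<epsilon> * \<bar>ln \<epsilon>\<bar> \<le> 4 * sqrt (sqrt \<epsilon>)"
proof -
  define y where "y = sqrt (sqrt \<epsilon>)"
  have y: "y > 0" "y \<le> 1" using assms by (auto simp: y_def)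
  have y2: "sqrt \<epsilon> = y * y" using assms by (simp add: y_def)
  have "ln \<epsilon> = 4 * ln y" using assms by (simp add: y_def ln_sqrt)
  moreover have "- ln y \<le> 1 / y"
    using ln_le_minus_one[of "1 / y"] y by (simp add: ln_div)
  moreover have "ln y \<le> 0" using y by simp
  ultimately have "\<bar>ln \<epsilon>\<bar> \<le> 4 / y" by simp
  hence "y * y * \<bar>ln \<epsilon>\<bar> \<le> y * y * (4 / y)" using y by (intro mult_left_mono) auto
  also have "y * y * (4 / y) = 4 * y" using y by simp
  finally show ?thesis unfolding y2[symmetric] by (simp only: y_def)
qed

text \<open>A unit vector with vanishing first component is one of the two vertical ones. For these
  the coefficient \<open>4 * Re a / per\<close> of the linear term is zero, and the lower bound in
  (ii) rests on that term.\<close>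

theorem theorem1p1:
  fixes a :: "real^2" and M :: real
  assumes "norm a = 1"
    and "a \<noteq> vector [0, 1]" and "a \<noteq> - vector [0, 1]"
    and "M > 0"
  shows "\<exists>C\<^sub>1>0. \<exists>C\<^sub>2>0. \<exists>A>0. \<exists>\<epsilon>\<^sub>0>0. \<exists>K>0.
    \<forall>(\<epsilon>::real) (q::real) (p::real^2) (u::real^2 \<Rightarrow> real) (x::real^2).
      0 < \<epsilon> \<longrightarrow> \<epsilon> < \<epsilon>\<^sub>0 \<longrightarrow>
      p = vector [0, q] \<longrightarrow> norm p < M * sqrt \<epsilon> \<longrightarrow>
      dipole_solution \<epsilon> a p u \<longrightarrow>
      x \<in> ball 0 (1/2) - closure (disk \<epsilon> 1 \<union> disk \<epsilon> 2) \<longrightarrow> x \<noteq> p \<longrightarrow>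
      (\<exists>grad. GDERIV u x :> grad \<and>
        (norm (x - p) \<le> C\<^sub>1 * \<epsilon> \<longrightarrow>
           norm grad \<le> K * (1 / (norm (x - p))\<^sup>2) \<and>
           1 / (norm (x - p))\<^sup>2 \<le> K * norm grad) \<and>
        (norm (x - p) \<ge> C\<^sub>2 * \<epsilon> * \<bar>ln \<epsilon>\<bar> \<longrightarrow>
           norm grad \<le> K * (1 / (sqrt \<epsilon> * (\<epsilon> + (x $ 2)\<^sup>2))) \<and>
           1 / (sqrt \<epsilon> * (\<epsilon> + (x $ 2)\<^sup>2)) \<le> K * norm grad) \<and>
        (C\<^sub>1 * \<epsilon> < norm (x - p) \<and> norm (x - p) < C\<^sub>2 * \<epsilon> * \<bar>ln \<epsilon>\<bar> \<longrightarrow>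
           norm grad \<le> K * (1 / (norm (x - p))\<^sup>2 * exp (- A * (norm (x - p) / \<epsilon>))
                            + \<epsilon> powr (-3/2))))"
proof -
  define g th where "g = gap_const M" and "th = gap_angle M"
  define \<alpha> where "\<alpha> = \<bar>a $ 1\<bar>"
  have g0: "g > 0" unfolding g_def by (rule gap_const_pos[OF assms(4)])
  have th0: "th > 0" unfolding th_def by (rule gap_angle_pos[OF assms(4)])
  have na: "cmod (cx a) = 1" using assms(1) by (simp add: norm_cx)
  have \<alpha>0: "\<alpha> > 0"
  proof -
    have "a $ 1 \<noteq> 0"
    proof
      assume a0: "a $ 1 = 0"
      have "(a $ 1)\<^sup>2 + (a $ 2)\<^sup>2 = 1" using na by (simp add: cx_def cmod_def)
      hence "a $ 2 = 1 \<or> a $ 2 = - 1" using a0 by (simp add: power2_eq_1_iff)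
      hence "a = vector [0, 1] \<or> a = - vector [0, 1]" using a0 by (auto simp: vec_eq_iff forall_2)
      thus False using assms(2,3) by blast
    qed
    thus ?thesis by (simp add: \<alpha>_def)
  qed
  \<comment> \<open>All smallness is imposed on the fourth root \<open>y\<close> of
    \<open>\<epsilon>\<close>, through \<open>foc \<le> 2 * y\<close> and
    \<open>sqrt \<epsilon> \<le> y\<close>. In order, the entries provide
    \<open>\<epsilon> \<le> 1 / 256\<close> and the hypotheses \<open>s1\<close>, \<open>s2\<close>,
    \<open>s3\<close> and \<open>s4\<close> of \<open>gradient_estimates\<close>.\<close>
  define \<eta> where "\<eta> = Min {1 / 4, th / 8, \<alpha> * th\<^sup>2 / 2000, \<alpha> / 1200, g / 24}"
  have \<eta>0: "\<eta> > 0" unfolding \<eta>_def using g0 th0 \<alpha>0 by simp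
  have \<eta>: "\<eta> \<le> 1 / 4" "\<eta> \<le> th / 8" "\<eta> \<le> \<alpha> * th\<^sup>2 / 2000" "\<eta> \<le> \<alpha> / 1200" "\<eta> \<le> g / 24"
    unfolding \<eta>_def by (rule Min_le; simp)+
  \<comment> \<open>The sum of the constants of all estimates: it bounds each of them and depends
    only on \<open>a\<close> and \<open>M\<close>.\<close>
  define K where "K = 24 / g\<^sup>2 + 2048 * (1 + M\<^sup>2) * (1 + (M + 1)\<^sup>2) + 2 + 64 * (1 + M\<^sup>2) / \<alpha> + 576 / g\<^sup>2"
  have pos: "24 / g\<^sup>2 \<ge> 0" "2048 * (1 + M\<^sup>2) * (1 + (M + 1)\<^sup>2) \<ge> 0" "64 * (1 + M\<^sup>2) / \<alpha> \<ge> 0" "576 / g\<^sup>2 \<ge> 0"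
    using \<alpha>0 by auto
  have Kb: "24 / g\<^sup>2 \<le> K" "2048 * (1 + M\<^sup>2) * (1 + (M + 1)\<^sup>2) \<le> K" "2 \<le> K" "64 * (1 + M\<^sup>2) / \<alpha> \<le> K" "576 / g\<^sup>2 \<le> K"
    unfolding K_def using pos by linarith+
  have K0: "K > 0" using Kb(3) by linarith
  have "\<exists>grad. GDERIV u x :> grad \<and>
        (norm (x - p) \<le> 1 / 130 * \<epsilon> \<longrightarrow>
           norm grad \<le> K * (1 / (norm (x - p))\<^sup>2) \<and>
           1 / (norm (x - p))\<^sup>2 \<le> K * norm grad) \<and>
        (norm (x - p) \<ge> 6 / g * \<epsilon> * \<bar>ln \<epsilon>\<bar> \<longrightarrow>
           norm grad \<le> K * (1 / (sqrt \<epsilon> * (\<epsilon> + (x $ 2)\<^sup>2))) \<and>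
           1 / (sqrt \<epsilon> * (\<epsilon> + (x $ 2)\<^sup>2)) \<le> K * norm grad) \<and>
        (1 / 130 * \<epsilon> < norm (x - p) \<and> norm (x - p) < 6 / g * \<epsilon> * \<bar>ln \<epsilon>\<bar> \<longrightarrow>
           norm grad \<le> K * (1 / (norm (x - p))\<^sup>2 * exp (- (g / 6) * (norm (x - p) / \<epsilon>))
                            + \<epsilon> powr (-3/2)))"
    if e0: "0 < \<epsilon>" "\<epsilon> < \<eta> ^ 4" and p: "p = vector [0, q]" "norm p < M * sqrt \<epsilon>"
      and sol: "dipole_solution \<epsilon> a p u" and x: "x \<in> ball 0 (1/2) - closure (disk \<epsilon> 1 \<union> disk \<epsilon> 2)" "x \<noteq> p"
    for \<epsilon> q :: real and p x :: "real^2" and u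
  proof -
    interpret two_disks \<epsilon> q "cx a" using e0 na by unfold_locales auto
    define z where "z = cx x"
    define y where "y = sqrt (sqrt \<epsilon>)"
    have y0: "y > 0" using eps by (simp add: y_def)
    have y4: "y ^ 4 = \<epsilon>"
    proof -
      have "y ^ 4 = (y\<^sup>2)\<^sup>2" by simp
      also have "y\<^sup>2 = sqrt \<epsilon>" using eps by (simp add: y_def)
      also have "(sqrt \<epsilon>)\<^sup>2 = \<epsilon>" using eps by simp
      finally show ?thesis .
    qed
    have y\<eta>: "y < \<eta>" using e0(2) y4 \<eta>0 by (metis power_less_imp_less_base less_imp_le)
    have y1: "y \<le> 1" using y\<eta> \<eta>(1) by linarith
    have sy: "sqrt \<epsilon> = y * y" using eps by (simp add: y_def)
    have sy': "sqrt \<epsilon> \<le> y" unfolding sy using y0 y1 by (simp add: mult_left_le)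
    have e256: "\<epsilon> \<le> 1 / 256"
    proof -
      have "y ^ 4 \<le> (1 / 4) ^ 4" using y\<eta> \<eta>(1) y0 by (intro power_mono) auto
      thus ?thesis by (simp add: y4 power_divide)
    qed
    have e4: "\<epsilon> \<le> 1 / 4" using e256 by simp
    note fb = foc_bounds[OF e4]
    have f2y: "foc \<le> 2 * y" using fb(2) sy' by linarith
    have qM: "\<bar>q\<bar> \<le> M * foc"
    proof -
      have "norm p = \<bar>q\<bar>" using norm_cx[of p] by (simp add: p(1) cx_def complex_norm)
      moreover have "M * sqrt \<epsilon> \<le> M * foc" using fb(1) assms(4) by (intro mult_left_mono) auto
      ultimately show ?thesis using p(2) by linarith
    qed
    have rea: "\<bar>Re (cx a)\<bar> = \<alpha>" by (simp add: cx_def \<alpha>_def)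
    have xe: "x \<in> exterior_domain \<epsilon>" using x by (simp add: exterior_domain_def)
    have ze: "1 \<le> cmod (z - of_real ctr)" "1 \<le> cmod (z + of_real ctr)"
      using xe by (auto simp: exterior_domain_eq dist_centers_cx z_def)
    have zh: "cmod z < 1 / 2" using x by (simp add: z_def norm_cx)
    have zp: "z \<noteq> pc" using x(2) cx_eq_pc[of x] by (simp add: z_def p(1))
    have tn: "cmod (z - pc) = norm (x - p)" by (simp add: z_def p(1) norm_cx flip: cx_p cx_diff)
    have imz: "Im z = x $ 2" by (simp add: z_def cx_def)
    have s1: "4 * foc \<le> gap_angle M" using f2y y\<eta> \<eta>(2) by (simp add: th_def)
    have s2: "1000 * foc \<le> \<bar>Re (cx a)\<bar> * (gap_angle M)\<^sup>2" using f2y y\<eta> \<eta>(3) by (simp add: rea flip: th_def)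
    have s3: "1200 * sqrt \<epsilon> \<le> \<bar>Re (cx a)\<bar>" using sy' y\<eta> \<eta>(4) by (simp add: rea)
    have s4: "6 / gap_const M * (sqrt \<epsilon> * \<bar>ln \<epsilon>\<bar>) \<le> 1"
    proof -
      have "6 / g * (sqrt \<epsilon> * \<bar>ln \<epsilon>\<bar>) \<le> 6 / g * (4 * y)"
        unfolding y_def using sqrt_times_ln_bound[of \<epsilon>] eps e4 g0 by (intro mult_left_mono) auto
      also have "\<dots> \<le> 6 / g * (4 * (g / 24))" using y\<eta> \<eta>(5) g0 by (intro mult_left_mono) auto
      also have "\<dots> = 1" using g0 by simp
      finally show ?thesis by (simp add: g_def)
    qed
    have ra0: "Re (cx a) \<noteq> 0" using rea \<alpha>0 by auto
    obtain D where D: "(pot has_field_derivative D) (at z)"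
      and i: "norm (x - p) \<le> \<epsilon> / 130 \<Longrightarrow> cmod D \<le> 24 / g\<^sup>2 * (1 / (norm (x - p))\<^sup>2)"
        "norm (x - p) \<le> \<epsilon> / 130 \<Longrightarrow> 1 / (norm (x - p))\<^sup>2 \<le> 2048 * (1 + M\<^sup>2) * (1 + (M + 1)\<^sup>2) * cmod D"
      and ii: "6 / g * \<epsilon> * \<bar>ln \<epsilon>\<bar> \<le> norm (x - p) \<Longrightarrow> cmod D \<le> 2 * (1 / (sqrt \<epsilon> * (\<epsilon> + (x $ 2)\<^sup>2)))"
        "6 / g * \<epsilon> * \<bar>ln \<epsilon>\<bar> \<le> norm (x - p) \<Longrightarrow> 1 / (sqrt \<epsilon> * (\<epsilon> + (x $ 2)\<^sup>2)) \<le> 64 * (1 + M\<^sup>2) / \<alpha> * cmod D"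
      and iii: "norm (x - p) < 6 / g * \<epsilon> * \<bar>ln \<epsilon>\<bar> \<Longrightarrow>
         cmod D \<le> 576 / g\<^sup>2 * (1 / (norm (x - p))\<^sup>2 * exp (- (g / 6) * (norm (x - p) / \<epsilon>))) + 2 * \<epsilon> powr (- 3 / 2)"
      using gradient_estimates[OF assms(4) qM ra0 e256 s1 s2 s3 s4 ze zh zp]
      unfolding tn imz rea g_def[symmetric] by blast
    obtain grad where grad: "GDERIV u x :> grad" "norm grad = cmod D"
      using solution_gradient[OF sol[unfolded p(1)] refl xe x(2)[unfolded p(1)] D[unfolded z_def]] by blast
    have up: "c * X \<le> K * X" if "c \<le> K" "X \<ge> 0" for c X :: real using that by (rule mult_right_mono)
    have n0: "1 / (norm (x - p))\<^sup>2 \<ge> 0" "1 / (sqrt \<epsilon> * (\<epsilon> + (x $ 2)\<^sup>2)) \<ge> 0" "norm grad \<ge> 0"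
        "1 / (norm (x - p))\<^sup>2 * exp (- (g / 6) * (norm (x - p) / \<epsilon>)) \<ge> 0" "\<epsilon> powr (- 3 / 2) \<ge> 0"
      using eps by auto
    show ?thesis
    proof (intro exI[of _ grad] conjI impI grad(1))
      assume t: "norm (x - p) \<le> 1 / 130 * \<epsilon>"
      show "norm grad \<le> K * (1 / (norm (x - p))\<^sup>2)" using i(1) t up[OF Kb(1) n0(1)] grad(2) by simp
      show "1 / (norm (x - p))\<^sup>2 \<le> K * norm grad" using i(2) t up[OF Kb(2) n0(3)] grad(2) by simp
    next
      assume t: "6 / g * \<epsilon> * \<bar>ln \<epsilon>\<bar> \<le> norm (x - p)"
      show "norm grad \<le> K * (1 / (sqrt \<epsilon> * (\<epsilon> + (x $ 2)\<^sup>2)))" using ii(1)[OF t] up[OF Kb(3) n0(2)] grad(2) by linarith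
      show "1 / (sqrt \<epsilon> * (\<epsilon> + (x $ 2)\<^sup>2)) \<le> K * norm grad" using ii(2)[OF t] up[OF Kb(4) n0(3)] grad(2) by simp
    next
      assume t: "1 / 130 * \<epsilon> < norm (x - p) \<and> norm (x - p) < 6 / g * \<epsilon> * \<bar>ln \<epsilon>\<bar>"
      show "norm grad \<le> K * (1 / (norm (x - p))\<^sup>2 * exp (- (g / 6) * (norm (x - p) / \<epsilon>)) + \<epsilon> powr (-3/2))"
        using iii[OF conjunct2[OF t]] up[OF Kb(5) n0(4)] up[OF Kb(3) n0(5)] grad(2) unfolding distrib_left by linarith
    qed
  qed
  note main = this
  have "\<eta> ^ 4 > 0" "6 / g > 0" "g / 6 > 0" "1 / 130 > (0::real)" using \<eta>0 g0 by auto
  show ?thesis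
    by (rule exI[of _ "1 / 130"], rule conjI, simp, rule exI[of _ "6 / g"], rule conjI, fact, rule exI[of _ "g / 6"], rule conjI, fact,
        rule exI[of _ "\<eta> ^ 4"], rule conjI, fact, rule exI[of _ K], rule conjI, fact K0, intro allI impI, rule main)
qed

end
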